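(* Let $c\ge 0$ and $\kappa\in\mathbb{R}$. (i) If $(c,\kappa)\notin\mathcal{D}$ and $u\in\mathcal{X}(\mathbb{R})\cap C^2(\mathbb{R})$ is a solution to $\mathrm{TW}(c,\kappa)$, then there exists $\phi\in\mathbb{R}$ such that $u(x)=e^{i\phi}$ for all $x\in\mathbb{R}$. (ii) For $(c,\kappa)\in\mathcal{D}$, let $\eta_{c,\kappa}:\mathbb{R}\to\mathbb{R}$ be $\eta_{c,\kappa}=\mathcal{F}_{c,\kappa}$ if $(c,\kappa)\in\mathcal{D}_1$, $\eta_{c,\kappa}=\mathcal{G}_{c,\kappa}$ if $(c,\kappa)\in\mathcal{D}_2$, and $\eta_{c,\kappa}=\mathcal{H}_{c,\kappa}$ if $(c,\kappa)\in\mathcal{D}_3$. If $c>0$, then $\eta_{c,\kappa}<1$ on $\mathbb{R}$, and $u_{c,\kappa}=\rho_{c,\kappa}e^{i\theta_{c,\kappa}}$, where $$\rho_{c,\kappa}(x)=\sqrt{1-\eta_{c,\kappa}(x)},\qquad \theta_{c,\kappa}(x)=\frac c2\int_0^x\frac{\eta_{c,\kappa}(y)}{1-\eta_{c,\kappa}(y)}\,dy,$$ is the unique nontrivial solution to $\mathrm{TW}(c,\kappa)$ in $C^2(\mathbb{R})\cap\mathcal{X}(\mathbb{R})$, up to invariances. If $c=0$, then the real-valued odd function $u_{0,\kappa}(x)=\pm\sqrt{1-\eta_{0,\kappa}(x)}$, for all $\pm x\ge 0$, is the unique nontrivial solution to $\mathrm{TW}(0,\kappa)$ in $C^2(\mathbb{R})\cap\mathcal{X}(\mathbb{R})$,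 up to invariances. In addition, for any $(c,\kappa)\in\mathcal{D}$, $u_{c,\kappa}\in C^\infty(\mathbb{R})$, and $\eta_{c,\kappa}$ is even and reaches a global extremum at the origin with $\eta_{c,\kappa}(0)=1-c^2/2$. Moreover, $\eta_{c,\kappa}>0$ and $\eta_{c,\kappa}'<0$ on $(0,\infty)$ if $(c,\kappa)\in\mathcal{D}_1\cup\mathcal{D}_2$, while $\eta_{c,\kappa}<0$ and $\eta_{c,\kappa}'>0$ on $(0,\infty)$ if $(c,\kappa)\in\mathcal{D}_3$. Finally, for every $k\in\mathbb{N}$ there exist constants $A,C>0$ such that $$|D^k u_{c,\kappa}'(x)|+|D^k\eta_{c,\kappa}(x)|\le A e^{-C|x|},\quad\text{for all }x\in\mathbb{R}.$$
   Context: Energy space: $\mathcal{X}(\mathbb{R})=\{v\in H^1_{\mathrm{loc}}(\mathbb{R};\mathbb{C}): 1-|v|^2\in L^2(\mathbb{R}),\ v'\in L^2(\mathbb{R})\}$. Equation $\mathrm{TW}(c,\kappa)$, for $u:\mathbb{R}\to\mathbb{C}$: $\ icu'+u''+u(1-|u|^2)+\kappa u\,(1-|u|^2)''=0$ on $\mathbb{R}$. A solution is trivial if it is a constant function of modulus one. "Up to invariances" means up to a translation and multiplication by a constant phase: $u\mapsto e^{i\phi}u(\cdot-x_0)$, $\phi,x_0\in\mathbb{R}$. Parameter sets: $\mathcal{D}_1=\{0\le c<\sqrt2,\ 0<\kappa<1/2\}$, $\mathcal{D}_2=\{0\le c<\sqrt2,\ \kappa\le 0\}$, $\mathcal{D}_3=\{c>\sqrt2,\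 \kappa>1/2\}$, $\mathcal{D}=\mathcal{D}_1\cup\mathcal{D}_2\cup\mathcal{D}_3$. Functions: for $c<\sqrt2$ put $\mathcal{I}_c=(0,1-c^2/2]$; for $c>\sqrt2$ put $\mathcal{J}_c=[1-c^2/2,0)$. For $(c,\kappa)\in\mathcal{D}_1$ and $y\in\mathcal{I}_c$, $$F_{c,\kappa}(y)=2\sqrt{\kappa}\arctan\Big(\sqrt{\kappa}\sqrt{\tfrac{2-c^2-2y}{1-2\kappa+2\kappa y}}\Big)+2\sqrt{\tfrac{1-2\kappa}{2-c^2}}\operatorname{artanh}\Big(\sqrt{\tfrac{(1-2\kappa)(2-c^2-2y)}{(2-c^2)(1-2\kappa+2\kappa y)}}\Big).$$ For $(c,\kappa)\in\mathcal{D}_2$ and $y\in\mathcal{I}_c$, $$G_{c,\kappa}(y)=-2\sqrt{-\kappa}\operatorname{artanh}\Big(\sqrt{-\kappa}\sqrt{\tfrac{2-c^2-2y}{1-2\kappa+2\kappa y}}\Big)+2\sqrt{\tfrac{1-2\kappa}{2-c^2}}\operatorname{artanh}\Big(\sqrt{\tfrac{(1-2\kappa)(2-c^2-2y)}{(2-c^2)(1-2\kappa+2\kappa y)}}\Big).$$ For $(c,\kappa)\in\mathcal{D}_3$ and $y\in\mathcal{J}_c$, $H_{c,\kappa}(y)$ is given by the same formula as $F_{c,\kappa}(y)$. These functions are well-defined, continuous, injective, vanish at $y=1-c^2/2$ and tend to $+\infty$ as $y\to0$, so they are bijections onto $[0,\infty)$. $\mathcal{F}_{c,\kappa},\mathcal{G}_{c,\kappa},\mathcal{H}_{c,\kappa}$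 denote the inverses of $F_{c,\kappa},G_{c,\kappa},H_{c,\kappa}$ respectively, extended from $[0,\infty)$ to $\mathbb{R}$ as even functions. *)

theory Defs
  imports "HOL-Analysis.Analysis"
begin

section \<open>Function spaces on the real line\<close>

definition iter_deriv :: "nat \<Rightarrow> (real \<Rightarrow> 'a::real_normed_vector) \<Rightarrow> real \<Rightarrow> 'a" where
  "iter_deriv k f = ((\<lambda>g x. vector_derivative g (at x)) ^^ k) f"

text \<open>\<^const>\<open>vector_derivative\<close> is arbitrary at points of non-differentiability, hence the explicit
  differentiability requirement.\<close>
definition C_k :: "nat \<Rightarrow> (real \<Rightarrow> 'a::real_normed_vector) set" where
  "C_k k = {f. (\<forall>j<k. \<forall>x. iter_deriv j f differentiable at x) \<and> continuous_on UNIV (iter_deriv k f)}"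

definition C_infinity :: "(real \<Rightarrow> 'a::real_normed_vector) set" where
  "C_infinity = (\<Inter>k. C_k k)"

definition test_functions :: "(real \<Rightarrow> real) set" where
  "test_functions = {\<phi> \<in> C_infinity. compact (closure {x. \<phi> x \<noteq> 0})}"

definition L1_loc :: "(real \<Rightarrow> 'a::euclidean_space) set" where
  "L1_loc = {f. \<forall>K. compact K \<longrightarrow> set_integrable lebesgue K f}"

definition L2 :: "(real \<Rightarrow> 'a::euclidean_space) set" where
  "L2 = {f \<in> borel_measurable lebesgue. integrable lebesgue (\<lambda>x. (norm (f x))\<^sup>2)}"

definition L2_loc :: "(real \<Rightarrow> 'a::euclidean_space) set" where
  "L2_loc = {f \<in> borel_measurable lebesgue. (\<lambda>x. (norm (f x))\<^sup>2) \<in> L1_loc}"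

definition has_weak_derivative ::
    "(real \<Rightarrow> 'a::euclidean_space) \<Rightarrow> (real \<Rightarrow> 'a) \<Rightarrow> bool" where
  "has_weak_derivative v w \<longleftrightarrow> v \<in> L1_loc \<and> w \<in> L1_loc \<and>
     (\<forall>\<phi>\<in>test_functions.
        (LINT x|lebesgue. iter_deriv 1 \<phi> x *\<^sub>R v x) = - (LINT x|lebesgue. \<phi> x *\<^sub>R w x))"

definition H1_loc :: "(real \<Rightarrow> 'a::euclidean_space) set" where
  "H1_loc = {v \<in> L2_loc. \<exists>w\<in>L2_loc. has_weak_derivative v w}"

text \<open>Weak derivatives are unique up to null sets, so the existential expresses that the weak
  derivative of \<open>v\<close> is square integrable.\<close>
definition energy_space :: "(real \<Rightarrow> complex) set" where
  "energy_space = {v \<in> H1_loc. (\<lambda>x. 1 - (cmod (v x))\<^sup>2) \<in> L2 \<and> (\<exists>w\<in>L2. has_weak_derivative v w)}"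


section \<open>The travelling wave equation\<close>

text \<open>The derivatives are classical; the predicate is only meaningful for \<open>u \<in> C_k 2\<close>.\<close>
definition TW :: "real \<Rightarrow> real \<Rightarrow> (real \<Rightarrow> complex) \<Rightarrow> bool" where
  "TW c \<kappa> u \<longleftrightarrow> (\<forall>x.
     \<i> * of_real c * iter_deriv 1 u x + iter_deriv 2 u x + u x * of_real (1 - (cmod (u x))\<^sup>2)
       + of_real \<kappa> * u x * of_real (iter_deriv 2 (\<lambda>y. 1 - (cmod (u y))\<^sup>2) x) = 0)"

definition trivial_solution :: "(real \<Rightarrow> complex) \<Rightarrow> bool" where
  "trivial_solution u \<longleftrightarrow> (\<exists>a. cmod a = 1 \<and> u = (\<lambda>_. a))"

definition nontrivial_solution :: "real \<Rightarrow> real \<Rightarrow> (real \<Rightarrow> complex) \<Rightarrow> bool" where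
  "nontrivial_solution c \<kappa> u \<longleftrightarrow> u \<in> C_k 2 \<inter> energy_space \<and> TW c \<kappa> u \<and> \<not> trivial_solution u"

definition unique_nontrivial_solution :: "real \<Rightarrow> real \<Rightarrow> (real \<Rightarrow> complex) \<Rightarrow> bool" where
  "unique_nontrivial_solution c \<kappa> u \<longleftrightarrow> nontrivial_solution c \<kappa> u \<and>
     (\<forall>v. nontrivial_solution c \<kappa> v \<longrightarrow> (\<exists>\<phi> x0. v = (\<lambda>x. cis \<phi> * u (x - x0))))"


section \<open>Parameter sets and profiles\<close>

definition D1 :: "(real \<times> real) set" where
  "D1 = {(c, \<kappa>). 0 \<le> c \<and> c < sqrt 2 \<and> 0 < \<kappa> \<and> \<kappa> < 1 / 2}"

definition D2 :: "(real \<times> real) set" where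
  "D2 = {(c, \<kappa>). 0 \<le> c \<and> c < sqrt 2 \<and> \<kappa> \<le> 0}"

definition D3 :: "(real \<times> real) set" where
  "D3 = {(c, \<kappa>). c > sqrt 2 \<and> \<kappa> > 1 / 2}"

definition DD :: "(real \<times> real) set" where
  "DD = D1 \<union> D2 \<union> D3"

definition I_int :: "real \<Rightarrow> real set" where
  "I_int c = {0<..1 - c\<^sup>2 / 2}"

definition J_int :: "real \<Rightarrow> real set" where
  "J_int c = {1 - c\<^sup>2 / 2..<0}"

definition F_fun :: "real \<Rightarrow> real \<Rightarrow> real \<Rightarrow> real" where
  "F_fun c \<kappa> y =
     2 * sqrt \<kappa> * arctan (sqrt \<kappa> * sqrt ((2 - c\<^sup>2 - 2 * y) / (1 - 2 * \<kappa> + 2 * \<kappa> * y)))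
     + 2 * sqrt ((1 - 2 * \<kappa>) / (2 - c\<^sup>2))
         * artanh (sqrt (((1 - 2 * \<kappa>) * (2 - c\<^sup>2 - 2 * y)) / ((2 - c\<^sup>2) * (1 - 2 * \<kappa> + 2 * \<kappa> * y))))"

definition G_fun :: "real \<Rightarrow> real \<Rightarrow> real \<Rightarrow> real" where
  "G_fun c \<kappa> y =
     - 2 * sqrt (- \<kappa>) * artanh (sqrt (- \<kappa>) * sqrt ((2 - c\<^sup>2 - 2 * y) / (1 - 2 * \<kappa> + 2 * \<kappa> * y)))
     + 2 * sqrt ((1 - 2 * \<kappa>) / (2 - c\<^sup>2))
         * artanh (sqrt (((1 - 2 * \<kappa>) * (2 - c\<^sup>2 - 2 * y)) / ((2 - c\<^sup>2) * (1 - 2 * \<kappa> + 2 * \<kappa> * y))))"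

definition H_fun :: "real \<Rightarrow> real \<Rightarrow> real \<Rightarrow> real" where
  "H_fun c \<kappa> y = F_fun c \<kappa> y"

definition F_inv :: "real \<Rightarrow> real \<Rightarrow> real \<Rightarrow> real" where
  "F_inv c \<kappa> x = the_inv_into (I_int c) (F_fun c \<kappa>) \<bar>x\<bar>"

definition G_inv :: "real \<Rightarrow> real \<Rightarrow> real \<Rightarrow> real" where
  "G_inv c \<kappa> x = the_inv_into (I_int c) (G_fun c \<kappa>) \<bar>x\<bar>"

definition H_inv :: "real \<Rightarrow> real \<Rightarrow> real \<Rightarrow> real" where
  "H_inv c \<kappa> x = the_inv_into (J_int c) (H_fun c \<kappa>) \<bar>x\<bar>"

text \<open>Only used for \<open>(c, \<kappa>) \<in> DD\<close>; the three sets are disjoint, and the last branch is then \<open>D3\<close>.\<close>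
definition eta :: "real \<Rightarrow> real \<Rightarrow> real \<Rightarrow> real" where
  "eta c \<kappa> = (if (c, \<kappa>) \<in> D1 then F_inv c \<kappa>
               else if (c, \<kappa>) \<in> D2 then G_inv c \<kappa>
               else H_inv c \<kappa>)"

definition rho :: "real \<Rightarrow> real \<Rightarrow> real \<Rightarrow> real" where
  "rho c \<kappa> x = sqrt (1 - eta c \<kappa> x)"

definition theta :: "real \<Rightarrow> real \<Rightarrow> real \<Rightarrow> real" where
  "theta c \<kappa> x = c / 2 * (LBINT y=0..x. eta c \<kappa> y / (1 - eta c \<kappa> y))"

text \<open>For \<open>c = 0\<close> the two prescriptions at the origin agree because \<open>eta 0 \<kappa> 0 = 1\<close>.\<close>
definition u_sol :: "real \<Rightarrow> real \<Rightarrow> real \<Rightarrow> complex" where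
  "u_sol c \<kappa> x =
     (if c = 0
      then of_real (if 0 \<le> x then sqrt (1 - eta 0 \<kappa> x) else - sqrt (1 - eta 0 \<kappa> x))
      else of_real (rho c \<kappa> x) * cis (theta c \<kappa> x))"

end

(*
  With eta = 1 - |u|^2, momentum and energy conservation give, for finite energy, the two relations
  Im (cnj u u') = c eta / 2 and |u'|^2 = eta^2 / 2 + kappa eta'^2 / 2, hence the profile equation
  eta'^2 (1 - 2 kappa + 2 kappa eta) = eta^2 (2 - c^2 - 2 eta).  The logarithmic slope s = - eta' / eta
  turns it into the scalar equation s' = (1 + kappa s^2) (a - b s^2) / d with a = 1 - c^2 / 2,
  b = 1/2 - kappa, d = 1 - kappa c^2, and eta = (a - b s^2) / (1 + kappa s^2).  The functions F, G and H,
  written in terms of s, are the time map of that equation, so the profile is smooth and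
  decays exponentially, and it is unique up to translation.  Given the profile, u solves a linear first
  order equation: u' = u (a - b s^2) / (s - i c).
*)

theory Submission
  imports Defs
begin

section \<open>Functions with exponentially decaying derivatives\<close>

text \<open>The first-order profile equation loses uniqueness at the crest: the constant
  \<open>a\<close> also solves it there, because the square root of \<open>a - eta\<close> is not
  Lipschitz. The signed slope \<open>s\<close> removes this obstacle. Its square is the radicand in
  F, G and H, and its vector field is polynomial, with the crest at the regular point
  \<open>s = 0\<close> and the two ends of the line at the equilibria
  \<open>s\<^sup>2 = a / b\<close>. Smoothness becomes a bootstrap, and no existence theorem for
  differential equations is used. On \<open>DD\<close> the numbers \<open>a\<close>,
  \<open>b\<close>, \<open>d\<close> share one sign, so working with their ratios treats the three
  parameter sets together. Off \<open>DD\<close> the signs of \<open>a\<close> and \<open>b\<close>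
  clash: \<open>a = 0\<close> leaves 0 as the only extremal value, opposite signs isolate the value
  0 of the profile, and \<open>b = 0\<close> produces a harmonic oscillation, which has infinite
  energy. Finite energy gives no limit at infinity, only points where the energy density is small;
  the constants of the first integrals are fixed at such points. For \<open>c = 0\<close> the wave
  has a zero, where \<open>u' / u\<close> has a pole. The formula for \<open>u\<close> and the
  uniqueness argument therefore need a version of their own.\<close>

definition exp_dominated :: "real \<Rightarrow> (real \<Rightarrow> 'a::real_normed_vector) \<Rightarrow> bool" where
  "exp_dominated C f \<longleftrightarrow> (\<exists>A. \<forall>x. norm (f x) \<le> A * exp (- C * \<bar>x\<bar>))"

text \<open>The rate \<open>C = 0\<close> stands for plain boundedness. The derivative is an
  existential witness and not \<open>vector_derivative\<close>, which makes differentiability part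
  of the statement and lets the closure rules go by induction on \<open>n\<close>.\<close>

primrec decays :: "real \<Rightarrow> nat \<Rightarrow> (real \<Rightarrow> 'a::real_normed_vector) \<Rightarrow> bool" where
  "decays C 0 f \<longleftrightarrow> exp_dominated C f"
| "decays C (Suc n) f \<longleftrightarrow> exp_dominated C f \<and>
     (\<exists>f'. (\<forall>x. (f has_vector_derivative f' x) (at x)) \<and> decays C n f')"

lemma exp_dominatedI: "(\<And>x. norm (f x) \<le> A * exp (- C * \<bar>x\<bar>)) \<Longrightarrow> exp_dominated C f"
  unfolding exp_dominated_def by blast

lemma exp_dominated_pos:
  assumes "exp_dominated C f"
  obtains A where "A > 0" "\<And>x. norm (f x) \<le> A * exp (- C * \<bar>x\<bar>)"
proof -
  from assms obtain A where A: "\<And>x. norm (f x) \<le> A * exp (- C * \<bar>x\<bar>)"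
    unfolding exp_dominated_def by blast
  have "norm (f x) \<le> max A 1 * exp (- C * \<bar>x\<bar>)" for x
    using A[of x] by (rule order_trans) (simp add: mult_right_mono)
  then show ?thesis by (intro that[of "max A 1"]) auto
qed

lemma exp_dominated_0_iff: "exp_dominated 0 f \<longleftrightarrow> (\<exists>A. \<forall>x. norm (f x) \<le> A)"
  by (simp add: exp_dominated_def)

lemma exp_dominated_linear:
  assumes "bounded_linear L" "exp_dominated C f"
  shows "exp_dominated C (\<lambda>x. L (f x))"
proof -
  obtain K where K: "K > 0" "\<And>y. norm (L y) \<le> norm y * K"
    using bounded_linear.pos_bounded[OF assms(1)] by blast
  obtain A where A: "A > 0" "\<And>x. norm (f x) \<le> A * exp (- C * \<bar>x\<bar>)"
    using assms(2) by (rule exp_dominated_pos) blast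
  have "norm (L (f x)) \<le> (A * K) * exp (- C * \<bar>x\<bar>)" for x
  proof -
    have "norm (L (f x)) \<le> norm (f x) * K" by (rule K)
    also have "\<dots> \<le> (A * exp (- C * \<bar>x\<bar>)) * K" by (intro mult_right_mono A) (use K in auto)
    finally show ?thesis by (simp add: mult_ac)
  qed
  then show ?thesis by (rule exp_dominatedI)
qed

lemma exp_dominated_add:
  assumes "exp_dominated C f" "exp_dominated C g"
  shows "exp_dominated C (\<lambda>x. f x + g x)"
proof -
  obtain A where A: "\<And>x. norm (f x) \<le> A * exp (- C * \<bar>x\<bar>)" using assms(1) by (rule exp_dominated_pos) blast
  obtain B where B: "\<And>x. norm (g x) \<le> B * exp (- C * \<bar>x\<bar>)" using assms(2) by (rule exp_dominated_pos) blast
  have "norm (f x + g x) \<le> (A + B) * exp (- C * \<bar>x\<bar>)" for x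
    using norm_triangle_ineq[of "f x" "g x"] A[of x] B[of x] by (simp add: distrib_right)
  then show ?thesis by (rule exp_dominatedI)
qed

lemma exp_dominated_mult:
  fixes f g :: "real \<Rightarrow> 'a::real_normed_algebra"
  assumes "exp_dominated B f" "exp_dominated C g"
  shows "exp_dominated (B + C) (\<lambda>x. f x * g x)"
proof -
  obtain A1 where A1: "A1 > 0" "\<And>x. norm (f x) \<le> A1 * exp (- B * \<bar>x\<bar>)" using assms(1) by (rule exp_dominated_pos) blast
  obtain A2 where A2: "A2 > 0" "\<And>x. norm (g x) \<le> A2 * exp (- C * \<bar>x\<bar>)" using assms(2) by (rule exp_dominated_pos) blast
  have "norm (f x * g x) \<le> (A1 * A2) * exp (- (B + C) * \<bar>x\<bar>)" for x
  proof -
    have "norm (f x * g x) \<le> norm (f x) * norm (g x)" by (rule norm_mult_ineq)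
    also have "\<dots> \<le> (A1 * exp (- B * \<bar>x\<bar>)) * (A2 * exp (- C * \<bar>x\<bar>))"
      by (intro mult_mono A1 A2) (use A1 in auto)
    also have "\<dots> = (A1 * A2) * (exp (- B * \<bar>x\<bar>) * exp (- C * \<bar>x\<bar>))" by (simp add: mult_ac)
    also have "exp (- B * \<bar>x\<bar>) * exp (- C * \<bar>x\<bar>) = exp (- (B + C) * \<bar>x\<bar>)"
      by (simp add: exp_add[symmetric] algebra_simps)
    finally show ?thesis .
  qed
  then show ?thesis by (rule exp_dominatedI)
qed

lemma decays_imp_dominated: "decays C n f \<Longrightarrow> exp_dominated C f"
  by (cases n) auto

lemma decays_Suc_imp:
  assumes "decays C (Suc n) f"
  shows "decays C n f"
  using assms
proof (induction n arbitrary: f)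
  case (Suc n)
  from Suc.prems obtain f' where f': "\<And>x. (f has_vector_derivative f' x) (at x)" "decays C (Suc n) f'"
    unfolding decays.simps(2)[of _ "Suc n"] by blast
  have "exp_dominated C f" using Suc.prems unfolding decays.simps(2)[of _ "Suc n"] by blast
  then show ?case using f'(1) Suc.IH[OF f'(2)] unfolding decays.simps(2)[of _ n] by blast
qed simp

lemma decaysE:
  assumes "decays C (Suc n) f"
  obtains f' where "\<And>x. (f has_vector_derivative f' x) (at x)" "decays C n f'"
  using assms by auto

lemma decays_SucI:
  "exp_dominated C f \<Longrightarrow> (\<And>x. (f has_vector_derivative f' x) (at x)) \<Longrightarrow> decays C n f' \<Longrightarrow> decays C (Suc n) f"
  by auto

lemma decays_mono:
  assumes "decays C n f" "B \<le> C"
  shows "decays B n f"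
proof -
  have dom: "exp_dominated B g" if g: "exp_dominated C g" for g :: "real \<Rightarrow> 'a"
  proof -
    obtain A where A: "A > 0" "\<And>x. norm (g x) \<le> A * exp (- C * \<bar>x\<bar>)"
      using g by (rule exp_dominated_pos) blast
    have "norm (g x) \<le> A * exp (- B * \<bar>x\<bar>)" for x
    proof -
      have "- C * \<bar>x\<bar> \<le> - B * \<bar>x\<bar>" using assms(2) by (simp add: mult_right_mono)
      then have "A * exp (- C * \<bar>x\<bar>) \<le> A * exp (- B * \<bar>x\<bar>)" using A(1) by simp
      with A(2)[of x] show ?thesis by linarith
    qed
    then show ?thesis by (rule exp_dominatedI)
  qed
  from assms(1) show ?thesis
    by (induction n arbitrary: f) (use dom in auto)
qed

lemma decays_linear:
  assumes "bounded_linear L" "decays C n f"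
  shows "decays C n (\<lambda>x. L (f x))"
  using assms(2)
proof (induction n arbitrary: f)
  case 0
  then show ?case using assms(1) by (simp add: exp_dominated_linear)
next
  case (Suc n)
  then obtain f' where f': "\<And>x. (f has_vector_derivative f' x) (at x)" "decays C n f'"
    by (elim decaysE) blast
  show ?case unfolding decays.simps
  proof (intro conjI exI[of _ "\<lambda>x. L (f' x)"] allI)
    show "exp_dominated C (\<lambda>x. L (f x))"
      by (rule exp_dominated_linear[OF assms(1) decays_imp_dominated[OF Suc.prems]])
    show "((\<lambda>x. L (f x)) has_vector_derivative L (f' x)) (at x)" for x
      by (rule bounded_linear.has_vector_derivative[OF assms(1) f'(1)])
    show "decays C n (\<lambda>x. L (f' x))" using Suc.IH f'(2) .
  qed
qed

lemma decays_add:
  assumes "decays C n f" "decays C n g"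
  shows "decays C n (\<lambda>x. f x + g x)"
  using assms
proof (induction n arbitrary: f g)
  case 0
  then show ?case by (simp add: exp_dominated_add)
next
  case (Suc n)
  obtain f' where f': "\<And>x. (f has_vector_derivative f' x) (at x)" "decays C n f'"
    using Suc.prems(1) by (elim decaysE) blast
  obtain g' where g': "\<And>x. (g has_vector_derivative g' x) (at x)" "decays C n g'"
    using Suc.prems(2) by (elim decaysE) blast
  have "exp_dominated C (\<lambda>x. f x + g x)"
    using Suc.prems by (intro exp_dominated_add decays_imp_dominated)
  moreover have "((\<lambda>x. f x + g x) has_vector_derivative f' x + g' x) (at x)" for x
    by (rule has_vector_derivative_add[OF f'(1) g'(1)])
  moreover have "decays C n (\<lambda>x. f' x + g' x)" using Suc.IH f'(2) g'(2) .
  ultimately show ?case unfolding decays.simps by (intro conjI exI[of _ "\<lambda>x. f' x + g' x"]) auto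
qed

text \<open>By the Leibniz rule each term pairs a factor known to order \<open>Suc n\<close> with a
  derivative known to order \<open>n\<close>; \<open>decays_Suc_imp\<close> lowers the
  former.\<close>

lemma decays_mult:
  fixes f g :: "real \<Rightarrow> 'a::real_normed_algebra"
  assumes "decays B n f" "decays C n g"
  shows "decays (B + C) n (\<lambda>x. f x * g x)"
  using assms
proof (induction n arbitrary: f g)
  case 0
  then show ?case by (simp add: exp_dominated_mult)
next
  case (Suc n)
  obtain f' where f': "\<And>x. (f has_vector_derivative f' x) (at x)" "decays B n f'"
    using Suc.prems(1) by (elim decaysE) blast
  obtain g' where g': "\<And>x. (g has_vector_derivative g' x) (at x)" "decays C n g'"
    using Suc.prems(2) by (elim decaysE) blast
  have "exp_dominated (B + C) (\<lambda>x. f x * g x)"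
    using Suc.prems by (intro exp_dominated_mult decays_imp_dominated)
  moreover have "((\<lambda>x. f x * g x) has_vector_derivative f x * g' x + f' x * g x) (at x)" for x
    by (rule has_vector_derivative_mult[OF f'(1) g'(1)])
  moreover have "decays (B + C) n (\<lambda>x. f x * g' x + f' x * g x)"
    by (rule decays_add[OF Suc.IH[OF decays_Suc_imp[OF Suc.prems(1)] g'(2)]
          Suc.IH[OF f'(2) decays_Suc_imp[OF Suc.prems(2)]]])
  ultimately show ?case unfolding decays.simps
    by (intro conjI exI[of _ "\<lambda>x. f x * g' x + f' x * g x"]) auto
qed

text \<open>A factor with bounded derivatives preserves the rate. In this way the decay of the
  single function \<open>N (S x)\<close> passes to the profile and to the derivative of the
  wave.\<close>

lemma decays_mult_bounded:
  fixes f g :: "real \<Rightarrow> 'a::real_normed_algebra"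
  shows "decays C n f \<Longrightarrow> decays 0 n g \<Longrightarrow> decays C n (\<lambda>x. f x * g x)"
    "decays 0 n f \<Longrightarrow> decays C n g \<Longrightarrow> decays C n (\<lambda>x. f x * g x)"
  using decays_mult[of C n f 0 g] decays_mult[of 0 n f C g] by simp_all

lemma decays_zero: "decays C n (\<lambda>x. 0 :: 'a::real_normed_vector)"
proof (induction n)
  have dom: "exp_dominated C (\<lambda>x. 0 :: 'a)" by (rule exp_dominatedI[where A = 0]) simp
  {
    case 0
    show ?case using dom by simp
  next
    case (Suc n)
    show ?case by (rule decays_SucI[OF dom _ Suc]) simp
  }
qed

lemma decays_const: "decays 0 n (\<lambda>x. a :: 'a::real_normed_vector)"
proof (cases n)
  case (Suc m)
  show ?thesis unfolding Suc
    by (rule decays_SucI[OF _ _ decays_zero]) (auto simp: exp_dominated_0_iff)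
qed (auto simp: exp_dominated_0_iff)

lemma decays_uminus: "decays C n f \<Longrightarrow> decays C n (\<lambda>x. - f x)"
  by (rule decays_linear[OF bounded_linear_minus[OF bounded_linear_ident]])

lemma decays_diff: "decays C n f \<Longrightarrow> decays C n g \<Longrightarrow> decays C n (\<lambda>x. f x - g x)"
  using decays_add[OF _ decays_uminus, of C n f g] by simp

lemma decays_cmult:
  fixes f :: "real \<Rightarrow> 'a::real_normed_algebra"
  shows "decays C n f \<Longrightarrow> decays C n (\<lambda>x. a * f x)"
  by (rule decays_linear[OF bounded_linear_mult_right])

lemma decays_of_real:
  "decays C n f \<Longrightarrow> decays C n (\<lambda>x. of_real (f x) :: 'a::{real_normed_algebra_1})"
  by (rule decays_linear[OF bounded_linear_of_real])

lemma decays_power2: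
  fixes f :: "real \<Rightarrow> 'a::real_normed_algebra_1"
  shows "decays 0 n f \<Longrightarrow> decays 0 n (\<lambda>x. (f x)\<^sup>2)"
  unfolding power2_eq_square by (rule decays_mult_bounded)

text \<open>The derivative of \<open>1 / f\<close> contains \<open>1 / f\<close> itself only
  undifferentiated, so the induction closes. The uniform bound \<open>\<delta>\<close> supplies the
  boundedness that \<open>f x \<noteq> 0\<close> alone would not give.\<close>

lemma decays_inverse:
  fixes f :: "real \<Rightarrow> 'a::real_normed_field"
  assumes "decays 0 n f" "\<delta> > 0" "\<And>x. norm (f x) \<ge> \<delta>"
  shows "decays 0 n (\<lambda>x. inverse (f x))"
proof -
  have nz: "f x \<noteq> 0" for x using assms(2) assms(3)[of x] by auto
  have dom: "exp_dominated 0 (\<lambda>x. inverse (f x))"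
    unfolding exp_dominated_0_iff norm_inverse
    by (intro exI[of _ "inverse \<delta>"] allI le_imp_inverse_le assms)
  show ?thesis using assms(1)
  proof (induction n)
    case 0
    show ?case using dom by simp
  next
    case (Suc n)
    obtain f' where f': "\<And>x. (f has_vector_derivative f' x) (at x)" "decays 0 n f'"
      using Suc.prems by (elim decaysE) blast
    have IH: "decays 0 n (\<lambda>x. inverse (f x))" using Suc decays_Suc_imp by blast
    show ?case
    proof (rule decays_SucI[OF dom])
      show "((\<lambda>x. inverse (f x)) has_vector_derivative - (inverse (f x) * f' x * inverse (f x))) (at x)" for x
      proof -
        have "(f has_derivative (\<lambda>h. h *\<^sub>R f' x)) (at x)"
          using f'(1)[of x] by (simp add: has_vector_derivative_def)
        from Deriv.has_derivative_inverse[where f = f, OF nz this] show ?thesis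
          by (simp add: has_vector_derivative_def)
      qed
      show "decays 0 n (\<lambda>x. - (inverse (f x) * f' x * inverse (f x)))"
        by (intro decays_uminus decays_mult_bounded IH f')
    qed
  qed
qed

lemma decays_sqrt:
  assumes "decays 0 n f" "\<delta> > 0" "\<And>x. f x \<ge> \<delta>"
  shows "decays 0 n (\<lambda>x. sqrt (f x))"
proof -
  have pos: "f x > 0" for x using assms(2) assms(3)[of x] by auto
  have dom: "exp_dominated 0 (\<lambda>x. sqrt (f x))" if D: "decays 0 n f" for n
  proof -
    obtain A where "\<And>x. norm (f x) \<le> A"
      using decays_imp_dominated[OF D] unfolding exp_dominated_0_iff by blast
    then show ?thesis
      unfolding exp_dominated_0_iff using pos
      by (intro exI[of _ "sqrt A"]) (auto simp: real_sqrt_le_iff abs_le_iff less_imp_le)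
  qed
  show ?thesis using assms(1)
  proof (induction n)
    case 0
    then show ?case using dom[of 0] by simp
  next
    case (Suc n)
    obtain f' where f': "\<And>x. (f has_vector_derivative f' x) (at x)" "decays 0 n f'"
      using Suc.prems by (elim decaysE) blast
    have IH: "decays 0 n (\<lambda>x. sqrt (f x))" using Suc decays_Suc_imp by blast
    have inv: "decays 0 n (\<lambda>x. inverse (sqrt (f x)))"
      by (rule decays_inverse[OF IH, of "sqrt \<delta>"]) (use assms(2,3) pos in \<open>auto simp: less_imp_le\<close>)
    show ?case
    proof (rule decays_SucI[OF dom[OF Suc.prems]])
      show "((\<lambda>x. sqrt (f x)) has_vector_derivative inverse (sqrt (f x)) * ((1/2) * f' x)) (at x)" for x
        using f'(1)[of x] pos[of x] unfolding has_real_derivative_iff_has_vector_derivative[symmetric]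
        by (auto intro!: derivative_eq_intros simp: field_simps)
      show "decays 0 n (\<lambda>x. inverse (sqrt (f x)) * ((1/2) * f' x))"
        by (intro decays_mult_bounded decays_cmult inv f')
    qed
  qed
qed

lemma decays_exp:
  fixes f :: "real \<Rightarrow> real"
  assumes "decays 0 n f"
  shows "decays 0 n (\<lambda>x. exp (f x))"
proof -
  have dom: "exp_dominated 0 (\<lambda>x. exp (f x))" if D: "decays 0 n f" for n
  proof -
    obtain A where "\<And>x. norm (f x) \<le> A"
      using decays_imp_dominated[OF D] unfolding exp_dominated_0_iff by blast
    then show ?thesis
      unfolding exp_dominated_0_iff by (intro exI[of _ "exp A"]) (auto simp: abs_le_iff)
  qed
  show ?thesis using assms
  proof (induction n)
    case 0
    then show ?case using dom[of 0] by simp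
  next
    case (Suc n)
    obtain f' where f': "\<And>x. (f has_vector_derivative f' x) (at x)" "decays 0 n f'"
      using Suc.prems by (elim decaysE) blast
    have IH: "decays 0 n (\<lambda>x. exp (f x))" using Suc decays_Suc_imp by blast
    show ?case
    proof (rule decays_SucI[OF dom[OF Suc.prems]])
      show "((\<lambda>x. exp (f x)) has_vector_derivative exp (f x) * f' x) (at x)" for x
        using f'(1)[of x] unfolding has_real_derivative_iff_has_vector_derivative[symmetric]
        by (auto intro!: derivative_eq_intros)
      show "decays 0 n (\<lambda>x. exp (f x) * f' x)" by (intro decays_mult_bounded IH f')
    qed
  qed
qed

lemma decays_affine:
  fixes f :: "real \<Rightarrow> 'a::real_normed_vector"
  assumes "decays 0 n f"
  shows "decays 0 n (\<lambda>x. f (a * x + b))"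
  using assms
proof (induction n arbitrary: f)
  case 0
  then show ?case by (auto simp: exp_dominated_0_iff)
next
  case (Suc n)
  then obtain f' where f': "\<And>x. (f has_vector_derivative f' x) (at x)" "decays 0 n f'"
    by (elim decaysE) blast
  show ?case
  proof (rule decays_SucI)
    show "exp_dominated 0 (\<lambda>x. f (a * x + b))"
      using decays_imp_dominated[OF Suc.prems] by (auto simp: exp_dominated_0_iff)
    show "((\<lambda>x. f (a * x + b)) has_vector_derivative a *\<^sub>R f' (a * x + b)) (at x)" for x
    proof -
      have "((\<lambda>x. a * x + b) has_real_derivative a) (at x)" by (auto intro!: derivative_eq_intros)
      then show ?thesis
        using vector_diff_chain_at[of "\<lambda>x. a * x + b" a x f "f' (a * x + b)"] f'(1)[of "a * x + b"]
        by (simp add: o_def has_real_derivative_iff_has_vector_derivative)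
    qed
    show "decays 0 n (\<lambda>x. a *\<^sub>R f' (a * x + b))"
      by (rule decays_linear[OF bounded_linear_scaleR_right Suc.IH[OF f'(2)]])
  qed
qed

section \<open>Iterated derivatives and smoothness classes\<close>

lemma iter_deriv_0 [simp]: "iter_deriv 0 f = f"
  by (simp add: iter_deriv_def)

text \<open>Peels off the innermost derivative, as the recursion of \<open>decays\<close> does;
  unfolding \<open>^^\<close> directly would expose the outermost one.\<close>

lemma iter_deriv_Suc: "iter_deriv (Suc k) f = iter_deriv k (\<lambda>x. vector_derivative f (at x))"
  by (simp only: iter_deriv_def funpow_Suc_right o_apply)

lemma iter_deriv_Suc_eqI:
  assumes "\<And>x. (f has_vector_derivative f' x) (at x)"
  shows "iter_deriv (Suc k) f = iter_deriv k f'"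
  using vector_derivative_at[OF assms] by (simp add: iter_deriv_Suc)

lemma iter_deriv_1_eqI:
  assumes "\<And>x. (f has_vector_derivative f' x) (at x)"
  shows "iter_deriv 1 f = f'" "iter_deriv (Suc 0) f = f'"
  using iter_deriv_Suc_eqI[OF assms, of 0] by simp_all

lemma iter_deriv_2_eqI:
  assumes "\<And>x. (f has_vector_derivative f' x) (at x)" "\<And>x. (f' has_vector_derivative f'' x) (at x)"
  shows "iter_deriv 2 f = f''"
  using iter_deriv_Suc_eqI[OF assms(1), of 1] iter_deriv_1_eqI[OF assms(2)] by (simp add: numeral_2_eq_2)

lemma decays_iter_deriv:
  assumes "decays C n f" "k \<le> n"
  shows "decays C (n - k) (iter_deriv k f)"
  using assms
proof (induction k arbitrary: n f)
  case (Suc k)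
  then obtain m where m: "n = Suc m" by (cases n) auto
  obtain f' where f': "\<And>x. (f has_vector_derivative f' x) (at x)" "decays C m f'"
    using Suc.prems(1) unfolding m by (elim decaysE) blast
  show ?case using Suc.IH[OF f'(2)] Suc.prems(2) m by (simp add: iter_deriv_Suc_eqI[OF f'(1)])
qed simp

lemma decays_imp_C_infinity:
  assumes "\<And>n. decays C n f"
  shows "f \<in> C_infinity"
proof -
  have "(\<exists>f'. \<forall>x. (iter_deriv j f has_vector_derivative f' x) (at x))" for j
    using decays_iter_deriv[OF assms[of "Suc j"], of j] by auto
  then have "iter_deriv j f differentiable at x" for j x
    by (meson differentiableI_vector)
  then have "iter_deriv j f differentiable at x" "continuous_on UNIV (iter_deriv j f)" for j x
    by (simp_all add: differentiable_imp_continuous_on differentiable_on_def)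
  then show ?thesis by (simp add: C_infinity_def C_k_def)
qed

lemma C_k_2E:
  assumes "f \<in> C_k 2"
  obtains f' f'' where "\<And>x. (f has_vector_derivative f' x) (at x)"
    "\<And>x. (f' has_vector_derivative f'' x) (at x)" "continuous_on UNIV f''"
    "iter_deriv 1 f = f'" "iter_deriv 2 f = f''"
proof -
  have d: "iter_deriv j f differentiable at x" if "j < 2" for j x
    using assms that by (auto simp: C_k_def)
  have 1: "(f has_vector_derivative iter_deriv 1 f x) (at x)" for x
    using d[of 0 x] by (simp add: iter_deriv_def vector_derivative_works[symmetric])
  have 2: "(iter_deriv 1 f has_vector_derivative iter_deriv 2 f x) (at x)" for x
    using d[of 1 x] by (simp add: iter_deriv_def numeral_2_eq_2 vector_derivative_works[symmetric])
  show ?thesis by (rule that[OF 1 2]) (use assms in \<open>auto simp: C_k_def\<close>)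
qed

section \<open>Weak derivatives\<close>

definition exp_tail :: "nat \<Rightarrow> real \<Rightarrow> real" where
  "exp_tail k x = (if x > 0 then inverse x ^ k * exp (- inverse x) else 0)"

text \<open>A nonnegative series dominates each of its terms.\<close>

lemma power_le_fact_exp:
  fixes t :: real
  assumes "t \<ge> 0"
  shows "t ^ k \<le> fact k * exp t"
proof -
  have "(\<Sum>n\<in>{k}. t ^ n /\<^sub>R fact n) \<le> (\<Sum>n. t ^ n /\<^sub>R fact n)"
    by (rule sum_le_suminf) (use assms summable_exp_generic[of t] in auto)
  then have "t ^ k / fact k \<le> exp t" by (simp add: exp_def divide_real_def mult_ac)
  then show ?thesis by (simp add: field_simps)
qed

lemma exp_tail_nonneg: "exp_tail k x \<ge> 0"
  by (simp add: exp_tail_def)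

lemma exp_tail_le: "exp_tail k x \<le> fact k"
proof (cases "x > 0")
  case True
  then show ?thesis using power_le_fact_exp[of "inverse x" k]
    by (simp add: exp_tail_def exp_minus field_simps)
qed (simp add: exp_tail_def)

text \<open>The powers of \<open>1 / x\<close> are included so that the family is closed under
  differentiation; smoothness of all members is then one induction. At the origin,
  \<open>exp_tail k h = exp_tail (k + 2) h * h\<^sup>2\<close> for positive \<open>h\<close> makes
  the difference quotient of order \<open>h\<close>.\<close>

lemma exp_tail_deriv:
  "(exp_tail k has_real_derivative exp_tail (k + 2) x - real k * exp_tail (k + 1) x) (at x)"
proof -
  consider "x > 0" | "x < 0" | "x = 0" by linarith
  then show ?thesis
  proof cases
    case 1
    \<comment> \<open>For \<open>k = 0\<close> the exponent is truncated to 0, and the factor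
      \<open>real k\<close> makes both sides vanish.\<close>
    have pk: "real k * inverse x ^ (k - Suc 0) = real k * inverse x ^ k * x"
      using 1 by (cases k) auto
    have "((\<lambda>x. inverse x ^ k * exp (- inverse x)) has_real_derivative
       (real k * inverse x ^ (k - Suc 0)) * (- (inverse x * inverse x)) * exp (- inverse x)
       + inverse x ^ k * (exp (- inverse x) * (inverse x * inverse x))) (at x)"
      using 1 by (auto intro!: derivative_eq_intros simp: power2_eq_square)
    also have "(real k * inverse x ^ (k - Suc 0)) * (- (inverse x * inverse x)) * exp (- inverse x)
       + inverse x ^ k * (exp (- inverse x) * (inverse x * inverse x))
       = exp_tail (k + 2) x - real k * exp_tail (k + 1) x"
      unfolding pk using 1 by (simp add: exp_tail_def field_simps)
    finally have "((\<lambda>x. inverse x ^ k * exp (- inverse x)) has_real_derivative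
       exp_tail (k + 2) x - real k * exp_tail (k + 1) x) (at x)" .
    then show ?thesis
      by (rule has_field_derivative_transform_within_open[where S = "{0<..}"])
        (use 1 in \<open>auto simp: exp_tail_def\<close>)
  next
    case 2
    have "((\<lambda>x. 0) has_real_derivative exp_tail (k + 2) x - real k * exp_tail (k + 1) x) (at x)"
      using 2 by (simp add: exp_tail_def)
    then show ?thesis
      by (rule has_field_derivative_transform_within_open[where S = "{..<0}"])
        (use 2 in \<open>auto simp: exp_tail_def\<close>)
  next
    case 3
    have le: "\<bar>exp_tail k h\<bar> \<le> fact (k + 2) * \<bar>h\<bar>\<^sup>2" for h
    proof (cases "h > 0")
      case True
      then have "exp_tail k h = exp_tail (k + 2) h * h\<^sup>2"
        by (simp add: exp_tail_def field_simps power2_eq_square)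
      with exp_tail_le[of "k + 2" h] show ?thesis
        by (simp add: abs_mult exp_tail_nonneg mult_right_mono del: fact_Suc)
    qed (simp add: exp_tail_def)
    have "((\<lambda>h. exp_tail k h / h) \<longlongrightarrow> 0) (at 0)"
    proof (rule Lim_null_comparison)
      show "\<forall>\<^sub>F h in at 0. norm (exp_tail k h / h) \<le> fact (k + 2) * \<bar>h\<bar>"
      proof (rule eventually_at_filter[THEN iffD2], rule always_eventually, intro allI impI)
        fix h :: real assume "h \<noteq> 0"
        then show "norm (exp_tail k h / h) \<le> fact (k + 2) * \<bar>h\<bar>"
          using le[of h] by (simp add: divide_le_eq power2_eq_square mult_ac del: fact_Suc)
      qed
      show "((\<lambda>h::real. fact (k + 2) * \<bar>h\<bar>) \<longlongrightarrow> 0) (at 0)"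
        by (auto intro!: tendsto_eq_intros)
    qed
    then show ?thesis
      using 3 by (simp add: has_field_derivative_iff exp_tail_def)
  qed
qed

lemma decays_exp_tail: "decays 0 n (exp_tail k)"
proof (induction n arbitrary: k)
  have dom: "exp_dominated 0 (exp_tail k)" for k
    unfolding exp_dominated_0_iff using exp_tail_le[of k] exp_tail_nonneg[of k] by auto
  {
    case 0
    show ?case using dom by simp
  next
    case (Suc n)
    show ?case
      by (rule decays_SucI[OF dom])
        (auto simp: has_real_derivative_iff_has_vector_derivative[symmetric]
          intro!: exp_tail_deriv decays_diff decays_cmult Suc)
  }
qed

text \<open>The product of the two tails is positive exactly on the open interval, so its large
  multiples drive the exponential to 0 there and leave it at 1 elsewhere. This gives test functions
  between 0 and 1 that approximate an indicator, without any mollification.\<close>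

definition plateau :: "real \<Rightarrow> real \<Rightarrow> nat \<Rightarrow> real \<Rightarrow> real" where
  "plateau a b n x = 1 - exp (- (real n * (exp_tail 0 (x - a) * exp_tail 0 (b - x))))"

lemma plateau_outside: "x \<notin> {a<..<b} \<Longrightarrow> plateau a b n x = 0"
  by (auto simp: plateau_def exp_tail_def)

lemma plateau_bounds: "0 \<le> plateau a b n x" "plateau a b n x \<le> 1"
  by (auto simp: plateau_def exp_tail_nonneg)

lemma plateau_tendsto: "(\<lambda>n. plateau a b n x) \<longlonglongrightarrow> indicator {a<..<b} x"
proof (cases "x \<in> {a<..<b}")
  case True
  define d where "d = exp_tail 0 (x - a) * exp_tail 0 (b - x)"
  have "d > 0" using True by (auto simp: d_def exp_tail_def)
  have "filterlim (\<lambda>n. real n * d) at_top sequentially"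
    by (rule filterlim_at_top_mult_tendsto_pos[OF tendsto_const \<open>d > 0\<close> filterlim_real_sequentially])
  then have "(\<lambda>n. exp (- (real n * d))) \<longlonglongrightarrow> 0"
    by (intro filterlim_compose[OF exp_at_bot] filterlim_compose[OF filterlim_uminus_at_bot_at_top])
  then have "(\<lambda>n. 1 - exp (- (real n * d))) \<longlonglongrightarrow> 1 - 0" by (intro tendsto_intros)
  then show ?thesis using True by (simp add: plateau_def d_def)
qed (simp add: plateau_outside)

lemma plateau_test_function: "plateau a b n \<in> test_functions"
proof -
  have "decays 0 m (\<lambda>x. exp_tail 0 (1 * x + (- a)))" "decays 0 m (\<lambda>x. exp_tail 0 ((-1) * x + b))" for m
    by (intro decays_affine decays_exp_tail)+
  then have "decays 0 m (plateau a b n)" for m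
    unfolding plateau_def[abs_def]
    by (intro decays_diff decays_const decays_exp decays_uminus decays_cmult decays_mult_bounded) simp_all
  then have "plateau a b n \<in> C_infinity" by (rule decays_imp_C_infinity)
  moreover have "x \<in> {a..b}" if "plateau a b n x \<noteq> 0" for x
    using that plateau_outside[of x a b n] by (cases "x \<in> {a<..<b}") auto
  then have "bounded {x. plateau a b n x \<noteq> 0}"
    by (intro bounded_subset[OF bounded_closed_interval[of a b]]) auto
  ultimately show ?thesis by (simp add: test_functions_def)
qed

lemma test_functionE:
  assumes "\<phi> \<in> test_functions"
  obtains N \<phi>' where "N > 0" "\<And>x. \<bar>x\<bar> \<ge> N \<Longrightarrow> \<phi> x = 0" "\<And>x. \<bar>x\<bar> \<ge> N \<Longrightarrow> \<phi>' x = 0"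
    "\<And>x. (\<phi> has_real_derivative \<phi>' x) (at x)" "continuous_on UNIV \<phi>'" "iter_deriv 1 \<phi> = \<phi>'"
proof -
  have "\<phi> \<in> C_k 2" using assms by (auto simp: test_functions_def C_infinity_def)
  then obtain \<phi>' \<phi>'' where d: "\<And>x. (\<phi> has_vector_derivative \<phi>' x) (at x)"
      "\<And>x. (\<phi>' has_vector_derivative \<phi>'' x) (at x)" "iter_deriv 1 \<phi> = \<phi>'"
    by (elim C_k_2E) blast
  have "bounded (closure {x. \<phi> x \<noteq> 0})"
    using assms by (auto simp: test_functions_def compact_imp_bounded)
  then obtain N where N: "N > 0" "\<And>x. x \<in> closure {x. \<phi> x \<noteq> 0} \<Longrightarrow> norm x \<le> N"
    by (auto simp: bounded_pos)
  have zero: "\<phi> x = 0" if "\<bar>x\<bar> > N" for x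
    using N(2)[of x] closure_subset[of "{x. \<phi> x \<noteq> 0}"] that by fastforce
  have dzero: "\<phi>' x = 0" if "\<bar>x\<bar> > N" for x
  proof -
    have "((\<lambda>x. 0) has_vector_derivative \<phi>' x) (at x)"
      by (rule has_vector_derivative_transform_within_open[OF d(1), where S = "- {-N..N}"])
        (use that zero in \<open>auto simp: open_Compl\<close>)
    then show ?thesis using vector_derivative_unique_at[OF _ has_vector_derivative_const] by blast
  qed
  \<comment> \<open>Vanishing was shown on the open set \<open>\<bar>x\<bar> > N\<close>, where
    derivatives can be compared; the closed condition required here costs one unit.\<close>
  show ?thesis
  proof (rule that[of "N + 1" \<phi>'])
    show "continuous_on UNIV \<phi>'"
      using d(2) by (meson continuous_at_imp_continuous_on has_vector_derivative_continuous)
    show "(\<phi> has_real_derivative \<phi>' x) (at x)" for x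
      using d(1) by (simp add: has_real_derivative_iff_has_vector_derivative)
  qed (use N zero dzero d in \<open>auto\<close>)
qed

section \<open>Weak against classical derivatives\<close>

lemma measurable_lebesgue_if_continuous:
  fixes f :: "real \<Rightarrow> 'a::euclidean_space"
  shows "continuous_on UNIV f \<Longrightarrow> f \<in> borel_measurable lebesgue"
  by (intro measurable_completion) (auto intro: borel_measurable_continuous_onI)

lemma set_integrable_lebesgue_if_continuous:
  fixes f :: "real \<Rightarrow> 'a::euclidean_space"
  assumes "continuous_on UNIV f" "compact K"
  shows "set_integrable lebesgue K f"
proof -
  have "integrable lborel (\<lambda>x. indicator K x *\<^sub>R f x)"
    by (rule borel_integrable_compact) (use assms continuous_on_subset in auto)
  then show ?thesis unfolding set_integrable_def
    using integrable_completion borel_measurable_integrable by blast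
qed

lemma continuous_L1_loc: "continuous_on UNIV f \<Longrightarrow> f \<in> L1_loc"
  by (auto simp: L1_loc_def set_integrable_lebesgue_if_continuous)

lemma continuous_L2_loc: "continuous_on UNIV f \<Longrightarrow> f \<in> L2_loc"
  by (auto simp: L2_loc_def measurable_lebesgue_if_continuous intro!: continuous_L1_loc continuous_intros)

lemma integrable_compact_support_mult:
  fixes g :: "real \<Rightarrow> 'a::euclidean_space" and \<phi> :: "real \<Rightarrow> real"
  assumes g: "g \<in> L1_loc" and cont: "continuous_on UNIV \<phi>" and supp: "\<And>x. \<bar>x\<bar> \<ge> N \<Longrightarrow> \<phi> x = 0"
  shows "integrable lebesgue (\<lambda>x. \<phi> x *\<^sub>R g x)"
proof -
  have "compact (\<phi> ` {-N..N})"
    by (rule compact_continuous_image) (use cont continuous_on_subset in auto)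
  then obtain B where B: "\<And>x. x \<in> {-N..N} \<Longrightarrow> norm (\<phi> x) \<le> B"
    using compact_imp_bounded bounded_iff by (metis imageI)
  have int: "integrable lebesgue (\<lambda>x. indicator {-N..N} x *\<^sub>R g x)"
    using g by (auto simp: L1_loc_def set_integrable_def)
  have "integrable lebesgue (\<lambda>x. \<phi> x *\<^sub>R (indicator {-N..N} x *\<^sub>R g x))"
  proof (rule Bochner_Integration.integrable_bound)
    show "integrable lebesgue (\<lambda>x. B *\<^sub>R (indicator {-N..N} x *\<^sub>R g x))"
      by (rule integrable_scaleR_right[OF int])
    show "(\<lambda>x. \<phi> x *\<^sub>R (indicator {-N..N} x *\<^sub>R g x)) \<in> borel_measurable lebesgue"
      by (intro borel_measurable_scaleR measurable_lebesgue_if_continuous cont borel_measurable_integrable[OF int])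
    show "AE x in lebesgue. norm (\<phi> x *\<^sub>R (indicator {-N..N} x *\<^sub>R g x)) \<le> norm (B *\<^sub>R (indicator {-N..N} x *\<^sub>R g x))"
    proof (rule AE_I2)
      fix x
      show "norm (\<phi> x *\<^sub>R (indicator {-N..N} x *\<^sub>R g x)) \<le> norm (B *\<^sub>R (indicator {-N..N} x *\<^sub>R g x))"
        using B[of x] by (cases "x \<in> {-N..N}") (auto intro!: mult_right_mono)
    qed
  qed
  also have "(\<lambda>x. \<phi> x *\<^sub>R (indicator {-N..N} x *\<^sub>R g x)) = (\<lambda>x. \<phi> x *\<^sub>R g x)"
  proof
    fix x show "\<phi> x *\<^sub>R (indicator {-N..N} x *\<^sub>R g x) = \<phi> x *\<^sub>R g x"
      using supp[of x] by (cases "\<bar>x\<bar> \<ge> N") (auto simp: indicator_def)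
  qed
  finally show ?thesis .
qed

text \<open>Integration by parts: on \<open>{-N..N}\<close> the integrand is the derivative of
  \<open>\<phi> x *\<^sub>R v x\<close>, which vanishes at both ends. The fundamental theorem is
  applied for \<open>lborel\<close> and then transferred to its completion.\<close>

lemma classical_imp_weak_derivative:
  fixes v :: "real \<Rightarrow> 'a::euclidean_space"
  assumes v: "\<And>x. (v has_vector_derivative v' x) (at x)" and cont: "continuous_on UNIV v'"
  shows "has_weak_derivative v v'"
proof -
  have cv: "continuous_on UNIV v"
    using v by (meson continuous_at_imp_continuous_on has_vector_derivative_continuous)
  have "(LINT x|lebesgue. iter_deriv 1 \<phi> x *\<^sub>R v x) = - (LINT x|lebesgue. \<phi> x *\<^sub>R v' x)"
    if \<phi>: "\<phi> \<in> test_functions" for \<phi>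
  proof -
    obtain N \<phi>' where N: "N > 0" "\<And>x. \<bar>x\<bar> \<ge> N \<Longrightarrow> \<phi> x = 0" "\<And>x. \<bar>x\<bar> \<ge> N \<Longrightarrow> \<phi>' x = 0"
      and d: "\<And>x. (\<phi> has_real_derivative \<phi>' x) (at x)" "continuous_on UNIV \<phi>'" "iter_deriv 1 \<phi> = \<phi>'"
      using test_functionE[OF \<phi>] by blast
    have c\<phi>: "continuous_on UNIV \<phi>" using d(1) by (meson DERIV_continuous_on has_field_derivative_at_within)
    have i1: "integrable lebesgue (\<lambda>x. \<phi>' x *\<^sub>R v x)"
      by (rule integrable_compact_support_mult[OF continuous_L1_loc[OF cv] d(2) N(3)])
    have i2: "integrable lebesgue (\<lambda>x. \<phi> x *\<^sub>R v' x)"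
      by (rule integrable_compact_support_mult[OF continuous_L1_loc[OF cont] c\<phi> N(2)])
    have cf: "continuous_on UNIV (\<lambda>x. \<phi> x *\<^sub>R v' x + \<phi>' x *\<^sub>R v x)"
      by (intro continuous_intros c\<phi> d cont cv)
    have "integral\<^sup>L lborel (\<lambda>x. indicator {-N..N} x *\<^sub>R (\<phi> x *\<^sub>R v' x + \<phi>' x *\<^sub>R v x))
        = \<phi> N *\<^sub>R v N - \<phi> (-N) *\<^sub>R v (-N)"
    proof (rule integral_FTC_atLeastAtMost)
      fix x
      show "((\<lambda>x. \<phi> x *\<^sub>R v x) has_vector_derivative \<phi> x *\<^sub>R v' x + \<phi>' x *\<^sub>R v x) (at x within {- N..N})"
        by (rule has_vector_derivative_at_within[OF has_vector_derivative_scaleR[OF d(1) v]])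
    qed (use N(1) continuous_on_subset[OF cf] in auto)
    also have "(\<lambda>x. indicator {-N..N} x *\<^sub>R (\<phi> x *\<^sub>R v' x + \<phi>' x *\<^sub>R v x)) = (\<lambda>x. \<phi> x *\<^sub>R v' x + \<phi>' x *\<^sub>R v x)"
      using N(2,3) by (auto simp: indicator_def fun_eq_iff)
    also have "integral\<^sup>L lborel (\<lambda>x. \<phi> x *\<^sub>R v' x + \<phi>' x *\<^sub>R v x) =
        integral\<^sup>L lebesgue (\<lambda>x. \<phi> x *\<^sub>R v' x + \<phi>' x *\<^sub>R v x)"
      by (rule integral_completion[symmetric]) (use borel_measurable_continuous_onI[OF cf] in auto)
    also have "\<dots> = (LINT x|lebesgue. \<phi> x *\<^sub>R v' x) + (LINT x|lebesgue. \<phi>' x *\<^sub>R v x)"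
      by (rule Bochner_Integration.integral_add[OF i2 i1])
    finally show ?thesis using N(1) N(2)[of N] N(2)[of "-N"] d(3) by (simp add: eq_neg_iff_add_eq_0 add.commute)
  qed
  then show ?thesis by (auto simp: has_weak_derivative_def continuous_L1_loc cv cont)
qed

text \<open>Dynkin's argument: open intervals form an intersection-stable generator, and the sets
  over which \<open>g\<close> integrates to 0 are closed under complements, by \<open>tot\<close>,
  and under countable disjoint unions. A Lebesgue set differs from a Borel set by a null
  set.\<close>

lemma set_integral_zero_if_intervals:
  fixes g :: "real \<Rightarrow> 'a::euclidean_space"
  assumes g: "integrable lebesgue g"
    and int0: "\<And>a b. (LINT x:{a<..<b}|lebesgue. g x) = 0" and tot: "(LINT x|lebesgue. g x) = 0"
    and A: "A \<in> sets lebesgue"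
  shows "(LINT x:A|lebesgue. g x) = 0"
proof -
  have si: "set_integrable lebesgue B g" if "B \<in> sets lebesgue" for B
    unfolding set_integrable_def by (rule integrable_mult_indicator[OF that g])
  have borel: "(LINT x:B|lebesgue. g x) = 0" if "B \<in> sets borel" for B
  proof -
    let ?G = "range (\<lambda>(a, b). {a<..<b} :: real set)"
    have borel_sets: "sets borel = sigma_sets UNIV ?G"
      by (subst borel_eq_box) (simp add: case_prod_unfold)
    have "B \<in> sigma_sets UNIV ?G"
      using that unfolding borel_sets by simp
    have "Int_stable ?G" "?G \<subseteq> Pow UNIV" by (auto simp: Int_stable_def)
    from this \<open>B \<in> sigma_sets UNIV ?G\<close> show ?thesis
    proof (induction rule: sigma_sets_induct_disjoint)
      case (basic A)
      then show ?case using int0 by auto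
    next
      case empty
      then show ?case by (simp add: set_lebesgue_integral_def)
    next
      case (compl A)
      then have A: "A \<in> sets lebesgue" by (simp add: borel_sets[symmetric])
      have "(LINT x:UNIV|lebesgue. g x) = (LINT x:A|lebesgue. g x) + (LINT x:UNIV - A|lebesgue. g x)"
        by (subst set_integral_Un[symmetric]) (use A in \<open>auto intro!: si\<close>)
      then show ?case using compl tot by (simp add: set_lebesgue_integral_def)
    next
      case (union A)
      then have "A i \<in> sets lebesgue" for i by (auto simp: borel_sets[symmetric])
      then show ?case
        by (subst lebesgue_integral_countable_add) (use union in \<open>auto simp: disjoint_family_on_def intro!: si\<close>)
    qed
  qed
  from A obtain S N N' where SN: "A = S \<union> N" "N \<subseteq> N'" "N' \<in> null_sets lborel" "S \<in> sets lborel"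
    by (rule sets_completionE)
  have "AE x in lborel. x \<notin> N'" using SN(3) by (rule AE_not_in)
  then have "AE x in lebesgue. x \<notin> N'" by (rule AE_completion)
  then have "AE x in lebesgue. indicator A x *\<^sub>R g x = indicator S x *\<^sub>R g x"
    using SN(1,2) by (auto simp: indicator_def elim!: eventually_mono)
  then have "(LINT x:A|lebesgue. g x) = (LINT x:S|lebesgue. g x)"
    unfolding set_lebesgue_integral_def
    by (intro integral_cong_AE) (use A SN(4) g in \<open>auto intro!: borel_measurable_scaleR borel_measurable_indicator\<close>)
  then show ?thesis using borel SN(4) by simp
qed

text \<open>The completion agrees with \<open>lborel\<close> on Borel sets, so the same countable
  cover works. It makes \<open>density_zero\<close> available for \<open>lebesgue\<close>.\<close>

lemma sigma_finite_lebesgue: "sigma_finite_measure (lebesgue :: 'a::euclidean_space measure)"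
proof
  obtain A :: "'a set set" where A: "countable A" "A \<subseteq> sets lborel" "\<Union>A = space lborel"
      "\<forall>a\<in>A. emeasure lborel a \<noteq> \<infinity>"
    using lborel.sigma_finite_countable by blast
  have "emeasure lebesgue a \<noteq> \<infinity>" if "a \<in> A" for a
  proof -
    have a: "a \<in> sets lborel" using A(2) that by blast
    then have "emeasure lebesgue a = emeasure lborel a"
      by (subst emeasure_completion) (auto simp: main_part_sets)
    then show ?thesis using A(4) that by simp
  qed
  then show "\<exists>A :: 'a set set. countable A \<and> A \<subseteq> sets lebesgue \<and> \<Union>A = space lebesgue \<and>
      (\<forall>a\<in>A. emeasure lebesgue a \<noteq> \<infinity>)"
    using A by (intro exI[of _ A]) auto
qed

text \<open>Testing with \<open>plateau\<close> and passing to the limit by dominated convergence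
  yields zero integrals over open intervals. As \<open>g\<close> is only locally integrable, the
  conclusion is drawn on each \<open>{-real n<..<real n}\<close> and the countably many null sets
  are collected.\<close>

lemma fundamental_lemma_calculus_of_variations:
  fixes g :: "real \<Rightarrow> 'a::euclidean_space"
  assumes g: "g \<in> L1_loc" and zero: "\<And>\<phi>. \<phi> \<in> test_functions \<Longrightarrow> (LINT x|lebesgue. \<phi> x *\<^sub>R g x) = 0"
  shows "AE x in lebesgue. g x = 0"
proof -
  have interval: "(LINT x:{a<..<b}|lebesgue. g x) = 0" for a b
  proof -
    have int: "integrable lebesgue (\<lambda>x. indicator {a..b} x *\<^sub>R g x)"
      using g by (auto simp: L1_loc_def set_integrable_def)
    have eq: "plateau a b n x *\<^sub>R g x = plateau a b n x *\<^sub>R (indicator {a..b} x *\<^sub>R g x)" for n x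
      using plateau_outside[of x a b n] by (cases "x \<in> {a<..<b}") (auto simp: indicator_def)
    have eq2: "indicator {a<..<b} x *\<^sub>R g x = indicator {a<..<b} x *\<^sub>R (indicator {a..b} x *\<^sub>R g x)" for x
      by (auto simp: indicator_def)
    have cont: "continuous_on UNIV (plateau a b n)" for n
      using plateau_test_function[of a b n]
      by (auto elim!: test_functionE intro!: continuous_at_imp_continuous_on DERIV_isCont)
    have "(\<lambda>n. LINT x|lebesgue. plateau a b n x *\<^sub>R g x) \<longlonglongrightarrow> (LINT x|lebesgue. indicator {a<..<b} x *\<^sub>R g x)"
    proof (rule integral_dominated_convergence)
      show "(\<lambda>x. indicator {a<..<b} x *\<^sub>R g x) \<in> borel_measurable lebesgue"
        unfolding eq2
        by (intro borel_measurable_scaleR borel_measurable_indicator borel_measurable_integrable[OF int]) auto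
      show "(\<lambda>x. plateau a b n x *\<^sub>R g x) \<in> borel_measurable lebesgue" for n
        unfolding eq
        by (intro borel_measurable_scaleR measurable_lebesgue_if_continuous cont borel_measurable_integrable[OF int])
      show "integrable lebesgue (\<lambda>x. norm (indicator {a..b} x *\<^sub>R g x))"
        by (rule integrable_norm[OF int])
      show "AE x in lebesgue. (\<lambda>n. plateau a b n x *\<^sub>R g x) \<longlonglongrightarrow> indicator {a<..<b} x *\<^sub>R g x"
        by (intro AE_I2 tendsto_scaleR plateau_tendsto tendsto_const)
      show "AE x in lebesgue. norm (plateau a b n x *\<^sub>R g x) \<le> norm (indicator {a..b} x *\<^sub>R g x)" for n
      proof (rule AE_I2)
        fix x
        have "norm (plateau a b n x *\<^sub>R g x) = plateau a b n x * norm (indicator {a..b} x *\<^sub>R g x)"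
          by (subst eq) (simp add: plateau_bounds)
        also have "\<dots> \<le> 1 * norm (indicator {a..b} x *\<^sub>R g x)"
          by (intro mult_right_mono plateau_bounds norm_ge_zero)
        finally show "norm (plateau a b n x *\<^sub>R g x) \<le> norm (indicator {a..b} x *\<^sub>R g x)" by simp
      qed
    qed
    then have "(\<lambda>n. 0) \<longlonglongrightarrow> (LINT x|lebesgue. indicator {a<..<b} x *\<^sub>R g x)"
      by (simp add: zero plateau_test_function)
    then show ?thesis by (simp add: set_lebesgue_integral_def LIMSEQ_const_iff)
  qed
  have "AE x in lebesgue. indicator {-real n<..<real n} x *\<^sub>R g x = 0" for n :: nat
  proof (rule sigma_finite_measure.density_zero[OF sigma_finite_lebesgue])
    let ?g = "\<lambda>x. indicator {-real n<..<real n} x *\<^sub>R g x"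
    show int: "integrable lebesgue ?g"
    proof -
      have "integrable lebesgue (\<lambda>x. indicator {-real n..real n} x *\<^sub>R g x)"
        using g by (auto simp: L1_loc_def set_integrable_def)
      then have "integrable lebesgue (\<lambda>x. indicator {-real n<..<real n} x *\<^sub>R (indicator {-real n..real n} x *\<^sub>R g x))"
        by (rule integrable_mult_indicator[rotated]) auto
      also have "(\<lambda>x. indicator {-real n<..<real n} x *\<^sub>R (indicator {-real n..real n} x *\<^sub>R g x)) = ?g"
        by (auto simp: indicator_def fun_eq_iff)
      finally show ?thesis .
    qed
    fix A :: "real set" assume "A \<in> sets lebesgue"
    then show "(LINT x:A|lebesgue. ?g x) = 0"
    proof (rule set_integral_zero_if_intervals[OF int, rotated 2])
      show "(LINT x:{a<..<b}|lebesgue. ?g x) = 0" for a b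
      proof -
        have "(\<lambda>x. indicator {a<..<b} x *\<^sub>R ?g x) = (\<lambda>x. indicator {max a (- real n)<..<min b (real n)} x *\<^sub>R g x)"
          by (auto simp: indicator_def fun_eq_iff)
        then show ?thesis using interval unfolding set_lebesgue_integral_def by metis
      qed
      show "(LINT x|lebesgue. ?g x) = 0" using interval unfolding set_lebesgue_integral_def .
    qed
  qed
  then have "AE x in lebesgue. \<forall>n::nat. indicator {-real n<..<real n} x *\<^sub>R g x = 0"
    unfolding AE_all_countable by blast
  then show ?thesis
  proof (rule eventually_mono)
    fix x assume *: "\<forall>n::nat. indicator {-real n<..<real n} x *\<^sub>R g x = 0"
    obtain n :: nat where "\<bar>x\<bar> < real n" using reals_Archimedean2 by blast
    then show "g x = 0" using *[rule_format, of n] by (auto simp: indicator_def)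
  qed
qed

lemma weak_derivative_unique:
  assumes "has_weak_derivative v w1" "has_weak_derivative v w2"
  shows "AE x in lebesgue. w1 x = w2 x"
proof -
  have L: "w1 \<in> L1_loc" "w2 \<in> L1_loc" using assms by (auto simp: has_weak_derivative_def)
  have "(\<lambda>x. w1 x - w2 x) \<in> L1_loc"
    using L by (auto simp: L1_loc_def intro!: set_integral_diff)
  moreover have "(LINT x|lebesgue. \<phi> x *\<^sub>R (w1 x - w2 x)) = 0" if \<phi>: "\<phi> \<in> test_functions" for \<phi>
  proof -
    obtain N \<phi>' where N: "\<And>x. \<bar>x\<bar> \<ge> N \<Longrightarrow> \<phi> x = 0" and d: "\<And>x. (\<phi> has_real_derivative \<phi>' x) (at x)"
      using test_functionE[OF \<phi>] by metis
    have c: "continuous_on UNIV \<phi>" using d by (intro continuous_at_imp_continuous_on) (auto intro: DERIV_isCont)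
    have "(LINT x|lebesgue. \<phi> x *\<^sub>R (w1 x - w2 x)) = (LINT x|lebesgue. \<phi> x *\<^sub>R w1 x) - (LINT x|lebesgue. \<phi> x *\<^sub>R w2 x)"
      unfolding scaleR_diff_right
      by (intro Bochner_Integration.integral_diff integrable_compact_support_mult[OF _ c N] L)
    moreover have "(LINT x|lebesgue. \<phi> x *\<^sub>R w1 x) = (LINT x|lebesgue. \<phi> x *\<^sub>R w2 x)"
    proof -
      have "- (LINT x|lebesgue. \<phi> x *\<^sub>R w1 x) = - (LINT x|lebesgue. \<phi> x *\<^sub>R w2 x)"
        using assms \<phi> unfolding has_weak_derivative_def by auto
      then show ?thesis by simp
    qed
    ultimately show ?thesis by simp
  qed
  ultimately have "AE x in lebesgue. w1 x - w2 x = 0" by (rule fundamental_lemma_calculus_of_variations)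
  then show ?thesis by simp
qed

text \<open>Removes weak derivatives from everything that follows: a weak derivative in
  \<open>L2\<close> agrees almost everywhere with the classical one, by uniqueness.\<close>

lemma energy_space_C1_iff:
  assumes v: "\<And>x. (v has_vector_derivative v' x) (at x)" and cont: "continuous_on UNIV v'"
  shows "v \<in> energy_space \<longleftrightarrow> integrable lebesgue (\<lambda>x. (1 - (cmod (v x))\<^sup>2)\<^sup>2) \<and>
     integrable lebesgue (\<lambda>x. (cmod (v' x))\<^sup>2)"
proof -
  have cv: "continuous_on UNIV v"
    using v by (meson continuous_at_imp_continuous_on has_vector_derivative_continuous)
  have weak: "has_weak_derivative v v'" by (rule classical_imp_weak_derivative[OF v cont])
  have H1: "v \<in> H1_loc" unfolding H1_loc_def using weak continuous_L2_loc[OF cv] continuous_L2_loc[OF cont] by blast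
  have "(\<exists>w\<in>L2. has_weak_derivative v w) \<longleftrightarrow> v' \<in> L2"
  proof
    assume "\<exists>w\<in>L2. has_weak_derivative v w"
    then obtain w where w: "w \<in> L2" "has_weak_derivative v w" by blast
    have "AE x in lebesgue. w x = v' x" by (rule weak_derivative_unique[OF w(2) weak])
    then have ae: "AE x in lebesgue. (cmod (w x))\<^sup>2 = (cmod (v' x))\<^sup>2" by eventually_elim simp
    have "integrable lebesgue (\<lambda>x. (cmod (v' x))\<^sup>2)"
      by (rule integrable_cong_AE_imp[OF _ _ ae])
        (use w(1) measurable_lebesgue_if_continuous[OF cont] in \<open>auto simp: L2_def\<close>)
    then show "v' \<in> L2" using measurable_lebesgue_if_continuous[OF cont] by (simp add: L2_def)
  qed (use weak in blast)
  moreover have "(\<lambda>x. 1 - (cmod (v x))\<^sup>2) \<in> L2 \<longleftrightarrow> integrable lebesgue (\<lambda>x. (1 - (cmod (v x))\<^sup>2)\<^sup>2)"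
  proof -
    have "(\<lambda>x. 1 - (cmod (v x))\<^sup>2) \<in> borel_measurable lebesgue"
      by (intro measurable_lebesgue_if_continuous continuous_intros cv)
    then show ?thesis by (simp add: L2_def)
  qed
  ultimately show ?thesis
    using H1 measurable_lebesgue_if_continuous[OF cont] by (auto simp: energy_space_def L2_def)
qed

section \<open>The profile\<close>

lemma artanh_cmult_has_derivative:
  fixes k s :: real
  assumes "\<bar>k * s\<bar> < 1"
  shows "((\<lambda>s. artanh (k * s)) has_real_derivative 1 / (1 - (k * s)\<^sup>2) * k) (at s)"
  by (rule DERIV_chain2[where f = artanh and g = "\<lambda>s. k * s"])
    (use assms in \<open>auto intro!: derivative_eq_intros artanh_real_has_field_derivative\<close>)

locale wave_parameters =
  fixes c \<kappa> :: real
  assumes c_nonneg: "0 \<le> c" and in_DD: "(c, \<kappa>) \<in> DD"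
begin

text \<open>\<open>a\<close> is the extremal value of the profile. \<open>2 * b\<close> and
  \<open>d\<close> are the values of \<open>1 - 2 * \<kappa> + 2 * \<kappa> * y\<close> at
  \<open>y = 0\<close> and \<open>y = a\<close>. The number \<open>1 / m\<close> is the limiting
  modulus of the slope at infinity.\<close>

definition a :: real where "a = 1 - c\<^sup>2 / 2"
definition b :: real where "b = 1 / 2 - \<kappa>"
definition d :: real where "d = 1 - \<kappa> * c\<^sup>2"
definition m :: real where "m = sqrt (b / a)"
definition N :: "real \<Rightarrow> real" where "N s = a - b * s\<^sup>2"

lemma d_eq: "d = 2 * (\<kappa> * a + b)"
  by (simp add: a_def b_def d_def field_simps)

lemma c_less_iff: "c < sqrt 2 \<longleftrightarrow> c\<^sup>2 < 2" "sqrt 2 < c \<longleftrightarrow> 2 < c\<^sup>2"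
  using c_nonneg real_sqrt_less_iff[of "c\<^sup>2" 2] real_sqrt_less_iff[of 2 "c\<^sup>2"] by simp_all

lemma D12_pos:
  assumes "(c, \<kappa>) \<in> D1 \<union> D2"
  shows "a > 0" "b > 0" "d > 0"
proof -
  have c2: "c\<^sup>2 < 2" and k: "\<kappa> < 1 / 2"
    using assms c_less_iff by (auto simp: D1_def D2_def)
  then show "a > 0" "b > 0" by (auto simp: a_def b_def)
  show "d > 0"
  proof (cases "\<kappa> \<le> 0")
    case True
    then have "\<kappa> * c\<^sup>2 \<le> 0" by (simp add: mult_nonpos_nonneg)
    then show ?thesis by (simp add: d_def)
  next
    case False
    then have "\<kappa> * c\<^sup>2 \<le> \<kappa> * 2" using c2 by (intro mult_left_mono) auto
    then show ?thesis using k by (simp add: d_def)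
  qed
qed

lemma D3_neg:
  assumes "(c, \<kappa>) \<in> D3"
  shows "a < 0" "b < 0" "d < 0" "\<kappa> > 0"
proof -
  have c2: "c\<^sup>2 > 2" and k: "\<kappa> > 1 / 2"
    using assms c_less_iff by (auto simp: D3_def)
  then show "a < 0" "b < 0" "\<kappa> > 0" by (auto simp: a_def b_def)
  have "\<kappa> * 2 < \<kappa> * c\<^sup>2" using c2 k by (intro mult_strict_left_mono) auto
  then show "d < 0" using k unfolding d_def by linarith
qed

text \<open>The alternatives are \<open>D1 \<union> D2\<close> and \<open>D3\<close>. Ratios such as
  \<open>b / a\<close>, \<open>a / d\<close> and \<open>b / d\<close> are positive in both, and most
  later estimates are phrased through them to avoid a case distinction.\<close>

lemma signs: "a > 0 \<and> b > 0 \<and> d > 0 \<or> a < 0 \<and> b < 0 \<and> d < 0"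
  using in_DD D12_pos D3_neg by (auto simp: DD_def)

lemma nonzero: "a \<noteq> 0" "b \<noteq> 0" "d \<noteq> 0"
  using signs by auto

lemma m_pos: "m > 0" and m_sq: "m\<^sup>2 = b / a"
proof -
  have "b / a > 0" using signs by (auto simp: zero_less_divide_iff)
  then show "m > 0" "m\<^sup>2 = b / a" by (auto simp: m_def)
qed

lemma range_iff: "\<bar>s\<bar> < 1 / m \<longleftrightarrow> m\<^sup>2 * s\<^sup>2 < 1" "\<bar>s\<bar> \<le> 1 / m \<longleftrightarrow> m\<^sup>2 * s\<^sup>2 \<le> 1"
proof -
  have "\<bar>s\<bar> < 1 / m \<longleftrightarrow> \<bar>m * s\<bar> < 1" "\<bar>s\<bar> \<le> 1 / m \<longleftrightarrow> \<bar>m * s\<bar> \<le> 1"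
    using m_pos by (auto simp: abs_mult field_simps)
  then show "\<bar>s\<bar> < 1 / m \<longleftrightarrow> m\<^sup>2 * s\<^sup>2 < 1" "\<bar>s\<bar> \<le> 1 / m \<longleftrightarrow> m\<^sup>2 * s\<^sup>2 \<le> 1"
    by (simp_all add: abs_square_less_1 abs_square_le_1 power_mult_distrib[symmetric])
qed

lemma N_eq: "N s = a * (1 - m\<^sup>2 * s\<^sup>2)"
  using nonzero by (simp add: N_def m_sq field_simps)

lemma N_over_a_pos: "\<bar>s\<bar> < 1 / m \<Longrightarrow> N s / a > 0"
  using nonzero by (simp add: N_eq range_iff)

lemma N_over_d_pos: "\<bar>s\<bar> < 1 / m \<Longrightarrow> N s / d > 0"
  using N_over_a_pos[of s] signs by (auto simp: zero_less_divide_iff)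

text \<open>The minimum of \<open>1 + \<kappa> * s\<^sup>2\<close> over
  \<open>\<bar>s\<bar> \<le> 1 / m\<close>: it sits at \<open>s = 0\<close> for
  \<open>\<kappa> \<ge> 0\<close> and at the endpoints, where \<open>s\<^sup>2 = a / b\<close>,
  otherwise.\<close>

definition pmin :: real where "pmin = min 1 (1 + \<kappa> * a / b)"

lemma pmin_pos: "pmin > 0"
proof -
  have "1 + \<kappa> * a / b = d / (2 * b)" using nonzero by (simp add: d_eq field_simps)
  moreover have "d / (2 * b) > 0" using signs by (auto simp: zero_less_divide_iff)
  ultimately show ?thesis by (simp add: pmin_def)
qed

lemma p_ge: "\<bar>s\<bar> \<le> 1 / m \<Longrightarrow> 1 + \<kappa> * s\<^sup>2 \<ge> pmin"
proof (cases "\<kappa> \<ge> 0")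
  case False
  assume "\<bar>s\<bar> \<le> 1 / m"
  then have "b / a * s\<^sup>2 \<le> 1" unfolding range_iff m_sq .
  moreover have "a / b > 0" using signs by (auto simp: zero_less_divide_iff)
  ultimately have "a / b * (b / a * s\<^sup>2) \<le> a / b * 1" by (intro mult_left_mono) auto
  then have "s\<^sup>2 \<le> a / b" using nonzero by simp
  then have "\<kappa> * (a / b) \<le> \<kappa> * s\<^sup>2" using False by (intro mult_left_mono_neg) auto
  then show ?thesis by (simp add: pmin_def)
next
  case True
  then have "0 \<le> \<kappa> * s\<^sup>2" by simp
  then show ?thesis by (simp add: pmin_def min_le_iff_disj)
qed

lemma p_pos: "\<bar>s\<bar> \<le> 1 / m \<Longrightarrow> 1 + \<kappa> * s\<^sup>2 > 0"
  using p_ge[of s] pmin_pos by simp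

section \<open>The time map and its inverse\<close>

definition A :: "real \<Rightarrow> real" where
  "A s = (if \<kappa> > 0 then 2 * sqrt \<kappa> * arctan (sqrt \<kappa> * s)
          else - 2 * sqrt (- \<kappa>) * artanh (sqrt (- \<kappa>) * s))"

text \<open>The formulas of F, G and H with a signed \<open>s\<close> in place of the square root.
  Being odd, it describes both halves of the wave at once, so the even extension of the inverse
  needs no gluing at the origin. The summand \<open>A\<close> stays smooth up to
  \<open>\<bar>s\<bar> = 1 / m\<close>; only the second summand blows up.\<close>

definition \<Phi> :: "real \<Rightarrow> real" where
  "\<Phi> s = A s + 2 * m * artanh (m * s)"

lemma artanh_range: "\<kappa> \<le> 0 \<Longrightarrow> \<bar>s\<bar> \<le> 1 / m \<Longrightarrow> \<bar>sqrt (- \<kappa>) * s\<bar> < 1"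
  using p_pos[of s] by (simp add: abs_square_less_1[symmetric] power_mult_distrib)

lemma A_deriv:
  assumes "\<bar>s\<bar> \<le> 1 / m"
  shows "(A has_real_derivative 2 * \<kappa> / (1 + \<kappa> * s\<^sup>2)) (at s)"
proof (cases "\<kappa> > 0")
  case True
  have "((\<lambda>s. 2 * sqrt \<kappa> * arctan (sqrt \<kappa> * s)) has_real_derivative 2 * \<kappa> / (1 + \<kappa> * s\<^sup>2)) (at s)"
    using True by (auto intro!: derivative_eq_intros simp: power_mult_distrib field_simps)
  then show ?thesis using True by (simp add: A_def[abs_def])
next
  case False
  have r: "\<bar>sqrt (- \<kappa>) * s\<bar> < 1" using artanh_range[OF _ assms] False by simp
  have "((\<lambda>s. - 2 * sqrt (- \<kappa>) * artanh (sqrt (- \<kappa>) * s)) has_real_derivative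
      - 2 * sqrt (- \<kappa>) * (1 / (1 - (sqrt (- \<kappa>) * s)\<^sup>2) * sqrt (- \<kappa>))) (at s)"
    by (intro DERIV_cmult artanh_cmult_has_derivative r)
  also have "- 2 * sqrt (- \<kappa>) * (1 / (1 - (sqrt (- \<kappa>) * s)\<^sup>2) * sqrt (- \<kappa>)) = 2 * \<kappa> / (1 + \<kappa> * s\<^sup>2)"
  proof -
    have sq: "sqrt (- \<kappa>) * sqrt (- \<kappa>) = - \<kappa>" using False by simp
    have "- 2 * sqrt (- \<kappa>) * (1 / (1 - (sqrt (- \<kappa>) * s)\<^sup>2) * sqrt (- \<kappa>))
        = - 2 * (sqrt (- \<kappa>) * sqrt (- \<kappa>)) / (1 - (sqrt (- \<kappa>) * s)\<^sup>2)" by simp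
    then show ?thesis unfolding sq using False by (simp add: power_mult_distrib)
  qed
  finally show ?thesis using False by (simp add: A_def[abs_def])
qed

text \<open>Partial fractions: the two derivatives combine because
  \<open>2 * (\<kappa> + m\<^sup>2) * a = d\<close>.\<close>

lemma \<Phi>_deriv:
  assumes "\<bar>s\<bar> < 1 / m"
  shows "(\<Phi> has_real_derivative d / ((1 + \<kappa> * s\<^sup>2) * N s)) (at s)"
proof -
  have ms: "\<bar>m * s\<bar> < 1" using assms m_pos by (simp add: abs_mult field_simps)
  have "(\<Phi> has_real_derivative 2 * \<kappa> / (1 + \<kappa> * s\<^sup>2) + 2 * m * (1 / (1 - (m * s)\<^sup>2) * m)) (at s)"
    unfolding \<Phi>_def
    by (intro DERIV_add A_deriv DERIV_cmult artanh_cmult_has_derivative ms) (use assms in simp)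
  also have "2 * \<kappa> / (1 + \<kappa> * s\<^sup>2) + 2 * m * (1 / (1 - (m * s)\<^sup>2) * m) = d / ((1 + \<kappa> * s\<^sup>2) * N s)"
  proof -
    have p: "1 + \<kappa> * s\<^sup>2 \<noteq> 0" using p_pos[of s] assms by auto
    have w: "1 - m\<^sup>2 * s\<^sup>2 \<noteq> 0" using assms range_iff by auto
    have "2 * \<kappa> / (1 + \<kappa> * s\<^sup>2) + 2 * m * (1 / (1 - (m * s)\<^sup>2) * m)
        = 2 * \<kappa> / (1 + \<kappa> * s\<^sup>2) + 2 * m\<^sup>2 / (1 - m\<^sup>2 * s\<^sup>2)"
      by (simp add: power_mult_distrib) (simp add: power2_eq_square)
    also have "\<dots> = 2 * (\<kappa> + m\<^sup>2) / ((1 + \<kappa> * s\<^sup>2) * (1 - m\<^sup>2 * s\<^sup>2))"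
      using p w by (simp add: divide_simps) (simp add: algebra_simps)
    also have "\<dots> = 2 * (\<kappa> + m\<^sup>2) * a / ((1 + \<kappa> * s\<^sup>2) * N s)"
      unfolding N_eq using nonzero p w by (simp add: divide_simps)
    also have "2 * (\<kappa> + m\<^sup>2) * a = d" using nonzero by (simp add: m_sq d_eq field_simps)
    finally show ?thesis .
  qed
  finally show ?thesis .
qed

lemma \<Phi>_deriv_pos: "\<bar>s\<bar> < 1 / m \<Longrightarrow> d / ((1 + \<kappa> * s\<^sup>2) * N s) > 0"
  using N_over_d_pos[of s] p_pos[of s] by (auto simp: zero_less_divide_iff zero_less_mult_iff mult_less_0_iff)

lemma \<Phi>_strict_mono:
  assumes "\<bar>s\<bar> < 1 / m" "\<bar>t\<bar> < 1 / m" "s < t"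
  shows "\<Phi> s < \<Phi> t"
proof (rule DERIV_pos_imp_increasing[OF assms(3)])
  fix x assume "s \<le> x" "x \<le> t"
  then have "\<bar>x\<bar> < 1 / m" using assms by linarith
  then show "\<exists>y. (\<Phi> has_real_derivative y) (at x) \<and> 0 < y" using \<Phi>_deriv \<Phi>_deriv_pos by blast
qed

lemma \<Phi>_inj: "\<bar>s\<bar> < 1 / m \<Longrightarrow> \<bar>t\<bar> < 1 / m \<Longrightarrow> \<Phi> s = \<Phi> t \<Longrightarrow> s = t"
  using \<Phi>_strict_mono by (metis less_irrefl linorder_neqE_linordered_idom)

lemma \<Phi>_0 [simp]: "\<Phi> 0 = 0"
  by (simp add: \<Phi>_def A_def)

lemma \<Phi>_minus: "\<bar>s\<bar> < 1 / m \<Longrightarrow> \<Phi> (- s) = - \<Phi> s"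
  using artanh_range[of s] artanh_minus_real[of "sqrt (- \<kappa>) * s"] artanh_minus_real[of "m * s"] m_pos
  by (auto simp: \<Phi>_def A_def arctan_minus abs_mult field_simps)

lemma \<Phi>_surj_nonneg:
  assumes "x \<ge> 0"
  shows "\<exists>s. \<bar>s\<bar> < 1 / m \<and> \<Phi> s = x"
proof -
  have "continuous_on {0..1 / m} A"
    by (intro continuous_at_imp_continuous_on ballI DERIV_isCont[OF A_deriv]) auto
  then have "bounded (A ` {0..1 / m})" by (intro compact_imp_bounded compact_continuous_image) auto
  then obtain B where "\<forall>y\<in>A ` {0..1 / m}. norm y \<le> B" unfolding bounded_iff by blast
  then have B: "\<And>s. s \<in> {0..1 / m} \<Longrightarrow> \<bar>A s\<bar> \<le> B" by simp
  have "B \<ge> 0" using order_trans[OF abs_ge_zero B[of 0]] m_pos by simp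
  \<comment> \<open>Chosen so that the unbounded summand, equal to \<open>2 * m * z\<close> at
    \<open>t\<close>, compensates for the bound \<open>B\<close> on \<open>A\<close> and still
    reaches \<open>x\<close>.\<close>
  define z where "z = (x + B) / (2 * m)"
  define t where "t = tanh z / m"
  have z: "z \<ge> 0" using assms \<open>B \<ge> 0\<close> m_pos by (simp add: z_def)
  then have t: "0 \<le> t" "t < 1 / m" using m_pos tanh_real_lt_1[of z] by (auto simp: t_def divide_strict_right_mono)
  have "\<Phi> t \<ge> - B + 2 * m * z"
    using B[of t] t m_pos by (auto simp: \<Phi>_def t_def artanh_tanh_real)
  also have "- B + 2 * m * z = x" using m_pos by (simp add: z_def)
  finally have "x \<le> \<Phi> t" .
  then have "\<exists>s. 0 \<le> s \<and> s \<le> t \<and> \<Phi> s = x"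
    by (intro IVT') (use assms t in \<open>auto intro!: continuous_at_imp_continuous_on DERIV_isCont[OF \<Phi>_deriv]\<close>)
  then show ?thesis using t by (metis abs_of_nonneg le_less_trans)
qed

lemma \<Phi>_surj: "\<exists>s. \<bar>s\<bar> < 1 / m \<and> \<Phi> s = x"
proof (cases "x \<ge> 0")
  case False
  then obtain s where "\<bar>s\<bar> < 1 / m" "\<Phi> s = - x" using \<Phi>_surj_nonneg[of "- x"] by auto
  then show ?thesis using \<Phi>_minus[of s] by (intro exI[of _ "- s"]) auto
qed (rule \<Phi>_surj_nonneg)

text \<open>The solution of the slope equation on the whole line with value 0 at the origin,
  obtained by inverting the time map.\<close>

definition S :: "real \<Rightarrow> real" where "S x = (THE s. \<bar>s\<bar> < 1 / m \<and> \<Phi> s = x)"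

lemma S_bound: "\<bar>S x\<bar> < 1 / m" and \<Phi>_S: "\<Phi> (S x) = x"
proof -
  have "\<exists>!s. \<bar>s\<bar> < 1 / m \<and> \<Phi> s = x" using \<Phi>_surj[of x] \<Phi>_inj by blast
  from theI'[OF this] show "\<bar>S x\<bar> < 1 / m" "\<Phi> (S x) = x" by (simp_all add: S_def)
qed

lemma S_eqI: "\<bar>s\<bar> < 1 / m \<Longrightarrow> \<Phi> s = x \<Longrightarrow> S x = s"
  using S_bound \<Phi>_S \<Phi>_inj by metis

lemma S_0 [simp]: "S 0 = 0"
  by (rule S_eqI) (use m_pos in auto)

lemma S_minus: "S (- x) = - S x"
  by (rule S_eqI) (use S_bound \<Phi>_S \<Phi>_minus in auto)

lemma S_strict_mono: "x < y \<Longrightarrow> S x < S y"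
  using \<Phi>_strict_mono[OF S_bound S_bound, of y x] \<Phi>_S by (metis linorder_neqE_linordered_idom order_less_asym)

lemma S_pos: "x > 0 \<Longrightarrow> S x > 0"
  using S_strict_mono[of 0 x] by simp

lemma S_abs: "S \<bar>x\<bar> = \<bar>S x\<bar>"
  using S_pos[of x] S_pos[of "- x"] S_minus[of x] by (cases "x = 0") (auto simp: abs_if)

lemma S_eq_0_iff: "S x = 0 \<longleftrightarrow> x = 0"
  using \<Phi>_S[of x] by (metis S_0 \<Phi>_0)

lemma S_deriv: "(S has_real_derivative (1 + \<kappa> * (S x)\<^sup>2) * N (S x) / d) (at x)"
proof -
  \<comment> \<open>Half the distance to the boundary keeps a closed neighbourhood of
    \<open>S x\<close> inside the domain where \<open>\<Phi>\<close> is known to be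
    differentiable.\<close>
  define e where "e = (1 / m - \<bar>S x\<bar>) / 2"
  have e: "e > 0" using S_bound[of x] by (simp add: e_def)
  have near: "\<bar>z\<bar> < 1 / m" if "\<bar>z - S x\<bar> \<le> e" for z
  proof -
    have "\<bar>z\<bar> \<le> \<bar>S x\<bar> + e" using that by linarith
    also have "\<dots> < 1 / m" using S_bound[of x] by (simp add: e_def field_simps)
    finally show ?thesis .
  qed
  have "isCont S (\<Phi> (S x))"
    by (rule isCont_inverse_function[OF e]) (use near in \<open>auto intro: S_eqI DERIV_isCont[OF \<Phi>_deriv]\<close>)
  then have "(S has_real_derivative inverse (d / ((1 + \<kappa> * (S x)\<^sup>2) * N (S x)))) (at x)"
    using \<Phi>_deriv_pos[OF S_bound[of x]]
    by (intro DERIV_inverse_function[where f = \<Phi> and g = S and x = x and a = "x - 1" and b = "x + 1"] \<Phi>_deriv[OF S_bound])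
      (auto simp: \<Phi>_S)
  then show ?thesis by simp
qed

definition \<eta> :: "real \<Rightarrow> real" where "\<eta> x = N (S x) / (1 + \<kappa> * (S x)\<^sup>2)"

lemma p_S_pos: "1 + \<kappa> * (S x)\<^sup>2 > 0"
  using p_pos[of "S x"] S_bound[of x] by simp

section \<open>Identification with the inverses of F, G and H\<close>

definition \<sigma> :: "real \<Rightarrow> real" where "\<sigma> y = sqrt ((2 - c\<^sup>2 - 2 * y) / (1 - 2 * \<kappa> + 2 * \<kappa> * y))"

lemma ratio_profile:
  assumes "\<bar>s\<bar> < 1 / m"
  shows "2 - c\<^sup>2 - 2 * (N s / (1 + \<kappa> * s\<^sup>2)) = s\<^sup>2 * d / (1 + \<kappa> * s\<^sup>2)"
    "1 - 2 * \<kappa> + 2 * \<kappa> * (N s / (1 + \<kappa> * s\<^sup>2)) = d / (1 + \<kappa> * s\<^sup>2)"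
proof -
  have p: "1 + \<kappa> * s\<^sup>2 \<noteq> 0" using p_pos[of s] assms by auto
  show "2 - c\<^sup>2 - 2 * (N s / (1 + \<kappa> * s\<^sup>2)) = s\<^sup>2 * d / (1 + \<kappa> * s\<^sup>2)"
    using p by (simp add: N_def a_def b_def d_def divide_simps) (simp add: algebra_simps)
  show "1 - 2 * \<kappa> + 2 * \<kappa> * (N s / (1 + \<kappa> * s\<^sup>2)) = d / (1 + \<kappa> * s\<^sup>2)"
    using p by (simp add: N_def a_def b_def d_def divide_simps) (simp add: algebra_simps)
qed

lemma \<sigma>_profile:
  assumes "\<bar>s\<bar> < 1 / m"
  shows "\<sigma> (N s / (1 + \<kappa> * s\<^sup>2)) = \<bar>s\<bar>"
proof -
  have "1 + \<kappa> * s\<^sup>2 \<noteq> 0" using p_pos[of s] assms by auto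
  then show ?thesis unfolding \<sigma>_def ratio_profile[OF assms] using nonzero by simp
qed

text \<open>One name for both intervals: relative to \<open>a\<close>, each is described by
  \<open>0 < y / a \<le> 1\<close>, whatever the sign of \<open>a\<close>.\<close>

definition I :: "real set" where "I = (if a > 0 then I_int c else J_int c)"

lemma mem_I_iff: "y \<in> I \<longleftrightarrow> 0 < y / a \<and> y / a \<le> 1"
  using nonzero(1) by (auto simp: I_def I_int_def J_int_def a_def[symmetric] zero_less_divide_iff divide_le_eq)

text \<open>Solving \<open>y = N s / (1 + \<kappa> * s\<^sup>2)\<close> for \<open>s\<^sup>2\<close>
  gives the radicand of \<open>\<sigma>\<close>. The point is that its denominator \<open>q\<close>
  does not vanish on \<open>I\<close>: \<open>q / d\<close> interpolates affinely in
  \<open>y / a\<close> between the positive numbers \<open>2 * b / d\<close> and 1.\<close>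

lemma \<sigma>_props:
  assumes "y \<in> I"
  shows "\<bar>\<sigma> y\<bar> < 1 / m" "y = N (\<sigma> y) / (1 + \<kappa> * (\<sigma> y)\<^sup>2)"
proof -
  define q where "q = 1 - 2 * \<kappa> + 2 * \<kappa> * y"
  have y: "0 < y / a" "y / a \<le> 1" using assms by (auto simp: mem_I_iff)
  have "q = 2 * b * (1 - y / a) + d * (y / a)"
    using nonzero by (simp add: q_def d_eq b_def field_simps)
  then have "q / d = 2 * (b / d) * (1 - y / a) + y / a"
    using nonzero by (simp add: field_simps)
  moreover have "b / d > 0" using signs by (auto simp: zero_less_divide_iff)
  ultimately have qd: "q / d > 0" using y by (simp only:) (intro add_nonneg_pos mult_nonneg_nonneg, auto)
  then have q0: "q \<noteq> 0" by auto
  have "a / d \<ge> 0" using signs by (auto simp: zero_le_divide_iff)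
  then have "0 \<le> 2 * (1 - y / a) * (a / d) / (q / d)"
    by (intro divide_nonneg_pos[OF mult_nonneg_nonneg]) (use y qd in simp_all)
  also have "2 * (1 - y / a) * (a / d) / (q / d) = (2 - c\<^sup>2 - 2 * y) / q"
    using nonzero q0 by (simp add: field_simps a_def)
  finally have r: "0 \<le> (2 - c\<^sup>2 - 2 * y) / q" .
  then have sq: "(\<sigma> y)\<^sup>2 = (2 - c\<^sup>2 - 2 * y) / q" by (simp add: \<sigma>_def q_def)
  have "1 - m\<^sup>2 * (\<sigma> y)\<^sup>2 = (y / a) / (q / d)"
    unfolding sq m_sq using nonzero q0 by (simp add: field_simps) (simp add: q_def a_def b_def d_def algebra_simps)
  also have "\<dots> > 0" by (rule divide_pos_pos[OF y(1) qd])
  finally show "\<bar>\<sigma> y\<bar> < 1 / m" by (simp add: range_iff)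
  have p: "1 + \<kappa> * (\<sigma> y)\<^sup>2 = d / q"
    unfolding sq using q0 by (simp add: field_simps) (simp add: q_def d_def algebra_simps)
  have n: "N (\<sigma> y) = y * d / q"
    unfolding sq N_def using q0 by (simp add: field_simps) (simp add: q_def d_def a_def b_def algebra_simps)
  show "y = N (\<sigma> y) / (1 + \<kappa> * (\<sigma> y)\<^sup>2)" unfolding p n using q0 nonzero by simp
qed

lemma profile_in_I:
  assumes "\<bar>s\<bar> < 1 / m"
  shows "N s / (1 + \<kappa> * s\<^sup>2) \<in> I"
proof -
  have p: "1 + \<kappa> * s\<^sup>2 > 0" using p_pos[of s] assms by auto
  have "N s / (1 + \<kappa> * s\<^sup>2) / a = (N s / a) / (1 + \<kappa> * s\<^sup>2)" by simp
  moreover have "\<dots> > 0" by (rule divide_pos_pos[OF N_over_a_pos[OF assms] p])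
  moreover have "N s / (1 + \<kappa> * s\<^sup>2) / a \<le> 1"
  proof -
    have "d / a > 0" using signs by (auto simp: zero_less_divide_iff)
    have "1 - N s / (1 + \<kappa> * s\<^sup>2) / a = s\<^sup>2 * (d / a) / (2 * (1 + \<kappa> * s\<^sup>2))"
      using p nonzero by (simp add: divide_simps N_def) (simp add: d_eq algebra_simps)
    also have "\<dots> \<ge> 0"
      by (rule divide_nonneg_pos[OF mult_nonneg_nonneg]) (use p \<open>d / a > 0\<close> in \<open>simp_all add: less_imp_le\<close>)
    finally show ?thesis by simp
  qed
  ultimately show ?thesis unfolding mem_I_iff by linarith
qed

lemma m_\<sigma>: "2 * sqrt ((1 - 2 * \<kappa>) / (2 - c\<^sup>2)) * artanh (sqrt (((1 - 2 * \<kappa>) * (2 - c\<^sup>2 - 2 * y)) / ((2 - c\<^sup>2) * (1 - 2 * \<kappa> + 2 * \<kappa> * y))))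
   = 2 * m * artanh (m * \<sigma> y)"
proof -
  have "b / a = (1 - 2 * \<kappa>) / (2 - c\<^sup>2)" using nonzero(1) by (simp add: a_def b_def field_simps)
  then show ?thesis by (simp add: m_def \<sigma>_def real_sqrt_mult[symmetric] del: real_sqrt_divide)
qed

lemma F_fun_eq: "\<kappa> > 0 \<Longrightarrow> F_fun c \<kappa> y = \<Phi> (\<sigma> y)"
  unfolding F_fun_def m_\<sigma> by (simp add: \<Phi>_def A_def \<sigma>_def)

lemma G_fun_eq: "\<kappa> \<le> 0 \<Longrightarrow> G_fun c \<kappa> y = \<Phi> (\<sigma> y)"
  unfolding G_fun_def m_\<sigma> by (simp add: \<Phi>_def A_def \<sigma>_def)

text \<open>\<open>\<sigma>\<close> recovers \<open>\<bar>S x\<bar> = S \<bar>x\<bar>\<close> from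
  \<open>\<eta> x\<close>, and \<open>\<Phi>\<close> sends it to \<open>\<bar>x\<bar>\<close>. Only
  the factorization of \<open>f\<close> through \<open>\<sigma>\<close> matters, so one argument
  serves F, G and H.\<close>

lemma the_inv_into_profile:
  assumes "\<And>y. f y = \<Phi> (\<sigma> y)"
  shows "the_inv_into I f \<bar>x\<bar> = \<eta> x"
proof (rule the_inv_into_f_eq)
  show "inj_on f I"
  proof (rule inj_onI)
    fix y z assume yz: "y \<in> I" "z \<in> I" "f y = f z"
    have "\<sigma> y = \<sigma> z" by (rule \<Phi>_inj) (use yz \<sigma>_props(1) assms in auto)
    then show "y = z" using \<sigma>_props(2)[OF yz(1)] \<sigma>_props(2)[OF yz(2)] by simp
  qed
  show "f (\<eta> x) = \<bar>x\<bar>"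
    using \<sigma>_profile[OF S_bound, of x] \<Phi>_S[of "\<bar>x\<bar>"] by (simp add: assms \<eta>_def S_abs)
  show "\<eta> x \<in> I" unfolding \<eta>_def by (rule profile_in_I[OF S_bound])
qed

lemma eta_eq: "eta c \<kappa> x = \<eta> x"
proof -
  consider "(c, \<kappa>) \<in> D1" | "(c, \<kappa>) \<in> D2" "(c, \<kappa>) \<notin> D1" | "(c, \<kappa>) \<in> D3" "(c, \<kappa>) \<notin> D1" "(c, \<kappa>) \<notin> D2"
    using in_DD by (auto simp: DD_def)
  then show ?thesis
  proof cases
    case 1
    then have "\<kappa> > 0" "I = I_int c" using D12_pos by (auto simp: D1_def I_def)
    then show ?thesis using 1 the_inv_into_profile[OF F_fun_eq] by (simp add: eta_def F_inv_def)
  next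
    case 2
    then have "\<kappa> \<le> 0" "I = I_int c" using D12_pos by (auto simp: D2_def I_def)
    then show ?thesis using 2 the_inv_into_profile[OF G_fun_eq] by (simp add: eta_def G_inv_def)
  next
    case 3
    then have "\<kappa> > 0" "I = J_int c" using D3_neg by (auto simp: I_def)
    then show ?thesis using 3 the_inv_into_profile[of "H_fun c \<kappa>"] F_fun_eq
      by (simp add: eta_def H_inv_def H_fun_def)
  qed
qed

end

lemma integrable_exp_dominated:
  fixes f :: "real \<Rightarrow> 'a::euclidean_space"
  assumes "exp_dominated C f" "C > 0" "continuous_on UNIV f"
  shows "integrable lebesgue (\<lambda>x. (norm (f x))\<^sup>2)"
proof -
  obtain A where A: "A > 0" "\<And>x. norm (f x) \<le> A * exp (- C * \<bar>x\<bar>)"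
    using assms(1) by (rule exp_dominated_pos) blast
  \<comment> \<open>Half-line exponential; together with its reflection it dominates the two-sided
    one.\<close>
  define g where "g = (\<lambda>x::real. indicator {0..} x *\<^sub>R exp (- (2 * C) * x))"
  have g: "integrable lborel g"
  proof -
    have "(\<lambda>x. exp (- (2 * C) * x)) absolutely_integrable_on {0..}"
      by (intro nonnegative_absolutely_integrable_1 integrable_on_exp_minus_to_infinity) (use assms in auto)
    then have "integrable lebesgue g" unfolding set_integrable_def g_def .
    moreover have "g \<in> borel_measurable lborel" unfolding g_def by simp
    ultimately show ?thesis using integrable_completion by blast
  qed
  have g': "integrable lborel (\<lambda>x. g (- x))"
    using lborel_integrable_real_affine[OF g, of "-1" 0] by simp
  have gle: "exp (- (2 * C) * \<bar>x\<bar>) \<le> g x + g (- x)" for x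
    by (cases "x \<ge> 0") (auto simp: g_def indicator_def)
  have "integrable lborel (\<lambda>x. (norm (f x))\<^sup>2)"
  proof (rule Bochner_Integration.integrable_bound)
    show "integrable lborel (\<lambda>x. A\<^sup>2 * (g x + g (- x)))"
      by (intro integrable_mult_right Bochner_Integration.integrable_add g g')
    have "continuous_on UNIV (\<lambda>x. (norm (f x))\<^sup>2)" by (intro continuous_intros assms)
    then show "(\<lambda>x. (norm (f x))\<^sup>2) \<in> borel_measurable lborel"
      using borel_measurable_continuous_onI by auto
    have "(norm (f x))\<^sup>2 \<le> A\<^sup>2 * (g x + g (- x))" for x
    proof -
      have "(norm (f x))\<^sup>2 \<le> (A * exp (- C * \<bar>x\<bar>))\<^sup>2"
        by (rule power_mono[OF A(2)]) simp
      also have "\<dots> = A\<^sup>2 * exp (- (2 * C) * \<bar>x\<bar>)"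
        by (simp add: power_mult_distrib exp_double[symmetric] mult.assoc)
      also have "\<dots> \<le> A\<^sup>2 * (g x + g (- x))" by (intro mult_left_mono gle) auto
      finally show ?thesis .
    qed
    then show "AE x in lborel. norm ((norm (f x))\<^sup>2) \<le> norm (A\<^sup>2 * (g x + g (- x)))"
      by (intro AE_I2) (simp add: order_trans[OF _ abs_ge_self])
  qed
  then show ?thesis using integrable_completion borel_measurable_integrable by blast
qed

text \<open>The hypothesis on \<open>d - p\<close> is where the conjugate \<open>2 * s - z\<close> of \<open>z = s - \<i> c\<close> enters.\<close>
lemma travelling_wave_identity:
  fixes s z \<kappa> a b d n p :: "'a::field"
  assumes "z \<noteq> 0" "p \<noteq> 0" "d \<noteq> 0" and d: "d = 2 * (\<kappa> * a + b)" and n: "n = a - b * s\<^sup>2"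
    and p: "p = 1 + \<kappa> * s\<^sup>2" and dp: "d - p = - \<kappa> * z * (2 * s - z)"
  shows "(s - z) * (n / z) + (- (2 * b * s) * (p * n / d) / z - n * (p * n / d) / z\<^sup>2) + (n / z)\<^sup>2
     + n / p + \<kappa> * (n / p * s\<^sup>2 - n\<^sup>2 / d) = 0" (is "?L = 0")
proof -
  have 1: "n / p + \<kappa> * (n / p * s\<^sup>2 - n\<^sup>2 / d) = n - \<kappa> * n\<^sup>2 / d"
  proof -
    have "n / p + \<kappa> * (n / p * s\<^sup>2 - n\<^sup>2 / d) = n * (1 + \<kappa> * s\<^sup>2) / p - \<kappa> * n\<^sup>2 / d"
      by (simp add: algebra_simps add_divide_distrib)
    then show ?thesis using assms(2) unfolding p[symmetric] by simp
  qed
  have 2: "(n / z)\<^sup>2 - n * (p * n / d) / z\<^sup>2 = n\<^sup>2 * (d - p) / (d * z\<^sup>2)"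
    using assms(1,3) by (simp add: field_simps power2_eq_square)
  have 3: "n\<^sup>2 * (d - p) / (d * z\<^sup>2) = - (\<kappa> * n\<^sup>2 * (2 * s - z)) / (d * z)"
    unfolding dp using assms(1,3) by (simp add: field_simps power2_eq_square)
  have "?L = (s - z) * (n / z) - 2 * b * s * (p * n / d) / z + n\<^sup>2 * (d - p) / (d * z\<^sup>2) + (n - \<kappa> * n\<^sup>2 / d)"
    unfolding 1[symmetric] 2[symmetric] by (simp add: algebra_simps)
  also have "\<dots> = n * s * (d - 2 * b * p - 2 * \<kappa> * n) / (d * z)"
    unfolding 3 using assms(1,3) by (simp add: field_simps power2_eq_square)
  \<comment> \<open>In \<open>2 * b * p + 2 * \<kappa> * n\<close> the terms with
    \<open>s\<^sup>2\<close> cancel, leaving \<open>d\<close>.\<close>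
  also have "d - 2 * b * p - 2 * \<kappa> * n = 0"
    unfolding d n p by (simp add: algebra_simps)
  finally show ?thesis by simp
qed

context wave_parameters
begin

section \<open>Smoothness and exponential decay of the profile\<close>

lemma eta_fun: "eta c \<kappa> = \<eta>"
  by (rule ext) (rule eta_eq)

lemma S_vderiv: "(S has_vector_derivative (1 + \<kappa> * (S x)\<^sup>2) * N (S x) / d) (at x)"
  using S_deriv by (simp add: has_real_derivative_iff_has_vector_derivative)

text \<open>The derivative of \<open>S\<close> is a polynomial in \<open>S\<close>, so bounds of
  order \<open>n\<close> on \<open>S\<close> yield bounds of order \<open>n\<close> on its
  derivative.\<close>

lemma decays_S: "decays 0 n S"
proof (induction n)
  have dom: "exp_dominated 0 S"
    unfolding exp_dominated_0_iff using S_bound by (auto intro!: exI[of _ "1 / m"] less_imp_le)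
  {
    case 0
    show ?case using dom by simp
  next
    case (Suc n)
    have "decays 0 n (\<lambda>x. (1 / d) * ((1 + \<kappa> * (S x)\<^sup>2) * (a - b * (S x)\<^sup>2)))"
      by (intro decays_cmult decays_mult_bounded decays_add decays_diff decays_const decays_power2 Suc)
    then show ?case by (intro decays_SucI[OF dom S_vderiv]) (simp add: N_def)
  }
qed

lemma decays_p: "decays 0 n (\<lambda>x. 1 + \<kappa> * (S x)\<^sup>2)"
  by (intro decays_cmult decays_add decays_const decays_power2 decays_S)

lemma decays_inverse_p: "decays 0 n (\<lambda>x. inverse (1 + \<kappa> * (S x)\<^sup>2))"
proof (rule decays_inverse[OF decays_p pmin_pos])
  show "pmin \<le> norm (1 + \<kappa> * (S x)\<^sup>2)" for x
    using p_ge[OF less_imp_le[OF S_bound], of x] by simp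
qed

text \<open>\<open>N (S x)\<close> is a factor of its own derivative. This gives its exponential
  decay, and also lets the decay pass to higher derivatives by induction.\<close>

lemma N_S_deriv: "((\<lambda>x. N (S x)) has_real_derivative
    N (S x) * (- (2 * b / d) * (S x * (1 + \<kappa> * (S x)\<^sup>2)))) (at x)"
  unfolding N_def by (rule derivative_eq_intros S_deriv refl)+ (simp add: N_def field_simps)

lemma N_S_exp_dominated: "\<exists>C>0. exp_dominated C (\<lambda>x. N (S x))"
proof -
  \<comment> \<open>For \<open>x \<ge> 1\<close> monotonicity of \<open>S\<close> and the bound
    \<open>pmin\<close> make the logarithmic derivative of \<open>h\<close> at most
    \<open>- C\<close>. The rate is not meant to be sharp; starting at 1 keeps away from the crest,
    where it degenerates.\<close>
  define C where "C = 2 * (b / d) * (S 1 * pmin)"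
  define h where "h = (\<lambda>x. N (S x) / a)"
  have bd: "b / d > 0" using signs by (auto simp: zero_less_divide_iff)
  have C: "C > 0" unfolding C_def by (intro mult_pos_pos bd S_pos pmin_pos) simp_all
  have h: "0 < h x" "h x \<le> 1" for x
  proof -
    show "0 < h x" unfolding h_def by (rule N_over_a_pos[OF S_bound])
    show "h x \<le> 1" unfolding h_def N_eq using nonzero by simp
  qed
  have dec: "h x * exp (C * x) \<le> h 1 * exp (C * 1)" if "1 \<le> x" for x
  proof (rule DERIV_nonpos_imp_nonincreasing[OF that])
    fix y :: real assume y: "1 \<le> y" "y \<le> x"
    have hd: "(h has_real_derivative h y * (- (2 * b / d) * (S y * (1 + \<kappa> * (S y)\<^sup>2)))) (at y)"
      unfolding h_def using DERIV_cdivide[OF N_S_deriv[of y], of a] by (simp add: mult_ac)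
    have "((\<lambda>x. h x * exp (C * x)) has_real_derivative
        h y * exp (C * y) * (C - (2 * b / d) * (S y * (1 + \<kappa> * (S y)\<^sup>2)))) (at y)"
      by (rule derivative_eq_intros hd refl)+ (simp add: algebra_simps)
    moreover have "h y * exp (C * y) * (C - (2 * b / d) * (S y * (1 + \<kappa> * (S y)\<^sup>2))) \<le> 0"
    proof (rule mult_nonneg_nonpos)
      have "S 1 \<le> S y" using S_strict_mono[of 1 y] y by (cases "y = 1") auto
      then have "S 1 * pmin \<le> S y * (1 + \<kappa> * (S y)\<^sup>2)"
        using S_pos[of 1] pmin_pos p_ge[of "S y"] S_bound[of y] by (intro mult_mono) auto
      then have "2 * (b / d) * (S 1 * pmin) \<le> 2 * (b / d) * (S y * (1 + \<kappa> * (S y)\<^sup>2))"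
        using bd by (intro mult_left_mono) auto
      then show "C - (2 * b / d) * (S y * (1 + \<kappa> * (S y)\<^sup>2)) \<le> 0" by (simp add: C_def)
    qed (use h[of y] in simp)
    ultimately show "\<exists>D. ((\<lambda>x. h x * exp (C * x)) has_real_derivative D) (at y) \<and> D \<le> 0" by blast
  qed
  have le: "h x \<le> exp C * exp (- C * x)" if "0 \<le> x" for x
  proof (cases "x \<ge> 1")
    case True
    have "h 1 * exp (C * 1) \<le> 1 * exp C" using h(2)[of 1] by (simp add: mult_right_mono)
    with dec[OF True] have "h x * exp (C * x) \<le> exp C" by linarith
    then show ?thesis by (simp add: exp_minus field_simps)
  next
    case False
    then have "C * x \<le> C * 1" using C by (intro mult_left_mono) auto
    then have "1 \<le> exp C * exp (- C * x)" by (simp add: exp_add[symmetric])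
    then show ?thesis using h(2)[of x] by linarith
  qed
  have "norm (N (S x)) \<le> \<bar>a\<bar> * exp C * exp (- C * \<bar>x\<bar>)" for x
  proof -
    have "N (S x) = a * h \<bar>x\<bar>" using nonzero by (simp add: h_def S_abs N_def)
    then have "norm (N (S x)) = \<bar>a\<bar> * h \<bar>x\<bar>" using h(1)[of "\<bar>x\<bar>"] by (simp add: abs_mult)
    also have "\<dots> \<le> \<bar>a\<bar> * (exp C * exp (- C * \<bar>x\<bar>))" by (intro mult_left_mono le) auto
    finally show ?thesis by (simp add: mult.assoc)
  qed
  then have "exp_dominated C (\<lambda>x. N (S x))" by (rule exp_dominatedI)
  with C show ?thesis by blast
qed

text \<open>Fixes one rate, so that estimates of all orders, for the profile and for the wave, share
  it.\<close>

definition rate :: real where "rate = (SOME C. C > 0 \<and> exp_dominated C (\<lambda>x. N (S x)))"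

lemma rate_pos: "rate > 0" and N_S_rate: "exp_dominated rate (\<lambda>x. N (S x))"
  using someI_ex[OF N_S_exp_dominated] by (simp_all add: rate_def)

lemma decays_N_S: "decays rate n (\<lambda>x. N (S x))"
proof (induction n)
  case (Suc n)
  show ?case
  proof (rule decays_SucI[OF N_S_rate])
    show "((\<lambda>x. N (S x)) has_vector_derivative
        N (S x) * (- (2 * b / d) * (S x * (1 + \<kappa> * (S x)\<^sup>2)))) (at x)" for x
      using N_S_deriv[of x] by (simp only: has_real_derivative_iff_has_vector_derivative)
    show "decays rate n (\<lambda>x. N (S x) * (- (2 * b / d) * (S x * (1 + \<kappa> * (S x)\<^sup>2))))"
      by (intro decays_mult_bounded(1)[OF Suc] decays_cmult decays_mult_bounded decays_S decays_p)
  qed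
qed (use N_S_rate in simp)

lemma decays_\<eta>: "decays rate n \<eta>"
  using decays_mult_bounded(1)[OF decays_N_S decays_inverse_p] by (simp add: \<eta>_def[abs_def] divide_inverse)

text \<open>Confirms that \<open>S\<close> is the logarithmic slope of the profile. The quotient
  rule leaves the factor \<open>2 * (b * p + \<kappa> * N) / d\<close> with \<open>p\<close> the
  denominator of \<open>\<eta>\<close>, and it equals 1 since the quadratic terms cancel.\<close>

lemma \<eta>_deriv: "(\<eta> has_real_derivative - S x * \<eta> x) (at x)"
proof -
  have p: "1 + \<kappa> * (S x)\<^sup>2 \<noteq> 0" using p_S_pos[of x] by simp
  let ?s = "S x" and ?p = "1 + \<kappa> * (S x)\<^sup>2"
  have "(\<eta> has_real_derivative ((- (b * (2 * ?s * (?p * N ?s / d)))) * ?p - N ?s * (\<kappa> * (2 * ?s * (?p * N ?s / d)))) / (?p * ?p)) (at x)"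
    unfolding \<eta>_def N_def
    by (rule derivative_eq_intros S_deriv refl p)+ (simp add: N_def power2_eq_square mult_ac)
  also have "((- (b * (2 * ?s * (?p * N ?s / d)))) * ?p - N ?s * (\<kappa> * (2 * ?s * (?p * N ?s / d)))) / (?p * ?p)
     = - ?s * (N ?s / ?p) * (2 * (b * ?p + \<kappa> * N ?s) / d)"
  proof -
    have "((- (b * (2 * s * (q * n / d)))) * q - n * (\<kappa> * (2 * s * (q * n / d)))) / (q * q)
        = - s * (n / q) * (2 * (b * q + \<kappa> * n) / d)" if "q \<noteq> 0" for s q n :: real
      using that nonzero by (simp add: field_simps)
    then show ?thesis using p by blast
  qed
  also have "2 * (b * ?p + \<kappa> * N ?s) / d = 1"
    using nonzero by (simp add: N_def d_eq field_simps)
  finally show ?thesis by (simp add: \<eta>_def[abs_def])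
qed

lemma \<eta>_deriv2: "((\<lambda>x. - S x * \<eta> x) has_real_derivative \<eta> x * (S x)\<^sup>2 - (N (S x))\<^sup>2 / d) (at x)"
proof -
  have e: "(1 + \<kappa> * (S x)\<^sup>2) * \<eta> x = N (S x)" using p_S_pos[of x] by (simp add: \<eta>_def)
  have "(1 + \<kappa> * (S x)\<^sup>2) * N (S x) / d * \<eta> x = (N (S x))\<^sup>2 / d"
    unfolding power2_eq_square[of "N (S x)"] by (subst e[symmetric]) (simp add: mult_ac e)
  then have eq: "- ((1 + \<kappa> * (S x)\<^sup>2) * N (S x) / d) * \<eta> x + - S x * \<eta> x * - S x
      = \<eta> x * (S x)\<^sup>2 - (N (S x))\<^sup>2 / d"
    by (simp add: power2_eq_square[of "S x"])
  show ?thesis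
    using DERIV_mult[OF DERIV_minus[OF S_deriv[of x]] \<eta>_deriv[of x]] unfolding eq .
qed

lemma \<eta>_iter_deriv:
  "iter_deriv 1 \<eta> = (\<lambda>x. - S x * \<eta> x)" "iter_deriv 2 \<eta> = (\<lambda>x. \<eta> x * (S x)\<^sup>2 - (N (S x))\<^sup>2 / d)"
  by (rule iter_deriv_1_eqI iter_deriv_2_eqI;
      use \<eta>_deriv \<eta>_deriv2 in \<open>simp add: has_real_derivative_iff_has_vector_derivative\<close>)+

text \<open>The squared modulus of the wave in terms of the slope: it vanishes only where both
  \<open>c\<close> and \<open>S x\<close> do, which separates the case \<open>c = 0\<close>.\<close>

lemma one_minus_\<eta>: "1 - \<eta> x = (c\<^sup>2 + (S x)\<^sup>2) / (2 * (1 + \<kappa> * (S x)\<^sup>2))"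
  using p_S_pos[of x] by (simp add: \<eta>_def N_def a_def b_def field_simps)

lemma \<eta>_0: "\<eta> 0 = a"
  by (simp add: \<eta>_def N_def)

lemma \<eta>_minus: "\<eta> (- x) = \<eta> x"
  by (simp add: \<eta>_def S_minus N_def)

lemma \<eta>_in_I: "\<eta> x \<in> I"
  unfolding \<eta>_def by (rule profile_in_I[OF S_bound])

lemma \<eta>_le_1: "\<eta> x \<le> 1"
proof -
  have "1 - \<eta> x \<ge> 0" unfolding one_minus_\<eta> using p_S_pos[of x] by simp
  then show ?thesis by simp
qed

lemma continuous_\<eta>: "continuous_on X \<eta>"
  by (intro continuous_at_imp_continuous_on ballI DERIV_isCont[OF \<eta>_deriv])

text \<open>Once the modulus is known, the nonlinear terms of the equation are explicit in
  \<open>S\<close>, so \<open>eq\<close> is the equation itself. Finite energy follows from decay,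
  and nontriviality from \<open>\<eta> 0 = a \<noteq> 0\<close>.\<close>

lemma nontrivial_solutionI:
  assumes u: "\<And>x. (u has_vector_derivative u' x) (at x)" "\<And>x. (u' has_vector_derivative u'' x) (at x)"
    and smooth: "u \<in> C_infinity" and dom: "exp_dominated rate u'"
    and mod: "\<And>x. (cmod (u x))\<^sup>2 = 1 - \<eta> x"
    and eq: "\<And>x. \<i> * of_real c * u' x + u'' x + u x * of_real (\<eta> x)
       + of_real \<kappa> * u x * of_real (\<eta> x * (S x)\<^sup>2 - (N (S x))\<^sup>2 / d) = 0"
  shows "nontrivial_solution c \<kappa> u"
proof -
  have cont: "continuous_on UNIV u'"
    using u(2) by (meson continuous_at_imp_continuous_on has_vector_derivative_continuous)
  have "u \<in> energy_space"
    unfolding energy_space_C1_iff[OF u(1) cont]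
  proof
    show "integrable lebesgue (\<lambda>x. (cmod (u' x))\<^sup>2)"
      by (rule integrable_exp_dominated[OF dom rate_pos cont])
    have "exp_dominated rate \<eta>" using decays_\<eta>[of 0] by simp
    from integrable_exp_dominated[OF this rate_pos continuous_\<eta>]
    show "integrable lebesgue (\<lambda>x. (1 - (cmod (u x))\<^sup>2)\<^sup>2)" by (simp add: mod)
  qed
  moreover have "u \<in> C_k 2" using smooth by (simp add: C_infinity_def)
  moreover have "TW c \<kappa> u"
  proof -
    have "(\<lambda>y. 1 - (cmod (u y))\<^sup>2) = \<eta>" by (simp add: mod)
    then show ?thesis unfolding TW_def
      using eq by (simp add: mod iter_deriv_1_eqI(1)[OF u(1), simplified] iter_deriv_2_eqI[OF u] \<eta>_iter_deriv)
  qed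
  moreover have "\<not> trivial_solution u"
  proof
    assume "trivial_solution u"
    then have "(cmod (u 0))\<^sup>2 = 1" by (auto simp: trivial_solution_def)
    then show False using nonzero by (simp add: mod \<eta>_0)
  qed
  ultimately show ?thesis by (simp add: nontrivial_solution_def)
qed

end

section \<open>Existence\<close>

lemma has_vector_derivative_cis:
  assumes "(f has_real_derivative f') (at x)"
  shows "((\<lambda>x. cis (f x)) has_vector_derivative \<i> * of_real f' * cis (f x)) (at x)"
  using has_derivative_cis[OF assms[unfolded has_field_derivative_def]]
  by (simp add: has_vector_derivative_def mult_ac scaleR_conv_of_real)

lemma has_vector_derivative_of_real_complex:
  "(f has_real_derivative f') (at x) \<Longrightarrow> ((\<lambda>x. complex_of_real (f x)) has_vector_derivative of_real f') (at x)"
  by (rule has_vector_derivative_of_real)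
    (simp add: has_real_derivative_iff_has_vector_derivative)

lemma has_vector_derivative_inverse_complex:
  fixes f :: "real \<Rightarrow> complex"
  assumes "(f has_vector_derivative f') (at x)" "f x \<noteq> 0"
  shows "((\<lambda>x. inverse (f x)) has_vector_derivative - (inverse (f x) * f' * inverse (f x))) (at x)"
  using Deriv.has_derivative_inverse[where f = f, OF assms(2) assms(1)[unfolded has_vector_derivative_def]]
  by (simp add: has_vector_derivative_def)

text \<open>Two solutions of the same linear first-order equation have a constant quotient. The
  cross-multiplied hypothesis makes no mention of a logarithmic derivative and so remains usable
  when that has a pole.\<close>

lemma quotient_derivative_zero:
  fixes f g :: "real \<Rightarrow> complex"
  assumes f: "(f has_vector_derivative f') (at x)" and g: "(g has_vector_derivative g') (at x)"
    and nz: "g x \<noteq> 0" and eq: "f' * g x = f x * g'"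
  shows "((\<lambda>x. f x * inverse (g x)) has_vector_derivative 0) (at x)"
proof -
  have "f x * - (inverse (g x) * g' * inverse (g x)) + f' * inverse (g x)
      = (f' * g x - f x * g') * inverse (g x) * inverse (g x)"
    using nz by (simp add: field_simps)
  also have "\<dots> = 0" unfolding eq by simp
  finally have eq0: "f x * - (inverse (g x) * g' * inverse (g x)) + f' * inverse (g x) = 0" .
  show ?thesis
    using has_vector_derivative_mult[OF f has_vector_derivative_inverse_complex[OF g nz]] unfolding eq0 .
qed

lemma has_vector_derivative_shift:
  fixes f :: "real \<Rightarrow> 'a::real_normed_vector"
  assumes "(f has_vector_derivative f') (at (x - \<xi>))"
  shows "((\<lambda>x. f (x - \<xi>)) has_vector_derivative f') (at x)"
proof -
  have "((\<lambda>x. x - \<xi>) has_vector_derivative 1) (at x)"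
    by (auto intro!: derivative_eq_intros)
  from vector_diff_chain_at[OF this assms] show ?thesis by (simp add: o_def)
qed

context wave_parameters
begin

lemma N_S_deriv': "((\<lambda>x. N (S x)) has_real_derivative
    - (2 * b * S x) * ((1 + \<kappa> * (S x)\<^sup>2) * N (S x) / d)) (at x)"
proof -
  have eq: "n * (- (2 * b / d) * (s * p)) = - (2 * b * s) * (p * n / d)" for n s p by simp
  show ?thesis using N_S_deriv[of x] unfolding eq .
qed

text \<open>The logarithmic derivative of the wave for \<open>c > 0\<close>. The denominator has
  modulus at least \<open>c\<close>; for \<open>c = 0\<close> it would vanish at the origin.\<close>

definition slope :: "real \<Rightarrow> complex" where
  "slope x = of_real (N (S x)) * inverse (of_real (S x) - \<i> * of_real c)"

lemma decays_slope:
  assumes "c > 0"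
  shows "decays rate n slope"
  unfolding slope_def[abs_def]
proof (rule decays_mult_bounded(1)[OF decays_of_real[OF decays_N_S]])
  show "decays 0 n (\<lambda>x. inverse (of_real (S x) - \<i> * of_real c))"
  proof (rule decays_inverse[OF _ assms])
    show "decays 0 n (\<lambda>x. complex_of_real (S x) - \<i> * complex_of_real c)"
      by (intro decays_diff decays_of_real decays_const decays_S)
    show "c \<le> cmod (complex_of_real (S x) - \<i> * complex_of_real c)" for x
      using abs_Im_le_cmod[of "complex_of_real (S x) - \<i> * complex_of_real c"] by simp
  qed
qed

lemma \<eta>_less_1:
  assumes "c > 0"
  shows "\<eta> x < 1"
proof -
  have "1 - \<eta> x > 0" unfolding one_minus_\<eta> using p_S_pos[of x] assms
    by (intro divide_pos_pos add_pos_nonneg) auto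
  then show ?thesis by simp
qed

lemma theta_deriv:
  assumes "c > 0"
  shows "(theta c \<kappa> has_real_derivative c / 2 * (\<eta> x / (1 - \<eta> x))) (at x)"
proof -
  let ?f = "\<lambda>y. \<eta> y / (1 - \<eta> y)" and ?r = "\<bar>x\<bar> + 1"
  have "\<eta> y \<noteq> 1" for y using \<eta>_less_1[OF assms, of y] by simp
  then have "continuous_on {- ?r..?r} ?f" by (intro continuous_intros continuous_\<eta>) auto
  then have "((\<lambda>u. LBINT y=0..u. ?f y) has_vector_derivative ?f x) (at x within {- ?r..?r})"
    using interval_integral_FTC2[of "- ?r" 0 ?r ?f x] by (simp add: zero_ereal_def)
  moreover have "at x within {- ?r..?r} = at x" by (rule at_within_interior) auto
  ultimately have "((\<lambda>u. LBINT y=0..u. ?f y) has_real_derivative ?f x) (at x)"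
    by (simp add: has_real_derivative_iff_has_vector_derivative)
  then have "((\<lambda>u. c / 2 * (LBINT y=0..u. ?f y)) has_real_derivative c / 2 * ?f x) (at x)"
    by (rule DERIV_cmult)
  then show ?thesis by (simp add: theta_def[abs_def] eta_fun)
qed

text \<open>The real part is the logarithmic derivative of \<open>rho\<close>, the imaginary part
  the derivative of \<open>theta\<close>. The formula comes from multiplying
  \<open>N / (s - \<i> c)\<close> by the conjugate of the denominator and using
  \<open>one_minus_\<eta>\<close>.\<close>

lemma slope_eq:
  assumes "c > 0"
  shows "slope x = of_real (\<eta> x / (2 * (1 - \<eta> x))) * (of_real (S x) + \<i> * of_real c)"
proof -
  let ?z = "of_real (S x) - \<i> * of_real c :: complex" and ?w = "of_real (S x) + \<i> * of_real c :: complex"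
  have z: "?z \<noteq> 0" using assms by (auto simp: complex_eq_iff)
  have "c\<^sup>2 + (S x)\<^sup>2 \<noteq> 0" using assms by (simp add: add_pos_nonneg less_imp_neq[symmetric])
  then have "\<eta> x / (2 * (1 - \<eta> x)) = N (S x) / (c\<^sup>2 + (S x)\<^sup>2)"
  proof -
    have "n / q / (2 * (e / (2 * q))) = n / e" if "q \<noteq> 0" "e \<noteq> 0" for n q e :: real
      using that by (simp add: field_simps)
    moreover have "1 + \<kappa> * (S x)\<^sup>2 \<noteq> 0" using p_S_pos[of x] by simp
    ultimately show ?thesis unfolding one_minus_\<eta> unfolding \<eta>_def using \<open>c\<^sup>2 + (S x)\<^sup>2 \<noteq> 0\<close> by blast
  qed
  moreover have "of_real (c\<^sup>2 + (S x)\<^sup>2) = ?w * ?z"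
    by (simp add: complex_eq_iff power2_eq_square)
  ultimately have "of_real (\<eta> x / (2 * (1 - \<eta> x))) * ?w = of_real (N (S x)) / (?w * ?z) * ?w"
    by (metis of_real_divide)
  moreover have "?w \<noteq> 0" using assms by (auto simp: complex_eq_iff)
  ultimately show ?thesis using z by (simp add: slope_def divide_inverse)
qed

lemma u_sol_deriv:
  assumes "c > 0"
  shows "(u_sol c \<kappa> has_vector_derivative u_sol c \<kappa> x * slope x) (at x)"
proof -
  let ?r = "1 - \<eta> x"
  have r: "?r > 0" using \<eta>_less_1[OF assms, of x] by simp
  have rho: "rho c \<kappa> = (\<lambda>x. sqrt (1 - \<eta> x))" by (simp add: rho_def[abs_def] eta_fun)
  have "(rho c \<kappa> has_real_derivative rho c \<kappa> x * (S x * \<eta> x / (2 * ?r))) (at x)"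
  proof -
    have "((\<lambda>x. sqrt (1 - \<eta> x)) has_real_derivative (0 - (- S x * \<eta> x)) * (inverse (sqrt ?r) / 2)) (at x)"
      by (rule DERIV_chain2[where f = sqrt, OF DERIV_real_sqrt[OF r] DERIV_diff[OF DERIV_const \<eta>_deriv],
            THEN DERIV_cong]) simp
    moreover have "(0 - (- S x * \<eta> x)) * (inverse (sqrt ?r) / 2) = sqrt ?r * (S x * \<eta> x / (2 * ?r))"
    proof -
      have "inverse (sqrt ?r) = sqrt ?r / ?r" using r by (simp add: real_div_sqrt field_simps)
      then show ?thesis by (simp add: mult_ac)
    qed
    ultimately show ?thesis unfolding rho by (metis (no_types, lifting))
  qed
  note has_vector_derivative_mult[OF has_vector_derivative_of_real_complex[OF this]
      has_vector_derivative_cis[OF theta_deriv[OF assms, of x]]]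
  moreover have "complex_of_real (rho c \<kappa> x) * (\<i> * of_real (c / 2 * (\<eta> x / ?r)) * cis (theta c \<kappa> x))
      + of_real (rho c \<kappa> x * (S x * \<eta> x / (2 * ?r))) * cis (theta c \<kappa> x)
      = of_real (rho c \<kappa> x) * cis (theta c \<kappa> x) * slope x"
  proof -
    have "complex_of_real R * (\<i> * of_real (c / 2 * (E / r)) * z) + of_real (R * (s * E / (2 * r))) * z
        = of_real R * z * (of_real (E / (2 * r)) * (of_real s + \<i> * of_real c))"
      if "r \<noteq> 0" for R E r s z
      using that by (simp add: field_simps)
    moreover have "?r \<noteq> 0" using r by simp
    ultimately show ?thesis unfolding slope_eq[OF assms] by blast
  qed
  ultimately show ?thesis using assms by (simp add: u_sol_def[abs_def])
qed

text \<open>Puts \<open>eta c \<kappa>\<close> in both branches, so that \<open>eta_fun\<close>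
  applies to either.\<close>

lemma u_sol_alt: "u_sol c \<kappa> x = (if c = 0
    then of_real (if 0 \<le> x then sqrt (1 - eta c \<kappa> x) else - sqrt (1 - eta c \<kappa> x))
    else of_real (rho c \<kappa> x) * cis (theta c \<kappa> x))"
  by (cases "c = 0") (simp_all add: u_sol_def)

lemma norm_u_sol: "(cmod (u_sol c \<kappa> x))\<^sup>2 = 1 - \<eta> x"
proof (cases "c = 0")
  case True
  then have "u_sol c \<kappa> x = of_real (if 0 \<le> x then sqrt (1 - \<eta> x) else - sqrt (1 - \<eta> x))"
    unfolding u_sol_alt eta_fun by simp
  then show ?thesis using \<eta>_le_1[of x] by simp
next
  case False
  then show ?thesis using \<eta>_le_1[of x] unfolding u_sol_alt rho_def eta_fun by (simp add: norm_mult)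
qed

lemma u_sol_exp_dominated: "exp_dominated 0 (u_sol c \<kappa>)"
proof -
  obtain B where B: "\<And>x. \<bar>\<eta> x\<bar> \<le> B * exp (- rate * \<bar>x\<bar>)" "B > 0"
  proof -
    have "exp_dominated rate \<eta>" using decays_\<eta>[of 0] by simp
    then show ?thesis using that by (rule exp_dominated_pos) simp
  qed
  have "cmod (u_sol c \<kappa> x) \<le> 1 + B" for x
  proof -
    have "B * exp (- rate * \<bar>x\<bar>) \<le> B * 1" using B(2) rate_pos by (intro mult_left_mono) auto
    then have "(cmod (u_sol c \<kappa> x))\<^sup>2 \<le> 1 + B" using B(1)[of x] unfolding norm_u_sol by linarith
    also have "\<dots> \<le> (1 + B)\<^sup>2" using B(2) by (simp add: power2_eq_square)
    finally show ?thesis using B(2) by (simp add: power2_le_iff_abs_le)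
  qed
  then show ?thesis unfolding exp_dominated_0_iff by blast
qed

lemma u_sol_smooth_pos:
  assumes "c > 0"
  shows "decays 0 n (u_sol c \<kappa>)"
proof (induction n)
  case (Suc n)
  have "decays rate n (\<lambda>x. u_sol c \<kappa> x * slope x)"
    by (rule decays_mult_bounded(2)[OF Suc decays_slope[OF assms]])
  then have "decays 0 n (\<lambda>x. u_sol c \<kappa> x * slope x)"
    by (rule decays_mono) (use rate_pos in simp)
  then show ?case by (rule decays_SucI[OF u_sol_exp_dominated u_sol_deriv[OF assms]])
qed (use u_sol_exp_dominated in simp)

lemma slope_deriv:
  assumes "c > 0"
  shows "(slope has_vector_derivative (let s = of_real (S x); z = s - \<i> * of_real c; n = of_real (N (S x));
     p = 1 + of_real \<kappa> * s\<^sup>2 in - (2 * of_real b * s) * (p * n / of_real d) / z - n * (p * n / of_real d) / z\<^sup>2)) (at x)"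
proof -
  have z: "of_real (S x) - \<i> * of_real c \<noteq> (0::complex)" using assms by (auto simp: complex_eq_iff)
  have zd: "((\<lambda>x. of_real (S x) - \<i> * of_real c) has_vector_derivative
      complex_of_real ((1 + \<kappa> * (S x)\<^sup>2) * N (S x) / d) - 0) (at x)"
    by (intro has_vector_derivative_diff has_vector_derivative_of_real_complex S_deriv has_vector_derivative_const)
  have eq: "of_real n * - (inverse z * of_real q * inverse z) + of_real (- (2 * b * s) * q) * inverse z
      = - (2 * of_real b * of_real s) * of_real q / z - of_real n * of_real q / z\<^sup>2"
    for n q s and z :: complex
    by (simp add: divide_inverse power2_eq_square algebra_simps)
  have "((\<lambda>x. inverse (of_real (S x) - \<i> * of_real c)) has_vector_derivative
     - (inverse (of_real (S x) - \<i> * of_real c) * complex_of_real ((1 + \<kappa> * (S x)\<^sup>2) * N (S x) / d)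
        * inverse (of_real (S x) - \<i> * of_real c))) (at x)"
    using has_vector_derivative_inverse_complex[OF zd z] by simp
  note has_vector_derivative_mult[OF has_vector_derivative_of_real_complex[OF N_S_deriv'] this]
  then show ?thesis
    unfolding slope_def[abs_def] Let_def eq by simp
qed

lemma u_sol_deriv_exp: "c > 0 \<Longrightarrow> decays rate n (\<lambda>x. u_sol c \<kappa> x * slope x)"
  by (rule decays_mult_bounded(2)[OF u_sol_smooth_pos decays_slope])

text \<open>Dividing the equation by \<open>u\<close> turns it into the Riccati equation
  \<open>\<i> c g + g' + g\<^sup>2 + \<eta> + \<kappa> \<eta>'' = 0\<close> for
  \<open>g = slope\<close>. This is \<open>travelling_wave_identity\<close> with
  \<open>z = s - \<i> c\<close>.\<close>

lemma nontrivial_u_sol_pos: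
  assumes "c > 0"
  shows "nontrivial_solution c \<kappa> (u_sol c \<kappa>)"
proof (rule nontrivial_solutionI)
  define g' where "g' = (\<lambda>x. let s = of_real (S x); z = s - \<i> * of_real c; n = of_real (N (S x));
     p = 1 + of_real \<kappa> * s\<^sup>2 in - (2 * of_real b * s) * (p * n / of_real d) / z - n * (p * n / of_real d) / z\<^sup>2)"
  show "(u_sol c \<kappa> has_vector_derivative u_sol c \<kappa> x * slope x) (at x)" for x
    by (rule u_sol_deriv[OF assms])
  show "((\<lambda>x. u_sol c \<kappa> x * slope x) has_vector_derivative u_sol c \<kappa> x * g' x + u_sol c \<kappa> x * slope x * slope x) (at x)" for x
    using slope_deriv[OF assms] unfolding g'_def
    by (intro has_vector_derivative_mult u_sol_deriv assms)
  show "u_sol c \<kappa> \<in> C_infinity" by (rule decays_imp_C_infinity) (rule u_sol_smooth_pos[OF assms])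
  show "exp_dominated rate (\<lambda>x. u_sol c \<kappa> x * slope x)"
    by (rule decays_imp_dominated[OF u_sol_deriv_exp[OF assms]])
  show "(cmod (u_sol c \<kappa> x))\<^sup>2 = 1 - \<eta> x" for x by (rule norm_u_sol)
  fix x
  define s z n p where "s = complex_of_real (S x)" and "z = s - \<i> * of_real c"
    and "n = complex_of_real (N (S x))" and "p = 1 + of_real \<kappa> * s\<^sup>2"
  have pr: "p = of_real (1 + \<kappa> * (S x)\<^sup>2)" by (simp add: p_def s_def)
  have nz: "z \<noteq> 0" "p \<noteq> 0" "complex_of_real d \<noteq> 0"
    using assms p_S_pos[of x] nonzero unfolding pr by (auto simp: z_def s_def complex_eq_iff simp del: of_real_add)
  have id: "(s - z) * (n / z) + (- (2 * of_real b * s) * (p * n / of_real d) / z - n * (p * n / of_real d) / z\<^sup>2) + (n / z)\<^sup>2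
     + n / p + of_real \<kappa> * (n / p * s\<^sup>2 - n\<^sup>2 / of_real d) = 0"
  proof (rule travelling_wave_identity[OF nz])
    show "complex_of_real d = 2 * (of_real \<kappa> * of_real a + of_real b)" by (simp add: d_eq)
    show "n = of_real a - of_real b * s\<^sup>2" by (simp add: n_def N_def s_def)
    show "p = 1 + of_real \<kappa> * s\<^sup>2" by (rule p_def)
    have "z * (2 * s - z) = of_real (c\<^sup>2 + (S x)\<^sup>2)"
      by (simp add: z_def s_def complex_eq_iff power2_eq_square)
    then have "- of_real \<kappa> * z * (2 * s - z) = of_real (- \<kappa> * (c\<^sup>2 + (S x)\<^sup>2))"
      by (simp add: mult.assoc)
    then show "of_real d - p = - of_real \<kappa> * z * (2 * s - z)"
      by (simp add: pr d_def algebra_simps)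
  qed
  have e: "slope x = n / z" "complex_of_real (\<eta> x) = n / p" "s - z = \<i> * of_real c"
    "g' x = - (2 * of_real b * s) * (p * n / of_real d) / z - n * (p * n / of_real d) / z\<^sup>2"
    "complex_of_real (\<eta> x * (S x)\<^sup>2 - (N (S x))\<^sup>2 / d) = n / p * s\<^sup>2 - n\<^sup>2 / of_real d"
    by (simp_all add: slope_def \<eta>_def g'_def Let_def pr n_def s_def z_def p_def divide_inverse)
  have "\<i> * of_real c * (u_sol c \<kappa> x * slope x) + (u_sol c \<kappa> x * g' x + u_sol c \<kappa> x * slope x * slope x)
      + u_sol c \<kappa> x * of_real (\<eta> x)
      + of_real \<kappa> * u_sol c \<kappa> x * of_real (\<eta> x * (S x)\<^sup>2 - (N (S x))\<^sup>2 / d)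
    = u_sol c \<kappa> x * (\<i> * of_real c * slope x + g' x + (slope x)\<^sup>2 + of_real (\<eta> x)
      + of_real \<kappa> * of_real (\<eta> x * (S x)\<^sup>2 - (N (S x))\<^sup>2 / d))"
    by (simp add: algebra_simps power2_eq_square)
  also have "\<dots> = 0" using id unfolding e(3) unfolding e(4)[symmetric] unfolding e by simp
  finally show "\<i> * of_real c * (u_sol c \<kappa> x * slope x) + (u_sol c \<kappa> x * g' x + u_sol c \<kappa> x * slope x * slope x)
      + u_sol c \<kappa> x * of_real (\<eta> x)
      + of_real \<kappa> * u_sol c \<kappa> x * of_real (\<eta> x * (S x)\<^sup>2 - (N (S x))\<^sup>2 / d) = 0" .
qed

section \<open>The wave of speed zero\<close>

context
  assumes c0: "c = 0"
begin

lemma c0_parameters: "a = 1" "d = 1" "b = 1 / 2 - \<kappa>"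
  unfolding a_def d_def b_def using c0 by simp_all

text \<open>For \<open>c = 0\<close> the modulus of the wave is
  \<open>\<bar>S x\<bar> / Q x\<close>. The signs prescribed on the two half-lines are those of
  \<open>S\<close>, so the wave is the smooth odd function \<open>S x / Q x\<close> and the square
  root at its zero disappears.\<close>

definition Q :: "real \<Rightarrow> real" where "Q x = sqrt (2 * (1 + \<kappa> * (S x)\<^sup>2))"

lemma Q_pos: "Q x > 0" and Q_sq: "Q x * Q x = 2 * (1 + \<kappa> * (S x)\<^sup>2)"
  using p_S_pos[of x] by (simp_all add: Q_def)

lemma decays_Q: "decays 0 n Q"
  unfolding Q_def[abs_def]
proof (rule decays_sqrt[OF decays_cmult[OF decays_p], of "2 * pmin"])
  show "2 * pmin \<le> 2 * (1 + \<kappa> * (S x)\<^sup>2)" for x using p_ge[OF less_imp_le[OF S_bound], of x] by simp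
qed (use pmin_pos in simp)

lemma decays_inverse_Q: "decays 0 n (\<lambda>x. inverse (Q x))"
proof (rule decays_inverse[OF decays_Q, of "sqrt (2 * pmin)"])
  show "sqrt (2 * pmin) \<le> norm (Q x)" for x
    using p_ge[OF less_imp_le[OF S_bound], of x] p_S_pos[of x] by (simp add: Q_def)
qed (use pmin_pos in simp)

lemma u_sol_black: "u_sol c \<kappa> x = of_real (S x / Q x)"
proof -
  have e: "sqrt (1 - \<eta> x) = \<bar>S x\<bar> / Q x" for x
    unfolding one_minus_\<eta> Q_def by (simp add: c0 real_sqrt_divide)
  have "0 \<le> x \<Longrightarrow> S x \<ge> 0" "\<not> 0 \<le> x \<Longrightarrow> S x \<le> 0"
    using S_pos[of x] S_pos[of "- x"] S_0 by (auto simp: S_minus le_less)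
  then show ?thesis unfolding u_sol_alt eta_fun e using c0 by auto
qed

lemma Q_deriv: "(Q has_real_derivative 2 * \<kappa> * S x * ((1 + \<kappa> * (S x)\<^sup>2) * N (S x)) / Q x) (at x)"
proof -
  have "0 < 2 * (1 + \<kappa> * (S x)\<^sup>2)" using p_S_pos[of x] by simp
  then show ?thesis
    unfolding Q_def[abs_def]
    by (auto intro!: derivative_eq_intros S_deriv simp: c0_parameters field_simps)
qed

lemma u_sol_black_deriv: "((\<lambda>x. S x / Q x) has_real_derivative N (S x) / Q x) (at x)"
proof -
  have Q: "Q x \<noteq> 0" using Q_pos[of x] by simp
  let ?s = "S x" and ?q = "Q x" and ?p = "1 + \<kappa> * (S x)\<^sup>2" and ?n = "N (S x)"
  have "((\<lambda>x. S x / Q x) has_real_derivative (?p * ?n / d * ?q - ?s * (2 * \<kappa> * ?s * (?p * ?n) / ?q)) / (?q * ?q)) (at x)"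
    by (rule DERIV_divide[OF S_deriv Q_deriv Q])
  also have "(?p * ?n / d * ?q - ?s * (2 * \<kappa> * ?s * (?p * ?n) / ?q)) / (?q * ?q)
      = ?p * ?n * (?q * ?q - 2 * \<kappa> * ?s\<^sup>2) / (?q * ?q) / ?q"
    using Q by (simp add: c0_parameters field_simps power2_eq_square)
  also have "\<dots> = ?n / ?q"
  proof -
    have 1: "?q * ?q - 2 * \<kappa> * ?s\<^sup>2 = 2" by (simp add: Q_sq algebra_simps)
    have "p * n * 2 / (2 * p) / q = n / q" if "p \<noteq> 0" for p n q :: real using that by simp
    from this[of ?p ?n ?q] show ?thesis unfolding 1 unfolding Q_sq using p_S_pos[of x] by linarith
  qed
  finally show ?thesis .
qed

lemma u_sol_black_deriv2:
  "((\<lambda>x. N (S x) / Q x) has_real_derivative - (S x / Q x) * (\<eta> x + \<kappa> * (\<eta> x * (S x)\<^sup>2 - (N (S x))\<^sup>2 / d))) (at x)"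
proof -
  have Q: "Q x \<noteq> 0" using Q_pos[of x] by simp
  let ?s = "S x" and ?q = "Q x" and ?p = "1 + \<kappa> * (S x)\<^sup>2" and ?n = "N (S x)"
  have p: "?p \<noteq> 0" using p_S_pos[of x] by simp
  have "((\<lambda>x. N (S x) / Q x) has_real_derivative
      (- (2 * b * ?s) * (?p * ?n / d) * ?q - ?n * (2 * \<kappa> * ?s * (?p * ?n) / ?q)) / (?q * ?q)) (at x)"
    by (rule DERIV_divide[OF N_S_deriv' Q_deriv Q])
  also have "(- (2 * b * ?s) * (?p * ?n / d) * ?q - ?n * (2 * \<kappa> * ?s * (?p * ?n) / ?q)) / (?q * ?q)
     = - (?s / ?q) * (2 * b * ?p * ?n * (?q * ?q) + 2 * \<kappa> * ?p * ?n\<^sup>2) / (?q * ?q)"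
    using Q by (simp add: c0_parameters(2) field_simps power2_eq_square)
  also have "\<dots> = - (?s / ?q) * (?n * (2 * b * ?p + \<kappa> * ?n))"
  proof -
    have "- t * (2 * b * p * n * (2 * p) + 2 * \<kappa> * p * n\<^sup>2) / (2 * p) = - t * (n * (2 * b * p + \<kappa> * n))"
      if "p \<noteq> 0" for t p n :: real
      using that by (simp add: field_simps power2_eq_square)
    then show ?thesis unfolding Q_sq using p by blast
  qed
  also have "2 * b * ?p + \<kappa> * ?n = 1 - \<kappa> * ?n"
    unfolding c0_parameters N_def by (simp add: algebra_simps)
  also have "?n * (1 - \<kappa> * ?n) = \<eta> x + \<kappa> * (\<eta> x * (S x)\<^sup>2 - (N (S x))\<^sup>2 / d)"
  proof -
    have "\<eta> x + \<kappa> * (\<eta> x * (S x)\<^sup>2) = ?p * \<eta> x" by (simp add: algebra_simps)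
    also have "\<dots> = ?n" using p by (simp add: \<eta>_def)
    finally show ?thesis by (simp add: c0_parameters(2) algebra_simps power2_eq_square)
  qed
  finally show ?thesis .
qed

lemma u_sol_black_smooth: "decays 0 n (u_sol c \<kappa>)"
  unfolding u_sol_black[abs_def] divide_inverse
  by (intro decays_of_real decays_mult_bounded decays_S decays_inverse_Q)

lemma u_sol_black_deriv_exp: "decays rate n (\<lambda>x. complex_of_real (N (S x) / Q x))"
  unfolding divide_inverse by (intro decays_of_real decays_mult_bounded(1) decays_N_S decays_inverse_Q)

lemma nontrivial_u_sol_black: "nontrivial_solution c \<kappa> (u_sol c \<kappa>)"
proof (rule nontrivial_solutionI)
  show "(u_sol c \<kappa> has_vector_derivative of_real (N (S x) / Q x)) (at x)" for x
    unfolding u_sol_black[abs_def] by (rule has_vector_derivative_of_real_complex[OF u_sol_black_deriv])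
  show "((\<lambda>x. of_real (N (S x) / Q x)) has_vector_derivative
      complex_of_real (- (S x / Q x) * (\<eta> x + \<kappa> * (\<eta> x * (S x)\<^sup>2 - (N (S x))\<^sup>2 / d)))) (at x)" for x
    by (rule has_vector_derivative_of_real_complex[OF u_sol_black_deriv2])
  show "u_sol c \<kappa> \<in> C_infinity" by (rule decays_imp_C_infinity) (rule u_sol_black_smooth)
  show "exp_dominated rate (\<lambda>x. complex_of_real (N (S x) / Q x))"
    by (rule decays_imp_dominated[OF u_sol_black_deriv_exp])
  show "(cmod (u_sol c \<kappa> x))\<^sup>2 = 1 - \<eta> x" for x by (rule norm_u_sol)
  show "\<i> * of_real c * of_real (N (S x) / Q x)
      + of_real (- (S x / Q x) * (\<eta> x + \<kappa> * (\<eta> x * (S x)\<^sup>2 - (N (S x))\<^sup>2 / d)))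
      + u_sol c \<kappa> x * of_real (\<eta> x)
      + of_real \<kappa> * u_sol c \<kappa> x * of_real (\<eta> x * (S x)\<^sup>2 - (N (S x))\<^sup>2 / d) = 0" for x
  proof -
    have ic: "\<i> * of_real c * z = 0" for z using c0 by simp
    show ?thesis unfolding u_sol_black ic by (simp add: algebra_simps)
  qed
qed

end

end

section \<open>First integrals and nonexistence\<close>

text \<open>An integrable function need not tend to 0, but it cannot stay above \<open>e\<close> on
  a half-line. Small values arbitrarily far out in both directions are all that the first integrals
  and the extremum arguments require.\<close>

lemma integrable_nonneg_small:
  fixes f :: "real \<Rightarrow> real"
  assumes f: "integrable lborel f" and nonneg: "\<And>x. f x \<ge> 0" and e: "e > 0"
  shows "\<exists>x>M. f x < e" "\<exists>x<M. f x < e"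
proof -
  have *: "\<exists>x>M. g x < e" if g: "integrable lborel g" "\<And>x. g x \<ge> 0" for g :: "real \<Rightarrow> real" and M
  proof (rule ccontr)
    assume "\<not> (\<exists>x>M. g x < e)"
    then have ge: "g x \<ge> e" if "x > M" for x using that by force
    \<comment> \<open>An interval of this length, on which \<open>g \<ge> e\<close>, contributes the
      total integral plus \<open>e\<close>.\<close>
    define K where "K = (LINT x|lborel. g x) / e + 1"
    have "(LINT x|lborel. g x) \<ge> 0" using g(2) by simp
    then have K: "K > 0" using e by (simp add: K_def add_nonneg_pos)
    have "(LINT x|lborel. e * indicator {M + 1..M + 1 + K} x) \<le> (LINT x|lborel. g x)"
    proof (rule integral_mono[OF _ g(1)])
      show "e * indicator {M + 1..M + 1 + K} x \<le> g x" for x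
        using ge[of x] g(2)[of x] by (auto simp: indicator_def)
    qed (intro integrable_mult_right integrable_real_indicator; simp add: emeasure_lborel_Icc_eq)
    moreover have "(LINT x|lborel. e * indicator {M + 1..M + 1 + K} x) = e * K"
      using K by simp
    moreover have "e * K = (LINT x|lborel. g x) + e" using e by (simp add: K_def field_simps)
    ultimately show False using e by simp
  qed
  show "\<exists>x>M. f x < e" using *[OF f nonneg] .
  have "integrable lborel (\<lambda>x. f (- x))"
    using lborel_integrable_real_affine[OF f, of "-1" 0] by simp
  from *[OF this, of "- M"] nonneg obtain x where "x > - M" "f (- x) < e" by auto
  then show "\<exists>x<M. f x < e" by (intro exI[of _ "- x"]) auto
qed

text \<open>The real and imaginary parts of the wave are \<open>p\<close> and \<open>q\<close>.\<close>
locale finite_energy_wave =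
  fixes c \<kappa> :: real and p q p1 q1 p2 q2 :: "real \<Rightarrow> real"
  assumes dp: "\<And>x. (p has_real_derivative p1 x) (at x)" and dp1: "\<And>x. (p1 has_real_derivative p2 x) (at x)"
    and dq: "\<And>x. (q has_real_derivative q1 x) (at x)" and dq1: "\<And>x. (q1 has_real_derivative q2 x) (at x)"
    and cont: "continuous_on UNIV p2" "continuous_on UNIV q2"
    and Re_eq: "\<And>x. - c * q1 x + p2 x + p x * (1 - (p x)\<^sup>2 - (q x)\<^sup>2)
      + \<kappa> * p x * (- 2 * ((p1 x)\<^sup>2 + (q1 x)\<^sup>2 + p x * p2 x + q x * q2 x)) = 0"
    and Im_eq: "\<And>x. c * p1 x + q2 x + q x * (1 - (p x)\<^sup>2 - (q x)\<^sup>2)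
      + \<kappa> * q x * (- 2 * ((p1 x)\<^sup>2 + (q1 x)\<^sup>2 + p x * p2 x + q x * q2 x)) = 0"
    and energy: "integrable lborel (\<lambda>x. (1 - (p x)\<^sup>2 - (q x)\<^sup>2)\<^sup>2 + ((p1 x)\<^sup>2 + (q1 x)\<^sup>2))"
begin

definition E :: "real \<Rightarrow> real" where "E x = 1 - (p x)\<^sup>2 - (q x)\<^sup>2"
definition E1 :: "real \<Rightarrow> real" where "E1 x = - 2 * (p x * p1 x + q x * q1 x)"
definition E2 :: "real \<Rightarrow> real" where "E2 x = - 2 * ((p1 x)\<^sup>2 + (q1 x)\<^sup>2 + p x * p2 x + q x * q2 x)"
text \<open>The same quantities as in \<open>wave_parameters\<close>, introduced anew because here
  \<open>(c, \<kappa>)\<close> may lie outside \<open>DD\<close>.\<close>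

definition a :: real where "a = 1 - c\<^sup>2 / 2"
definition b :: real where "b = 1 / 2 - \<kappa>"

lemma dE: "(E has_real_derivative E1 x) (at x)"
  unfolding E_def E1_def by (auto intro!: derivative_eq_intros dp dq simp: algebra_simps)

lemma dE1: "(E1 has_real_derivative E2 x) (at x)"
  unfolding E1_def E2_def
  by (auto intro!: derivative_eq_intros dp dq dp1 dq1 simp: algebra_simps power2_eq_square)

lemma continuous_waves: "continuous_on X p" "continuous_on X q" "continuous_on X p1" "continuous_on X q1"
    "continuous_on X E" "continuous_on X E1"
  by (intro continuous_at_imp_continuous_on ballI DERIV_isCont[OF dp] DERIV_isCont[OF dq]
      DERIV_isCont[OF dp1] DERIV_isCont[OF dq1] DERIV_isCont[OF dE] DERIV_isCont[OF dE1])+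

lemma continuous_E2: "continuous_on UNIV E2"
  unfolding E2_def[abs_def] by (intro continuous_intros continuous_waves cont)

lemma Re_eq': "- c * q1 x + p2 x + p x * E x + \<kappa> * p x * E2 x = 0"
  and Im_eq': "c * p1 x + q2 x + q x * E x + \<kappa> * q x * E2 x = 0"
  using Re_eq[of x] Im_eq[of x] unfolding E_def E2_def by auto

lemma small_point:
  assumes "e > 0"
  shows "\<exists>x. \<bar>E x\<bar> < e \<and> \<bar>p1 x\<bar> < e \<and> \<bar>q1 x\<bar> < e"
    "\<exists>x>M. \<bar>E x\<bar> < e" "\<exists>x<M. \<bar>E x\<bar> < e"
proof -
  let ?f = "\<lambda>x. (E x)\<^sup>2 + ((p1 x)\<^sup>2 + (q1 x)\<^sup>2)"
  have f: "integrable lborel ?f" using energy by (simp add: E_def)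
  have small: "\<bar>E x\<bar> < e \<and> \<bar>p1 x\<bar> < e \<and> \<bar>q1 x\<bar> < e" if "?f x < e\<^sup>2" for x
  proof -
    have "(E x)\<^sup>2 < e\<^sup>2" "(p1 x)\<^sup>2 < e\<^sup>2" "(q1 x)\<^sup>2 < e\<^sup>2"
      using that zero_le_power2[of "E x"] zero_le_power2[of "p1 x"] zero_le_power2[of "q1 x"] by linarith+
    moreover have "\<bar>y\<bar> < e" if "y\<^sup>2 < e\<^sup>2" for y
      using power2_less_imp_less[of "\<bar>y\<bar>" e] that assms by simp
    ultimately show ?thesis by blast
  qed
  have e2: "e\<^sup>2 > 0" using assms by simp
  have nn: "?f x \<ge> 0" for x by simp
  obtain x where "x > M" "?f x < e\<^sup>2" using integrable_nonneg_small(1)[OF f nn e2] by blast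
  then show "\<exists>x. \<bar>E x\<bar> < e \<and> \<bar>p1 x\<bar> < e \<and> \<bar>q1 x\<bar> < e" "\<exists>x>M. \<bar>E x\<bar> < e" using small by blast+
  obtain x where "x < M" "?f x < e\<^sup>2" using integrable_nonneg_small(2)[OF f nn e2] by blast
  then show "\<exists>x<M. \<bar>E x\<bar> < e" using small by blast
qed

text \<open>The constant is evaluated at a point where \<open>E\<close>, \<open>p1\<close> and
  \<open>q1\<close> are all small; there \<open>\<bar>E x\<bar> \<le> 1\<close> also bounds
  \<open>p\<close> and \<open>q\<close>. A bound linear in \<open>e\<close> then beats any nonzero
  value, by the choice of \<open>e\<close> below \<open>\<bar>g x\<bar> / B\<close>.\<close>

lemma constant_vanishes:
  assumes deriv: "\<And>x. (g has_real_derivative 0) (at x)"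
    and bound: "\<And>x e. \<lbrakk>0 < e; e \<le> 1; \<bar>E x\<bar> < e; \<bar>p1 x\<bar> < e; \<bar>q1 x\<bar> < e; \<bar>p x\<bar> \<le> 2; \<bar>q x\<bar> \<le> 2\<rbrakk> \<Longrightarrow> \<bar>g x\<bar> \<le> B * e"
    and B: "B \<ge> 0"
  shows "g x = 0"
proof (rule ccontr)
  assume nz: "g x \<noteq> 0"
  define e where "e = min 1 (\<bar>g x\<bar> / (B + 1))"
  have e: "0 < e" "e \<le> 1" using nz B by (auto simp: e_def)
  obtain y where y: "\<bar>E y\<bar> < e" "\<bar>p1 y\<bar> < e" "\<bar>q1 y\<bar> < e" using small_point(1)[OF e(1)] by blast
  have "\<bar>E y\<bar> \<le> 1" using y(1) e(2) by simp
  then have "(p y)\<^sup>2 + (q y)\<^sup>2 \<le> 2\<^sup>2" unfolding E_def by auto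
  then have "(p y)\<^sup>2 \<le> 2\<^sup>2" "(q y)\<^sup>2 \<le> 2\<^sup>2"
    using zero_le_power2[of "p y"] zero_le_power2[of "q y"] by linarith+
  then have "\<bar>p y\<bar> \<le> 2" "\<bar>q y\<bar> \<le> 2" using abs_le_square_iff[of _ "2::real"] by auto
  then have "\<bar>g y\<bar> \<le> B * e" using bound e y by blast
  moreover have "g x = g y" using DERIV_isconst_all[of g x y] deriv by blast
  moreover have "B * e < \<bar>g x\<bar>"
  proof -
    have "B * e \<le> B * (\<bar>g x\<bar> / (B + 1))" using B by (intro mult_left_mono) (auto simp: e_def)
    also have "\<dots> < \<bar>g x\<bar>" using B nz by (simp add: field_simps)
    finally show ?thesis .
  qed
  ultimately show False by simp
qed

text \<open>Comes from the imaginary part of the equation multiplied by the conjugate of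
  \<open>u\<close>: the terms that are real multiples of \<open>u\<close> drop out, and what remains
  is a total derivative.\<close>

lemma momentum: "p x * q1 x - q x * p1 x = c / 2 * E x"
proof -
  let ?g = "\<lambda>x. p x * q1 x - q x * p1 x - c / 2 * E x"
  have "(?g has_real_derivative 0) (at x)" for x
  proof -
    have "(?g has_real_derivative (p1 x * q1 x + q2 x * p x) - (q1 x * p1 x + p2 x * q x) - c / 2 * E1 x) (at x)"
      by (intro DERIV_diff DERIV_mult DERIV_cmult dp dq dp1 dq1 dE)
    moreover have "(p1 x * q1 x + q2 x * p x) - (q1 x * p1 x + p2 x * q x) - c / 2 * E1 x = 0"
    proof -
      have "(p1 x * q1 x + q2 x * p x) - (q1 x * p1 x + p2 x * q x) - c / 2 * E1 x
        = p x * (c * p1 x + q2 x + q x * E x + \<kappa> * q x * E2 x)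
          - q x * (- c * q1 x + p2 x + p x * E x + \<kappa> * p x * E2 x)"
        unfolding E1_def by (simp add: algebra_simps)
      then show ?thesis unfolding Re_eq' Im_eq' by simp
    qed
    ultimately show ?thesis by (rule DERIV_cong)
  qed
  moreover have "\<bar>?g x\<bar> \<le> (4 + \<bar>c\<bar>) * e"
    if "0 < e" "\<bar>E x\<bar> < e" "\<bar>p1 x\<bar> < e" "\<bar>q1 x\<bar> < e" "\<bar>p x\<bar> \<le> 2" "\<bar>q x\<bar> \<le> 2" for x e
  proof -
    have "\<bar>p x * q1 x\<bar> \<le> 2 * e" "\<bar>q x * p1 x\<bar> \<le> 2 * e"
      unfolding abs_mult using that by (auto intro!: mult_mono)
    moreover have "\<bar>c / 2 * E x\<bar> \<le> \<bar>c\<bar> * e"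
    proof -
      have "\<bar>c\<bar> * \<bar>E x\<bar> \<le> \<bar>c\<bar> * e" using that by (intro mult_left_mono) auto
      moreover have "\<bar>c / 2 * E x\<bar> = \<bar>c\<bar> * \<bar>E x\<bar> / 2" "0 \<le> \<bar>c\<bar> * \<bar>E x\<bar>" by (simp_all add: abs_mult)
      ultimately show ?thesis by linarith
    qed
    moreover have "(4 + \<bar>c\<bar>) * e = 2 * e + 2 * e + \<bar>c\<bar> * e" by (simp add: algebra_simps)
    ultimately show ?thesis by linarith
  qed
  ultimately have "?g x = 0" by (rule constant_vanishes[where B = "4 + \<bar>c\<bar>"]) auto
  then show ?thesis by simp
qed

text \<open>Comes from the real part of the equation multiplied by twice the conjugate of
  \<open>u'\<close>, where the term with \<open>c\<close> drops out.\<close>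

lemma speed: "(p1 x)\<^sup>2 + (q1 x)\<^sup>2 = (E x)\<^sup>2 / 2 + \<kappa> / 2 * (E1 x)\<^sup>2"
proof -
  let ?g = "\<lambda>x. ((p1 x)\<^sup>2 + (q1 x)\<^sup>2) - ((E x)\<^sup>2 / 2 + \<kappa> / 2 * (E1 x)\<^sup>2)"
  have "(?g has_real_derivative 0) (at x)" for x
  proof -
    have "(?g has_real_derivative (2 * p1 x * p2 x + 2 * q1 x * q2 x) - (E x * E1 x + \<kappa> * (E1 x * E2 x))) (at x)"
      by (auto intro!: derivative_eq_intros dp1 dq1 dE dE1)
    moreover have "(2 * p1 x * p2 x + 2 * q1 x * q2 x) - (E x * E1 x + \<kappa> * (E1 x * E2 x))
        = 2 * p1 x * (- c * q1 x + p2 x + p x * E x + \<kappa> * p x * E2 x)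
          + 2 * q1 x * (c * p1 x + q2 x + q x * E x + \<kappa> * q x * E2 x)"
      unfolding E1_def by (simp add: algebra_simps)
    ultimately show ?thesis unfolding Re_eq' Im_eq' by simp
  qed
  moreover have "\<bar>?g x\<bar> \<le> (3 + 32 * \<bar>\<kappa>\<bar>) * e"
    if "0 < e" "e \<le> 1" "\<bar>E x\<bar> < e" "\<bar>p1 x\<bar> < e" "\<bar>q1 x\<bar> < e" "\<bar>p x\<bar> \<le> 2" "\<bar>q x\<bar> \<le> 2" for x e
  proof -
    have sq: "y\<^sup>2 \<le> k * k * e" if "\<bar>y\<bar> \<le> k * e" "k \<ge> 0" for y k
    proof -
      have "y\<^sup>2 = \<bar>y\<bar> * \<bar>y\<bar>" by (simp add: power2_eq_square)
      also have "\<dots> \<le> (k * e) * (k * 1)"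
      proof (rule mult_mono)
        have "k * e \<le> k * 1" using that(2) \<open>e \<le> 1\<close> by (rule mult_left_mono[rotated])
        then show "\<bar>y\<bar> \<le> k * 1" using that(1) by linarith
      qed (use that \<open>0 < e\<close> in auto)
      finally show ?thesis by (simp add: mult_ac)
    qed
    have "\<bar>p x * p1 x\<bar> \<le> 2 * e" "\<bar>q x * q1 x\<bar> \<le> 2 * e"
      unfolding abs_mult using that by (auto intro!: mult_mono)
    then have "\<bar>p x * p1 x + q x * q1 x\<bar> \<le> 4 * e" by linarith
    then have "\<bar>E1 x\<bar> \<le> 8 * e" unfolding E1_def abs_mult by simp
    from sq[OF this] have "(E1 x)\<^sup>2 \<le> 64 * e" by simp
    then have k: "\<bar>\<kappa>\<bar> * (E1 x)\<^sup>2 \<le> \<bar>\<kappa>\<bar> * (64 * e)" by (intro mult_left_mono) auto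
    have "(E x)\<^sup>2 \<le> e" "(p1 x)\<^sup>2 \<le> e" "(q1 x)\<^sup>2 \<le> e"
      using sq[of _ 1] that by auto
    moreover have "\<bar>\<kappa> / 2 * (E1 x)\<^sup>2\<bar> \<le> \<bar>\<kappa>\<bar> * (32 * e)" using k by (simp add: abs_mult)
    moreover have "(3 + 32 * \<bar>\<kappa>\<bar>) * e = e + e + e + \<bar>\<kappa>\<bar> * (32 * e)" by (simp add: algebra_simps)
    moreover have "(E x)\<^sup>2 \<ge> 0" "(p1 x)\<^sup>2 \<ge> 0" "(q1 x)\<^sup>2 \<ge> 0" by auto
    ultimately show ?thesis unfolding abs_le_iff by linarith
  qed
  ultimately have "?g x = 0" by (rule constant_vanishes[where B = "3 + 32 * \<bar>\<kappa>\<bar>"]) auto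
  then show ?thesis by simp
qed

text \<open>Lagrange's identity writes the product of \<open>\<bar>u\<bar>\<^sup>2\<close> and
  \<open>\<bar>u'\<bar>\<^sup>2\<close> as a sum of two squares, one a multiple of
  \<open>E1\<^sup>2\<close> and the other the squared momentum. Inserting the first integrals
  eliminates the phase.\<close>

lemma first_order: "(E1 x)\<^sup>2 * (b + \<kappa> * E x) = (E x)\<^sup>2 * (a - E x)"
proof -
  have "((p x)\<^sup>2 + (q x)\<^sup>2) * ((p1 x)\<^sup>2 + (q1 x)\<^sup>2) = (E1 x)\<^sup>2 / 4 + (p x * q1 x - q x * p1 x)\<^sup>2"
    by (simp add: E1_def power2_eq_square algebra_simps)
  then have "(1 - E x) * ((E x)\<^sup>2 / 2 + \<kappa> / 2 * (E1 x)\<^sup>2) = (E1 x)\<^sup>2 / 4 + (c / 2 * E x)\<^sup>2"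
    unfolding momentum speed by (simp add: E_def)
  then show ?thesis unfolding a_def b_def by (simp add: power2_eq_square field_simps)
qed

text \<open>Formally this is the derivative of \<open>first_order\<close> divided by
  \<open>E1\<close>. It is derived from the real part of the equation multiplied by the conjugate of
  \<open>u\<close>, hence holds at critical points of \<open>E\<close> as well.\<close>

lemma second_order: "2 * E2 x * (b + \<kappa> * E x) + \<kappa> * (E1 x)\<^sup>2 = 2 * a * E x - 3 * (E x)\<^sup>2"
proof -
  have "p x * (- c * q1 x + p2 x + p x * E x + \<kappa> * p x * E2 x)
      + q x * (c * p1 x + q2 x + q x * E x + \<kappa> * q x * E2 x) = 0"
    unfolding Re_eq' Im_eq' by simp
  moreover have "p x * (- c * q1 x + p2 x + p x * E x + \<kappa> * p x * E2 x)
      + q x * (c * p1 x + q2 x + q x * E x + \<kappa> * q x * E2 x)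
      = - c * (p x * q1 x - q x * p1 x) - E2 x / 2 - ((p1 x)\<^sup>2 + (q1 x)\<^sup>2)
        + ((p x)\<^sup>2 + (q x)\<^sup>2) * (E x + \<kappa> * E2 x)"
  proof -
    have "p x * p2 x + q x * q2 x = - E2 x / 2 - ((p1 x)\<^sup>2 + (q1 x)\<^sup>2)"
    proof -
      have "w = - (- 2 * (s + t + v + w)) / 2 - (s + t) - v" for s t v w :: real by (simp add: field_simps)
      from this[of "q x * q2 x" "(p1 x)\<^sup>2" "(q1 x)\<^sup>2" "p x * p2 x"] show ?thesis
        unfolding E2_def by (simp add: algebra_simps)
    qed
    then show ?thesis by (simp add: power2_eq_square algebra_simps)
  qed
  moreover have "(p x)\<^sup>2 + (q x)\<^sup>2 = 1 - E x" by (simp add: E_def)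
  ultimately have "- c * (c / 2 * E x) - E2 x / 2 - ((E x)\<^sup>2 / 2 + \<kappa> / 2 * (E1 x)\<^sup>2)
        + (1 - E x) * (E x + \<kappa> * E2 x) = 0"
    unfolding momentum speed by simp
  then show ?thesis unfolding a_def b_def by (simp add: power2_eq_square field_simps)
qed

section \<open>Extremal values of \<open>E\<close>\<close>

lemma critical_value: "E1 x = 0 \<Longrightarrow> E x \<noteq> 0 \<Longrightarrow> E x = a"
  using first_order[of x] by simp

text \<open>Points on either side of \<open>x\<close> with a smaller modulus force the maximum over
  the interval between them into its interior; there \<open>first_order\<close> leaves only the
  value \<open>a\<close>.\<close>

lemma extremum_pos:
  assumes "E x > 0"
  shows "\<exists>y. E1 y = 0 \<and> E y = a \<and> E x \<le> E y"
proof -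
  obtain l where l: "l < x" "\<bar>E l\<bar> < E x" using small_point(3)[OF assms] by blast
  obtain r where r: "r > x" "\<bar>E r\<bar> < E x" using small_point(2)[OF assms] by blast
  have "\<exists>y\<in>{l..r}. \<forall>z\<in>{l..r}. E z \<le> E y"
    by (rule continuous_attains_sup) (use l r in \<open>auto intro: continuous_waves\<close>)
  then obtain y where y: "y \<in> {l..r}" "\<And>z. z \<in> {l..r} \<Longrightarrow> E z \<le> E y" by blast
  have xy: "E x \<le> E y" using y(2)[of x] l r by simp
  then have int: "l < y" "y < r" using y(1) l r by (auto simp: le_less)
  have "E1 y = 0"
  proof (rule DERIV_local_max[OF dE])
    show "0 < min (y - l) (r - y)" using int by simp
    show "\<forall>z. \<bar>y - z\<bar> < min (y - l) (r - y) \<longrightarrow> E z \<le> E y"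
      by (auto intro!: y(2) simp: abs_less_iff)
  qed
  then show ?thesis using critical_value[of y] xy assms by (intro exI[of _ y]) auto
qed

lemma extremum_neg:
  assumes "E x < 0"
  shows "\<exists>y. E1 y = 0 \<and> E y = a \<and> E y \<le> E x"
proof -
  have pos: "- E x > 0" using assms by simp
  obtain l where l: "l < x" "\<bar>E l\<bar> < - E x" using small_point(3)[OF pos] by blast
  obtain r where r: "r > x" "\<bar>E r\<bar> < - E x" using small_point(2)[OF pos] by blast
  have "\<exists>y\<in>{l..r}. \<forall>z\<in>{l..r}. E y \<le> E z"
    by (rule continuous_attains_inf) (use l r in \<open>auto intro: continuous_waves\<close>)
  then obtain y where y: "y \<in> {l..r}" "\<And>z. z \<in> {l..r} \<Longrightarrow> E y \<le> E z" by blast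
  have xy: "E y \<le> E x" using y(2)[of x] l r by simp
  then have int: "l < y" "y < r" using y(1) l r by (auto simp: le_less)
  have "E1 y = 0"
  proof (rule DERIV_local_min[OF dE])
    show "0 < min (y - l) (r - y)" using int by simp
    show "\<forall>z. \<bar>y - z\<bar> < min (y - l) (r - y) \<longrightarrow> E y \<le> E z"
      by (auto intro!: y(2) simp: abs_less_iff)
  qed
  then show ?thesis using critical_value[of y] xy assms by (intro exI[of _ y]) auto
qed

text \<open>A nonzero value of \<open>E\<close> has the sign of \<open>a\<close> and at most its
  modulus. When \<open>a = 0\<close> the quotients are 0 by the convention for division, and the
  content lies in the last claim.\<close>

lemma E_range: "0 \<le> E x / a" "E x / a \<le> 1" and E_zero_if_a_zero: "a = 0 \<Longrightarrow> E x = 0"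
  using extremum_pos[of x] extremum_neg[of x]
  by (cases "E x = 0"; cases "E x > 0"; force simp: divide_le_eq zero_le_divide_iff)+

lemma extremum:
  assumes "E x \<noteq> 0"
  obtains y where "E1 y = 0" "E y = a"
  using assms extremum_pos[of x] extremum_neg[of x] by (metis linorder_neqE_linordered_idom)

section \<open>Vanishing of \<open>E\<close>\<close>

lemma constant_if_E_zero:
  assumes "\<And>x. E x = 0"
  shows "(p x)\<^sup>2 + (q x)\<^sup>2 = 1" "p x = p 0" "q x = q 0"
proof -
  show "(p x)\<^sup>2 + (q x)\<^sup>2 = 1" using assms[of x] by (simp add: E_def)
  have "E = (\<lambda>x. 0)" using assms by auto
  then have "E1 x = 0" for x using dE[of x] DERIV_unique[OF _ DERIV_const] by metis
  then have "(p1 x)\<^sup>2 + (q1 x)\<^sup>2 = 0" for x using speed[of x] assms[of x] by simp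
  then have "p1 x = 0" "q1 x = 0" for x by (simp_all add: sum_power2_eq_zero_iff)
  then show "p x = p 0" "q x = q 0"
    using DERIV_isconst_all[of p x 0] DERIV_isconst_all[of q x 0] dp dq by metis+
qed

text \<open>Gronwall's argument for \<open>E\<^sup>2\<close>, whose derivative is at most
  \<open>1 + K\<close> times itself in modulus; exponential weights of opposite sign cover the two
  sides of \<open>x0\<close>.\<close>

lemma E_zero_everywhere:
  assumes bound: "\<And>x. (E1 x)\<^sup>2 \<le> K * (E x)\<^sup>2" and zero: "E x0 = 0"
  shows "E x = 0"
proof -
  let ?L = "1 + K"
  have le: "\<bar>2 * E x * E1 x\<bar> \<le> ?L * (E x)\<^sup>2" for x
  proof -
    have "0 \<le> (\<bar>E x\<bar> - \<bar>E1 x\<bar>)\<^sup>2" by simp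
    then have "\<bar>2 * E x * E1 x\<bar> \<le> (E x)\<^sup>2 + (E1 x)\<^sup>2"
      by (simp add: power2_eq_square abs_mult algebra_simps)
    also have "\<dots> \<le> ?L * (E x)\<^sup>2" using bound[of x] by (simp add: algebra_simps)
    finally show ?thesis .
  qed
  have d: "((\<lambda>x. (E x)\<^sup>2 * exp (k * x)) has_real_derivative (2 * E x * E1 x + k * (E x)\<^sup>2) * exp (k * x)) (at x)" for k x
    by (auto intro!: derivative_eq_intros dE simp: algebra_simps)
  have "(E x)\<^sup>2 \<le> 0"
  proof (cases "x0 \<le> x")
    case True
    have "(E x)\<^sup>2 * exp (- ?L * x) \<le> (E x0)\<^sup>2 * exp (- ?L * x0)"
    proof (rule DERIV_nonpos_imp_nonincreasing[OF True, where f = "\<lambda>x. (E x)\<^sup>2 * exp (- ?L * x)"])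
      fix y
      have "(2 * E y * E1 y + - ?L * (E y)\<^sup>2) * exp (- ?L * y) \<le> 0"
        using le[of y] by (intro mult_nonpos_nonneg) (simp_all add: abs_le_iff algebra_simps)
      then show "\<exists>D. ((\<lambda>x. (E x)\<^sup>2 * exp (- ?L * x)) has_real_derivative D) (at y) \<and> D \<le> 0"
        using d[where k = "- ?L"] by blast
    qed
    then show ?thesis using zero by (simp add: mult_le_0_iff)
  next
    case False
    have "(E x)\<^sup>2 * exp (?L * x) \<le> (E x0)\<^sup>2 * exp (?L * x0)"
    proof (rule DERIV_nonneg_imp_nondecreasing[where f = "\<lambda>x. (E x)\<^sup>2 * exp (?L * x)" and a = x and b = x0])
      fix y
      have "(2 * E y * E1 y + ?L * (E y)\<^sup>2) * exp (?L * y) \<ge> 0"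
        using le[of y] by (intro mult_nonneg_nonneg) (simp_all add: abs_le_iff algebra_simps)
      then show "\<exists>D. ((\<lambda>x. (E x)\<^sup>2 * exp (?L * x)) has_real_derivative D) (at y) \<and> 0 \<le> D"
        using d[where k = ?L] by blast
    qed (use False in simp)
    then show ?thesis using zero by (simp add: mult_le_0_iff)
  qed
  then show ?thesis by simp
qed

text \<open>For small nonzero \<open>E\<close> the two sides of \<open>first_order\<close> would
  have the signs of \<open>b\<close> and \<open>a\<close>, which differ. So
  \<open>\<bar>E\<bar>\<close> has no values strictly between 0 and \<open>\<delta>\<close>; it does
  take the value 0, and continuity keeps it there.\<close>

lemma E_zero_opposite_signs:
  assumes ab: "a * b < 0"
  shows "E x = 0"
proof (rule ccontr)
  assume nz: "E x \<noteq> 0"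
  \<comment> \<open>Below this threshold \<open>a - E y\<close> keeps the sign of \<open>a\<close>
    and \<open>b + \<kappa> * E y\<close> that of \<open>b\<close>. The 1 in the denominator covers
    \<open>\<kappa> = 0\<close>.\<close>
  define \<delta> where "\<delta> = min \<bar>a\<bar> (\<bar>b\<bar> / (1 + \<bar>\<kappa>\<bar>))"
  have "a \<noteq> 0" "b \<noteq> 0" using ab by auto
  then have \<delta>: "\<delta> > 0" by (simp add: \<delta>_def add_pos_nonneg)
  have gap: "E y = 0" if y: "\<bar>E y\<bar> < \<delta>" for y
  proof -
    have "a * E y \<le> \<bar>a\<bar> * \<bar>E y\<bar>" by (simp add: abs_mult[symmetric])
    also have "\<dots> < \<bar>a\<bar> * \<bar>a\<bar>" using y \<open>a \<noteq> 0\<close> by (intro mult_strict_left_mono) (auto simp: \<delta>_def)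
    finally have Y: "a * (a - E y) > 0" by (simp add: algebra_simps)
    have "\<bar>\<kappa> * E y\<bar> \<le> (1 + \<bar>\<kappa>\<bar>) * \<bar>E y\<bar>" by (simp add: abs_mult algebra_simps)
    also have "\<dots> < (1 + \<bar>\<kappa>\<bar>) * (\<bar>b\<bar> / (1 + \<bar>\<kappa>\<bar>))"
      using y by (intro mult_strict_left_mono) (auto simp: \<delta>_def)
    also have "\<dots> = \<bar>b\<bar>" by (simp add: add_pos_nonneg less_imp_neq[symmetric])
    finally have k: "\<bar>\<kappa> * E y\<bar> < \<bar>b\<bar>" .
    have "- (b * (\<kappa> * E y)) \<le> \<bar>b\<bar> * \<bar>\<kappa> * E y\<bar>" unfolding abs_mult[symmetric] by simp
    also have "\<dots> < \<bar>b\<bar> * \<bar>b\<bar>" using k \<open>b \<noteq> 0\<close> by (intro mult_strict_left_mono) auto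
    finally have X: "b * (b + \<kappa> * E y) > 0" by (simp add: algebra_simps)
    \<comment> \<open>Multiplying \<open>first_order\<close> by \<open>a\<^sup>2 * b\<close> makes
      the left side nonnegative and brings out the negative factor \<open>a * b\<close> on the
      right.\<close>
    have "0 \<le> a\<^sup>2 * (E1 y)\<^sup>2 * (b * (b + \<kappa> * E y))" 
      by (rule mult_nonneg_nonneg) (use X in simp_all)
    also have "\<dots> = a\<^sup>2 * b * ((E1 y)\<^sup>2 * (b + \<kappa> * E y))" by simp
    also have "\<dots> = (a * b) * ((E y)\<^sup>2 * (a * (a - E y)))"
      unfolding first_order by (simp add: power2_eq_square)
    finally have "0 \<le> (a * b) * ((E y)\<^sup>2 * (a * (a - E y)))" .
    then have "(E y)\<^sup>2 * (a * (a - E y)) \<le> 0" using mult_neg_pos[OF ab] by (meson not_le)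
    with mult_pos_pos[OF _ Y, of "(E y)\<^sup>2"] show ?thesis by (metis not_le zero_less_power2)
  qed
  obtain y where "\<bar>E y\<bar> < \<delta>" using small_point(1)[OF \<delta>] by blast
  then have y0: "\<bar>E y\<bar> = 0" using gap by simp
  have "min \<bar>E x\<bar> (\<delta> / 2) \<in> range (\<lambda>x. \<bar>E x\<bar>)"
  proof (rule connectedD_interval)
    show "connected (range (\<lambda>x. \<bar>E x\<bar>))"
      by (intro connected_continuous_image continuous_intros continuous_waves connected_UNIV)
    show "\<bar>E y\<bar> \<in> range (\<lambda>x. \<bar>E x\<bar>)" "\<bar>E x\<bar> \<in> range (\<lambda>x. \<bar>E x\<bar>)" by (rule rangeI)+
    show "\<bar>E y\<bar> \<le> min \<bar>E x\<bar> (\<delta> / 2)" unfolding y0 using \<delta> by simp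
  qed simp
  then obtain z where z: "\<bar>E z\<bar> = min \<bar>E x\<bar> (\<delta> / 2)" by auto
  then have "E z \<noteq> 0" "\<bar>E z\<bar> < \<delta>" using nz \<delta> by auto
  then show False using gap by blast
qed

text \<open>For \<open>\<kappa> = 1/2\<close> the profile equation is linear off the zero set of \<open>E\<close>, where \<open>E2 + 2 * E\<close> is \<open>a\<close>,
  and off the closure of that set it is \<open>0\<close>; being continuous, \<open>E2 + 2 * E\<close> is constant.
  The half-period shift of a harmonic oscillation changes the sign of \<open>E - a / 2\<close>, so that \<open>E\<close>
  and its shift cannot both be small.\<close>
lemma E_zero_critical:
  assumes b0: "b = 0" and a0: "a \<noteq> 0"
  shows "E x = 0"
proof (rule ccontr)
  assume nz: "E x \<noteq> 0"
  have k: "\<kappa> * z = z / 2" for z using b0 by (simp add: b_def)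
  let ?G = "\<lambda>x. E2 x + 2 * E x"
  let ?Z = "{x. E x \<noteq> 0}"
  have Z: "?G y = a" if "y \<in> ?Z" for y
  proof -
    have "E y * ((E1 y)\<^sup>2 / 2) = E y * (E y * (a - E y))"
      using first_order[of y] unfolding b0 k by (simp add: power2_eq_square mult_ac)
    then have "(E1 y)\<^sup>2 / 2 = E y * (a - E y)" using that by simp
    moreover have "E2 y * E y + (E1 y)\<^sup>2 / 2 = 2 * a * E y - 3 * (E y)\<^sup>2"
      using second_order[of y] unfolding b0 k by simp
    ultimately have "E y * ?G y = E y * a" by (simp add: power2_eq_square algebra_simps)
    then show ?thesis using that by simp
  qed
  have cG: "continuous_on UNIV ?G" by (intro continuous_intros continuous_E2 continuous_waves)
  have "closed {y. ?G y = a}" using cG by (intro closed_Collect_eq continuous_on_const)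
  then have "closure ?Z \<subseteq> {y. ?G y = a}" using Z by (intro closure_minimal) auto
  moreover have "?G y = 0" if y: "y \<notin> closure ?Z" for y
  proof -
    have yc: "y \<in> - closure ?Z" using y by blast
    have op: "open (- closure ?Z)" by (rule open_Compl[OF closed_closure])
    have E0: "E z = 0" if "z \<in> - closure ?Z" for z using that closure_subset[of ?Z] by blast
    have E10: "E1 z = 0" if "z \<in> - closure ?Z" for z
    proof -
      have "(E has_real_derivative 0) (at z)"
        by (rule has_field_derivative_transform_within_open[OF DERIV_const[of 0] op that]) (rule E0[symmetric])
      then show ?thesis by (rule DERIV_unique[OF dE])
    qed
    have "(E1 has_real_derivative 0) (at y)"
      by (rule has_field_derivative_transform_within_open[OF DERIV_const[of 0] op yc]) (rule E10[symmetric])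
    then have "E2 y = 0" by (rule DERIV_unique[OF dE1])
    then show ?thesis using E0[OF yc] by simp
  qed
  ultimately have "range ?G \<subseteq> {a, 0}" by auto
  then have "finite (range ?G)" by (rule finite_subset) simp
  then have "?G constant_on UNIV" by (intro continuous_finite_range_constant cG connected_UNIV)
  then have G: "?G y = a" for y using Z[of x] nz unfolding constant_on_def by auto
  obtain r :: real where r: "r > 0" "r * r = 2" by (rule that[of "sqrt 2"]) auto
  \<comment> \<open>Coordinates of \<open>(E - a / 2, E1 / r)\<close> in a frame rotating with the
    oscillation; their constancy gives the general solution without a uniqueness theorem.\<close>
  define f where "f = (\<lambda>y. (E y - a / 2) * cos (r * y) - E1 y / r * sin (r * y))"
  define g where "g = (\<lambda>y. (E y - a / 2) * sin (r * y) + E1 y / r * cos (r * y))"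
  have E2: "E2 y = - (r * r) * (E y - a / 2)" for y using G[of y] using r(2) by simp
  have c1: "((\<lambda>y. cos (r * y)) has_real_derivative - sin (r * y) * r) (at y)"
    and s1: "((\<lambda>y. sin (r * y)) has_real_derivative cos (r * y) * r) (at y)" for y
    by (auto intro!: derivative_eq_intros)
  have e0: "((\<lambda>y. E y - a / 2) has_real_derivative E1 y) (at y)" for y
    using DERIV_diff[OF dE DERIV_const] by simp
  have e1: "((\<lambda>y. E1 y / r) has_real_derivative E2 y / r) (at y)" for y
    by (rule DERIV_cdivide[OF dE1])
  have "(f has_real_derivative 0) (at y)" for y
  proof -
    note DERIV_diff[OF DERIV_mult'[OF e0 c1] DERIV_mult'[OF e1[of y] s1]]
    moreover have "((E y - a / 2) * (- sin (r * y) * r) + E1 y * cos (r * y))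
        - (E1 y / r * (cos (r * y) * r) + E2 y / r * sin (r * y)) = 0"
      unfolding E2 using r(1) by simp
    ultimately show ?thesis unfolding f_def by (rule DERIV_cong)
  qed
  moreover have "(g has_real_derivative 0) (at y)" for y
  proof -
    note DERIV_add[OF DERIV_mult'[OF e0 s1] DERIV_mult'[OF e1[of y] c1]]
    moreover have "((E y - a / 2) * (cos (r * y) * r) + E1 y * sin (r * y))
        + (E1 y / r * (- sin (r * y) * r) + E2 y / r * cos (r * y)) = 0"
      unfolding E2 using r(1) by simp
    ultimately show ?thesis unfolding g_def by (rule DERIV_cong)
  qed
  ultimately have fg: "f y = f 0" "g y = g 0" for y using DERIV_isconst_all by blast+
  have sol: "E y - a / 2 = f 0 * cos (r * y) + g 0 * sin (r * y)" for y
  proof -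
    have "f y * cos (r * y) + g y * sin (r * y)
        = (E y - a / 2) * ((cos (r * y))\<^sup>2 + (sin (r * y))\<^sup>2)"
    proof -
      have "(w * C - e * D) * C + (w * D + e * C) * D = w * (C\<^sup>2 + D\<^sup>2)" for w C D e :: real
        by (simp add: algebra_simps power2_eq_square)
      then show ?thesis unfolding f_def g_def .
    qed
    then show ?thesis by (simp add: fg[of y])
  qed
  define T where "T = pi / r"
  have shift: "E y + E (y + T) = a" for y
  proof -
    have "r * (y + T) = r * y + pi" using r(1) by (simp add: T_def field_simps)
    then show ?thesis using sol[of y] sol[of "y + T"] by simp
  qed
  \<comment> \<open>Adding the shifted energy density gives one integrable function, so that
    \<open>E\<close> is small at \<open>y\<close> and at \<open>y + T\<close>
    simultaneously.\<close>
  let ?h = "\<lambda>x. (E x)\<^sup>2 + ((p1 x)\<^sup>2 + (q1 x)\<^sup>2)"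
  have h: "integrable lborel ?h" using energy by (simp add: E_def)
  have "integrable lborel (\<lambda>x. ?h (T + 1 * x))" by (rule lborel_integrable_real_affine[OF h]) simp
  then have "integrable lborel (\<lambda>x. ?h x + ?h (T + 1 * x))" by (rule Bochner_Integration.integrable_add[OF h])
  then obtain y where "?h y + ?h (T + 1 * y) < (a / 2)\<^sup>2"
    using integrable_nonneg_small(1)[of "\<lambda>x. ?h x + ?h (T + 1 * x)" "(a / 2)\<^sup>2"] a0 by auto
  moreover have "(E y)\<^sup>2 \<le> ?h y" "(E (y + T))\<^sup>2 \<le> ?h (T + 1 * y)" "?h y \<ge> 0" "?h (T + 1 * y) \<ge> 0"
    by (simp_all add: add.commute)
  ultimately have "(E y)\<^sup>2 < (a / 2)\<^sup>2" "(E (y + T))\<^sup>2 < (a / 2)\<^sup>2" by linarith+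
  then have "\<bar>E y\<bar> < \<bar>a / 2\<bar>" "\<bar>E (y + T)\<bar> < \<bar>a / 2\<bar>"
    using abs_le_square_iff[of "a / 2"] by (metis not_le)+
  then show False using shift[of y] by linarith
qed

text \<open>For \<open>c \<ge> 0\<close>, the set \<open>DD\<close> is exactly where
  \<open>a\<close> and \<open>b\<close> are nonzero with the same sign; the three ways to fail are
  the three vanishing results.\<close>

lemma E_zero_outside_DD:
  assumes "c \<ge> 0" "(c, \<kappa>) \<notin> DD"
  shows "E x = 0"
proof -
  have c2: "c < sqrt 2 \<longleftrightarrow> c\<^sup>2 < 2" "sqrt 2 < c \<longleftrightarrow> 2 < c\<^sup>2"
    using assms(1) real_sqrt_less_iff[of "c\<^sup>2" 2] real_sqrt_less_iff[of 2 "c\<^sup>2"] by simp_all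
  have "\<not> (a > 0 \<and> b > 0)" "\<not> (a < 0 \<and> b < 0)"
    using assms c2 by (auto simp: a_def b_def DD_def D1_def D2_def D3_def)
  then consider "a = 0" | "b = 0" "a \<noteq> 0" | "a * b < 0"
    by (metis linorder_neqE_linordered_idom mult_neg_pos mult_pos_neg)
  then show ?thesis using E_zero_if_a_zero E_zero_critical E_zero_opposite_signs by cases auto
qed

end

section \<open>Uniqueness\<close>

lemma finite_energy_waveE:
  assumes v: "v \<in> C_k 2" "v \<in> energy_space" and tw: "TW c \<kappa> v"
  obtains v' p2 q2 where
    "finite_energy_wave c \<kappa> (\<lambda>x. Re (v x)) (\<lambda>x. Im (v x)) (\<lambda>x. Re (v' x)) (\<lambda>x. Im (v' x)) p2 q2"
    "\<And>x. (v has_vector_derivative v' x) (at x)" "continuous_on UNIV v'"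
proof -
  obtain v' v'' where d: "\<And>x. (v has_vector_derivative v' x) (at x)"
      "\<And>x. (v' has_vector_derivative v'' x) (at x)" and cont: "continuous_on UNIV v''"
    and it: "iter_deriv 1 v = v'" "iter_deriv 2 v = v''"
    using v(1) by (elim C_k_2E) blast
  have cv': "continuous_on UNIV v'"
    using d(2) by (meson continuous_at_imp_continuous_on has_vector_derivative_continuous)
  have Re_d: "((\<lambda>x. Re (f x)) has_real_derivative Re f') (at x)"
    and Im_d: "((\<lambda>x. Im (f x)) has_real_derivative Im f') (at x)"
    if "(f has_vector_derivative f') (at x)" for f f' x
    unfolding has_real_derivative_iff_has_vector_derivative
    using bounded_linear.has_vector_derivative[OF bounded_linear_Re that]
      bounded_linear.has_vector_derivative[OF bounded_linear_Im that] by auto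
  note ds = Re_d[OF d(1)] Im_d[OF d(1)] Re_d[OF d(2)] Im_d[OF d(2)]
  let ?W = "\<lambda>x. - 2 * ((Re (v' x))\<^sup>2 + (Im (v' x))\<^sup>2 + Re (v x) * Re (v'' x) + Im (v x) * Im (v'' x))"
  have mod: "1 - (cmod (v x))\<^sup>2 = 1 - (Re (v x))\<^sup>2 - (Im (v x))\<^sup>2" for x by (simp add: cmod_power2)
  have "iter_deriv 2 (\<lambda>y. 1 - (cmod (v y))\<^sup>2) = ?W"
  proof (rule iter_deriv_2_eqI)
    show "((\<lambda>y. 1 - (cmod (v y))\<^sup>2) has_vector_derivative - 2 * (Re (v x) * Re (v' x) + Im (v x) * Im (v' x))) (at x)" for x
      unfolding has_real_derivative_iff_has_vector_derivative[symmetric] mod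
      by (auto intro!: derivative_eq_intros d simp: algebra_simps)
    show "((\<lambda>x. - 2 * (Re (v x) * Re (v' x) + Im (v x) * Im (v' x))) has_vector_derivative ?W x) (at x)" for x
      unfolding has_real_derivative_iff_has_vector_derivative[symmetric]
      by (auto intro!: derivative_eq_intros d simp: algebra_simps power2_eq_square)
  qed
  then have eq: "\<i> * of_real c * v' x + v'' x + v x * of_real (1 - (Re (v x))\<^sup>2 - (Im (v x))\<^sup>2)
      + of_real \<kappa> * v x * of_real (?W x) = 0" for x
    using tw unfolding TW_def it mod by simp
  have "finite_energy_wave c \<kappa> (\<lambda>x. Re (v x)) (\<lambda>x. Im (v x)) (\<lambda>x. Re (v' x)) (\<lambda>x. Im (v' x))
      (\<lambda>x. Re (v'' x)) (\<lambda>x. Im (v'' x))"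
  proof
    show "- c * Im (v' x) + Re (v'' x) + Re (v x) * (1 - (Re (v x))\<^sup>2 - (Im (v x))\<^sup>2) + \<kappa> * Re (v x) * ?W x = 0" for x
      using arg_cong[OF eq[of x], of Re] by simp
    show "c * Re (v' x) + Im (v'' x) + Im (v x) * (1 - (Re (v x))\<^sup>2 - (Im (v x))\<^sup>2) + \<kappa> * Im (v x) * ?W x = 0" for x
      using arg_cong[OF eq[of x], of Im] by simp
    have cv: "continuous_on UNIV v"
      using d(1) by (meson continuous_at_imp_continuous_on has_vector_derivative_continuous)
    have int: "integrable lebesgue (\<lambda>x. (1 - (cmod (v x))\<^sup>2)\<^sup>2 + (cmod (v' x))\<^sup>2)"
      using v(2) unfolding energy_space_C1_iff[OF d(1) cv'] by (intro Bochner_Integration.integrable_add) auto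
    have "continuous_on UNIV (\<lambda>x. (1 - (cmod (v x))\<^sup>2)\<^sup>2 + (cmod (v' x))\<^sup>2)"
      by (intro continuous_intros cv cv')
    then have "(\<lambda>x. (1 - (cmod (v x))\<^sup>2)\<^sup>2 + (cmod (v' x))\<^sup>2) \<in> borel_measurable lborel"
      by (simp add: borel_measurable_continuous_onI)
    from integrable_completion[OF this] int
    have "integrable lborel (\<lambda>x. (1 - (cmod (v x))\<^sup>2)\<^sup>2 + (cmod (v' x))\<^sup>2)" by blast
    then show "integrable lborel (\<lambda>x. (1 - (Re (v x))\<^sup>2 - (Im (v x))\<^sup>2)\<^sup>2 + ((Re (v' x))\<^sup>2 + (Im (v' x))\<^sup>2))"
      unfolding mod by (simp add: cmod_power2)
  qed (auto intro!: ds continuous_intros cont)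
  then show ?thesis using d(1) cv' by (rule that)
qed

lemma cis_if_unit: "cmod k = 1 \<Longrightarrow> \<exists>\<phi>. k = cis \<phi>"
  using rcis_cmod_Arg[of k] by (metis mult_1 of_real_1 rcis_def)

lemma constant_phase_if_E_zero:
  assumes W: "finite_energy_wave c \<kappa> (\<lambda>x. Re (v x)) (\<lambda>x. Im (v x)) p1 q1 p2 q2"
    and E: "\<And>x. finite_energy_wave.E (\<lambda>x. Re (v x)) (\<lambda>x. Im (v x)) x = 0"
  shows "\<exists>\<phi>. \<forall>x. v x = cis \<phi>"
proof -
  interpret finite_energy_wave c \<kappa> "\<lambda>x. Re (v x)" "\<lambda>x. Im (v x)" p1 q1 p2 q2 by (rule W)
  have v0: "v x = v 0" for x using constant_if_E_zero(2,3)[OF E] by (simp add: complex_eq_iff)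
  have "(cmod (v 0))\<^sup>2 = 1" using constant_if_E_zero(1)[OF E, of 0] by (simp add: cmod_power2)
  then have "cmod (v 0) = 1" by (simp add: power2_eq_1_iff) (use norm_ge_zero[of "v 0"] in linarith)
  then show ?thesis using cis_if_unit v0 by metis
qed

lemma trivial_outside_DD:
  assumes "c \<ge> 0" "(c, \<kappa>) \<notin> DD" "u \<in> energy_space \<inter> C_k 2" "TW c \<kappa> u"
  shows "\<exists>\<phi>. \<forall>x. u x = cis \<phi>"
proof -
  obtain u' p2 q2 where W: "finite_energy_wave c \<kappa> (\<lambda>x. Re (u x)) (\<lambda>x. Im (u x)) (\<lambda>x. Re (u' x)) (\<lambda>x. Im (u' x)) p2 q2"
    using assms(3,4) by (auto elim: finite_energy_waveE)
  show ?thesis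
    by (rule constant_phase_if_E_zero[OF W finite_energy_wave.E_zero_outside_DD[OF W assms(1,2)]])
qed

context wave_parameters
begin

text \<open>The slope \<open>s = - E' / E\<close> of the logarithm of the profile solves the scalar equation of \<open>S\<close>,
  whose solutions are translates of \<open>S\<close> because \<open>\<Phi>\<close> is a time map.\<close>
lemma profile_unique:
  assumes W: "finite_energy_wave c \<kappa> p q p1 q1 p2 q2"
    and nz: "finite_energy_wave.E p q x0 \<noteq> 0"
  shows "\<exists>\<xi>. \<forall>x. finite_energy_wave.E p q x = \<eta> (x - \<xi>)
    \<and> finite_energy_wave.E1 p q p1 q1 x = - S (x - \<xi>) * \<eta> (x - \<xi>)"
proof -
  interpret W: finite_energy_wave c \<kappa> p q p1 q1 p2 q2 by (rule W)
  let ?E = W.E and ?E1 = W.E1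
  have ab: "W.a = a" "W.b = b" by (simp_all add: W.a_def W.b_def a_def b_def)
  have t: "0 \<le> ?E x / a" "?E x / a \<le> 1" for x using W.E_range[of x] unfolding ab by auto
  \<comment> \<open>The number \<open>(b + \<kappa> * E) / d\<close> is a convex combination of
    \<open>b / d\<close> and \<open>1 / 2\<close> with weight \<open>E / a\<close>, so
    \<open>\<mu>\<close> bounds it from below.\<close>
  define \<mu> where "\<mu> = min (b / d) (1 / 2)"
  have bd: "b / d > 0" and ad: "a / d > 0" using signs by (auto simp: zero_less_divide_iff)
  then have \<mu>: "\<mu> > 0" by (simp add: \<mu>_def)
  have \<mu>_le: "\<mu> \<le> b / d" "\<mu> \<le> 1 / 2"
    unfolding \<mu>_def by (rule min.cobounded1, rule min.cobounded2)
  have den: "(b + \<kappa> * ?E x) / d \<ge> \<mu>" for x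
  proof -
    have "(b + \<kappa> * ?E x) / d = (b / d) * (1 - ?E x / a) + (1 / 2) * (?E x / a)"
    proof -
      have "(b / d) * (1 - ?E x / a) + (1 / 2) * (?E x / a) = (2 * b * (a - ?E x) + d * ?E x) / (2 * a * d)"
        using nonzero by (simp add: field_simps)
      also have "2 * b * (a - ?E x) + d * ?E x = 2 * a * (b + \<kappa> * ?E x)"
        by (simp add: d_eq algebra_simps)
      finally show ?thesis using nonzero by simp
    qed
    moreover have "\<mu> * (1 - ?E x / a) \<le> (b / d) * (1 - ?E x / a)"
      by (rule mult_right_mono) (use t[of x] \<mu>_le in simp_all)
    moreover have "\<mu> * (?E x / a) \<le> (1 / 2) * (?E x / a)"
      by (rule mult_right_mono) (use t[of x] \<mu>_le in simp_all)
    ultimately show ?thesis by (simp add: algebra_simps)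
  qed
  then have den_nz: "b + \<kappa> * ?E x \<noteq> 0" for x using \<mu> by (metis div_0 not_le)
  \<comment> \<open>Input for Gronwall's argument: a profile that is nonzero somewhere is nonzero
    everywhere, so the slope \<open>s\<close> is defined on the whole line.\<close>
  have bound: "(?E1 x)\<^sup>2 \<le> (a / d / \<mu>) * (?E x)\<^sup>2" for x
  proof -
    have "\<mu> * (?E1 x)\<^sup>2 \<le> (b + \<kappa> * ?E x) / d * (?E1 x)\<^sup>2" by (intro mult_right_mono den) simp
    also have "\<dots> = (?E1 x)\<^sup>2 * (b + \<kappa> * ?E x) / d" by simp
    also have "\<dots> = (?E x)\<^sup>2 * (a - ?E x) / d" using W.first_order[of x] unfolding ab by simp
    also have "\<dots> = (?E x)\<^sup>2 * ((a / d) * (1 - ?E x / a))" using nonzero by (simp add: field_simps)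
    also have "\<dots> \<le> (?E x)\<^sup>2 * ((a / d) * 1)" using t[of x] ad by (intro mult_left_mono) auto
    finally have "\<mu> * (?E1 x)\<^sup>2 / \<mu> \<le> (?E x)\<^sup>2 * ((a / d) * 1) / \<mu>"
      using \<mu> by (intro divide_right_mono) auto
    then show ?thesis using \<mu> by (simp add: mult.commute)
  qed
  have Enz: "?E x \<noteq> 0" for x using W.E_zero_everywhere[OF bound] nz by blast
  have EI: "?E x \<in> I" for x using t[of x] Enz[of x] nonzero by (auto simp: mem_I_iff le_less)
  define s where "s = (\<lambda>x. - ?E1 x / ?E x)"
  have s_sq: "(s x)\<^sup>2 * (b + \<kappa> * ?E x) = a - ?E x" for x
    using W.first_order[of x] Enz[of x] unfolding ab by (simp add: s_def power_divide field_simps)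
  have \<sigma>: "\<bar>s x\<bar> = \<sigma> (?E x)" for x
  proof -
    have "(2 - c\<^sup>2 - 2 * ?E x) = (s x)\<^sup>2 * (1 - 2 * \<kappa> + 2 * \<kappa> * ?E x)"
      using s_sq[of x] by (simp add: a_def b_def algebra_simps)
    moreover have "1 - 2 * \<kappa> + 2 * \<kappa> * ?E x \<noteq> 0" using den_nz[of x] by (simp add: b_def)
    ultimately show ?thesis by (simp add: \<sigma>_def)
  qed
  have s_sq_\<sigma>: "(\<sigma> (?E x))\<^sup>2 = (s x)\<^sup>2" for x unfolding \<sigma>[symmetric] by simp
  have s_range: "\<bar>s x\<bar> < 1 / m" for x using \<sigma>_props(1)[OF EI, of x] unfolding \<sigma>[symmetric] by simp
  have E_s: "?E x = N (s x) / (1 + \<kappa> * (s x)\<^sup>2)" for x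
    using \<sigma>_props(2)[OF EI, of x] unfolding N_def s_sq_\<sigma> .
  \<comment> \<open>The derivative of \<open>s\<close> is \<open>s\<^sup>2 - E2 / E\<close>;
    \<open>second_order\<close> gives \<open>E2\<close>, and \<open>E\<close> itself is then
    expressed through \<open>s\<close>.\<close>
  have ds: "(s has_real_derivative (1 + \<kappa> * (s x)\<^sup>2) * N (s x) / d) (at x)" for x
  proof -
    let ?p = "1 + \<kappa> * (s x)\<^sup>2" and ?n = "N (s x)"
    have p: "?p \<noteq> 0" using p_pos[of "s x"] s_range[of x] by simp
    have pE: "?p * ?E x = ?n" using E_s[of x] p by simp
    have den2: "2 * (b + \<kappa> * ?E x) = d / ?p"
      using ratio_profile(2)[OF s_range[of x]] unfolding E_s[symmetric] b_def by (simp add: algebra_simps)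
    have e1: "?E1 x = - s x * ?E x" using Enz[of x] by (simp add: s_def)
    have "W.E2 x * (2 * (b + \<kappa> * ?E x)) = 2 * W.E2 x * (b + \<kappa> * ?E x)" by (simp only: mult_ac)
    then have "W.E2 x * (2 * (b + \<kappa> * ?E x)) + \<kappa> * (?E1 x)\<^sup>2 = 2 * a * ?E x - 3 * (?E x)\<^sup>2"
      using W.second_order[of x] unfolding ab by (simp only:)
    then have so: "W.E2 x * (d / ?p) + \<kappa> * (s x * ?E x)\<^sup>2 = 2 * a * ?E x - 3 * (?E x)\<^sup>2"
      unfolding den2 e1 by simp
    have "W.E2 x * d = ?p * (W.E2 x * (d / ?p))" using p by simp
    also have "\<dots> = ?p * (2 * a * ?E x - 3 * (?E x)\<^sup>2 - \<kappa> * (s x * ?E x)\<^sup>2)"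
      unfolding eq_diff_eq[THEN iffD2, OF so] by (rule refl)
    also have "\<dots> = ?E x * (2 * a * ?p - 3 * (?p * ?E x) - \<kappa> * (s x)\<^sup>2 * (?p * ?E x))"
      by (simp add: algebra_simps power2_eq_square)
    finally have E2: "W.E2 x / ?E x = (2 * a * ?p - 3 * ?n - \<kappa> * (s x)\<^sup>2 * ?n) / d"
      unfolding pE using Enz[of x] nonzero by (simp add: field_simps)
    have "(s has_real_derivative ((- W.E2 x) * ?E x - (- ?E1 x) * ?E1 x) / (?E x * ?E x)) (at x)"
      unfolding s_def by (rule DERIV_divide[OF DERIV_minus[OF W.dE1] W.dE Enz])
    also have "((- W.E2 x) * ?E x - (- ?E1 x) * ?E1 x) / (?E x * ?E x) = (s x)\<^sup>2 - W.E2 x / ?E x"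
      using Enz[of x] by (simp add: s_def field_simps power2_eq_square)
    also have "\<dots> = ?p * ?n / d"
    proof -
      have "(s x)\<^sup>2 * d - (2 * a * ?p - 3 * ?n - \<kappa> * (s x)\<^sup>2 * ?n) = ?p * ?n"
        by (simp add: d_eq N_def algebra_simps)
      then show ?thesis unfolding E2 using nonzero by (simp add: field_simps)
    qed
    finally show ?thesis .
  qed
  \<comment> \<open>The centre of the wave: the slope vanishes there, which fixes the integration
    constant of the time map.\<close>
  obtain \<xi> where \<xi>: "?E1 \<xi> = 0" using W.extremum[OF nz] by blast
  have "((\<lambda>x. \<Phi> (s x) - x) has_real_derivative 0) (at x)" for x
  proof -
    have "((\<lambda>x. \<Phi> (s x)) has_real_derivative d / ((1 + \<kappa> * (s x)\<^sup>2) * N (s x)) * ((1 + \<kappa> * (s x)\<^sup>2) * N (s x) / d)) (at x)"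
      by (rule DERIV_chain2[OF \<Phi>_deriv[OF s_range] ds])
    moreover have "(1 + \<kappa> * (s x)\<^sup>2) * N (s x) \<noteq> 0"
      using \<Phi>_deriv_pos[OF s_range[of x]] by (intro notI) (simp only: div_by_0 less_irrefl)
    then have "d / ((1 + \<kappa> * (s x)\<^sup>2) * N (s x)) * ((1 + \<kappa> * (s x)\<^sup>2) * N (s x) / d) = 1"
      using nonzero by simp
    ultimately have "((\<lambda>x. \<Phi> (s x)) has_real_derivative 1) (at x)" by (rule DERIV_cong)
    from DERIV_diff[OF this DERIV_ident] show ?thesis by simp
  qed
  then have "\<Phi> (s x) - x = \<Phi> (s \<xi>) - \<xi>" for x
    using DERIV_isconst_all[of "\<lambda>x. \<Phi> (s x) - x" x \<xi>] by blast
  moreover have "s \<xi> = 0" using \<xi> by (simp add: s_def)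
  ultimately have "\<Phi> (s x) = x - \<xi>" for x by (simp add: algebra_simps)
  then have S: "S (x - \<xi>) = s x" for x by (intro S_eqI s_range)
  have "?E x = \<eta> (x - \<xi>) \<and> ?E1 x = - S (x - \<xi>) * \<eta> (x - \<xi>)" for x
    unfolding \<eta>_def S E_s[symmetric] using Enz[of x] by (simp add: s_def)
  then show ?thesis by blast
qed

text \<open>The real part of \<open>cnj v * v'\<close> is read off from the derivative of the
  profile, the imaginary part from the momentum. The product with \<open>cnj v\<close> replaces
  \<open>v' / v\<close> because \<open>v\<close> may vanish when \<open>c = 0\<close>.\<close>

lemma solution_profile:
  assumes v: "nontrivial_solution c \<kappa> v"
  obtains \<xi> v' where "\<And>x. (v has_vector_derivative v' x) (at x)" "continuous_on UNIV v'"
    "\<And>x. (cmod (v x))\<^sup>2 = 1 - \<eta> (x - \<xi>)"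
    "\<And>x. cnj (v x) * v' x = of_real (\<eta> (x - \<xi>) / 2) * (of_real (S (x - \<xi>)) + \<i> * of_real c)"
proof -
  obtain v' p2 q2 where W: "finite_energy_wave c \<kappa> (\<lambda>x. Re (v x)) (\<lambda>x. Im (v x)) (\<lambda>x. Re (v' x)) (\<lambda>x. Im (v' x)) p2 q2"
    and d: "\<And>x. (v has_vector_derivative v' x) (at x)" and cont: "continuous_on UNIV v'"
    using v unfolding nontrivial_solution_def by (auto elim: finite_energy_waveE)
  interpret W: finite_energy_wave c \<kappa> "\<lambda>x. Re (v x)" "\<lambda>x. Im (v x)" "\<lambda>x. Re (v' x)" "\<lambda>x. Im (v' x)" p2 q2
    by (rule W)
  have "\<exists>x. W.E x \<noteq> 0"
  proof (rule ccontr)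
    assume "\<not> (\<exists>x. W.E x \<noteq> 0)"
    then obtain \<phi> where "\<forall>x. v x = cis \<phi>" using constant_phase_if_E_zero[OF W] by blast
    then have "v = (\<lambda>_. cis \<phi>)" by auto
    then have "trivial_solution v" unfolding trivial_solution_def by (intro exI[of _ "cis \<phi>"]) simp
    then show False using v unfolding nontrivial_solution_def by blast
  qed
  then obtain \<xi> where \<xi>: "\<And>x. W.E x = \<eta> (x - \<xi>)" "\<And>x. W.E1 x = - S (x - \<xi>) * \<eta> (x - \<xi>)"
    using profile_unique[OF W] by blast
  show ?thesis
  proof (rule that[OF d cont])
    show "(cmod (v x))\<^sup>2 = 1 - \<eta> (x - \<xi>)" for x
      using \<xi>(1)[of x] by (simp add: W.E_def cmod_power2)
    show "cnj (v x) * v' x = of_real (\<eta> (x - \<xi>) / 2) * (of_real (S (x - \<xi>)) + \<i> * of_real c)" for x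
    proof -
      have "Re (v x) * Re (v' x) + Im (v x) * Im (v' x) = \<eta> (x - \<xi>) / 2 * S (x - \<xi>)"
      proof -
        have "w = h / 2 * r" if "- 2 * w = - r * h" for w r h :: real using that by (simp add: mult.commute)
        then show ?thesis using \<xi>(2)[of x] unfolding W.E1_def .
      qed
      moreover have "Re (v x) * Im (v' x) - Im (v x) * Re (v' x) = \<eta> (x - \<xi>) / 2 * c"
        using W.momentum[of x] \<xi>(1)[of x] by simp
      ultimately show ?thesis by (simp add: complex_eq_iff)
    qed
  qed
qed

text \<open>As \<open>v\<close> has no zeros, dividing the last conclusion of
  \<open>solution_profile\<close> by \<open>\<bar>v\<bar>\<^sup>2\<close> gives
  \<open>v' = v * slope\<close>, shifted by \<open>\<xi>\<close>. The translated
  \<open>u_sol\<close> solves the same linear equation, and equal moduli make the constant quotient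
  a phase.\<close>

lemma unique_up_to_invariances_pos:
  assumes c: "c > 0" and v: "nontrivial_solution c \<kappa> v"
  shows "\<exists>\<phi> x0. v = (\<lambda>x. cis \<phi> * u_sol c \<kappa> (x - x0))"
proof -
  let ?u = "u_sol c \<kappa>"
  obtain \<xi> v' where d: "\<And>x. (v has_vector_derivative v' x) (at x)"
    and mod: "\<And>x. (cmod (v x))\<^sup>2 = 1 - \<eta> (x - \<xi>)"
    and vv': "\<And>x. cnj (v x) * v' x = of_real (\<eta> (x - \<xi>) / 2) * (of_real (S (x - \<xi>)) + \<i> * of_real c)"
    using solution_profile[OF v] by metis
  have pos: "1 - \<eta> y > 0" for y using \<eta>_less_1[OF c, of y] by simp
  have nz: "?u y \<noteq> 0" for y using pos[of y] norm_u_sol[of y] by auto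
  have v'_eq: "v' x = v x * slope (x - \<xi>)" for x
  proof -
    let ?r = "1 - \<eta> (x - \<xi>)"
    have vc: "v x * cnj (v x) = of_real ?r" using complex_norm_square[of "v x"] mod[of x] by simp
    have "of_real ?r * v' x = v x * (cnj (v x) * v' x)" unfolding vc[symmetric] by (simp add: mult_ac)
    also have "\<dots> = of_real ?r * (v x * slope (x - \<xi>))"
    proof -
      have "z * (complex_of_real (e / 2) * w) = of_real r * (z * (of_real (e / (2 * r)) * w))"
        if "r \<noteq> 0" for z w e r using that by simp
      moreover have "?r \<noteq> 0" using pos[of "x - \<xi>"] by simp
      ultimately show ?thesis unfolding vv' slope_eq[OF c] by blast
    qed
    finally show ?thesis using pos[of "x - \<xi>"] by simp
  qed
  have "((\<lambda>x. v x * inverse (?u (x - \<xi>))) has_vector_derivative 0) (at x within UNIV)" for x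
    by (rule quotient_derivative_zero[OF d has_vector_derivative_shift[OF u_sol_deriv[OF c]] nz])
      (simp add: v'_eq)
  then obtain k where k: "\<And>x. v x * inverse (?u (x - \<xi>)) = k"
    using has_vector_derivative_zero_constant[of UNIV "\<lambda>x. v x * inverse (?u (x - \<xi>))"] by auto
  have vk: "v x = k * ?u (x - \<xi>)" for x using k[of x] nz[of "x - \<xi>"] by (simp add: field_simps)
  have "cmod k = 1"
  proof -
    have "(cmod k)\<^sup>2 * (1 - \<eta> 0) = 1 * (1 - \<eta> 0)"
      using mod[of \<xi>] norm_u_sol[of 0] by (simp add: vk norm_mult power_mult_distrib)
    then have "(cmod k)\<^sup>2 = 1" using pos[of 0] by simp
    then show ?thesis by (simp add: power2_eq_1_iff) (use norm_ge_zero[of k] in linarith)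
  qed
  then obtain \<phi> where "k = cis \<phi>" using cis_if_unit by blast
  then have "v = (\<lambda>x. cis \<phi> * ?u (x - \<xi>))" using vk by auto
  then show ?thesis by blast
qed

text \<open>The quotient of \<open>v\<close> and the translated wave is undefined at their common
  zero \<open>\<xi>\<close>, so it is constant only on each half-line. Continuity of
  \<open>v'\<close> and the nonzero derivative of the wave at its zero force the two constants to
  agree; otherwise the phase could jump there.\<close>

lemma unique_up_to_invariances_black:
  assumes c0: "c = 0" and v: "nontrivial_solution c \<kappa> v"
  shows "\<exists>\<phi> x0. v = (\<lambda>x. cis \<phi> * u_sol c \<kappa> (x - x0))"
proof -
  let ?u = "u_sol c \<kappa>" and ?u' = "\<lambda>x. complex_of_real (N (S x) / Q x)"
  obtain \<xi> v' where d: "\<And>x. (v has_vector_derivative v' x) (at x)" and cont: "continuous_on UNIV v'"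
    and mod: "\<And>x. (cmod (v x))\<^sup>2 = 1 - \<eta> (x - \<xi>)"
    and vv': "\<And>x. cnj (v x) * v' x = of_real (\<eta> (x - \<xi>) / 2) * (of_real (S (x - \<xi>)) + \<i> * of_real c)"
    using solution_profile[OF v] by metis
  have du: "(?u has_vector_derivative ?u' x) (at x)" for x
    unfolding u_sol_black[OF c0, abs_def]
    by (rule has_vector_derivative_of_real_complex[OF u_sol_black_deriv[OF c0]])
  have cu: "continuous_on UNIV ?u'"
    by (intro continuous_at_imp_continuous_on ballI
        has_vector_derivative_continuous[OF has_vector_derivative_of_real_complex[OF u_sol_black_deriv2[OF c0]]])
  have Q: "Q x > 0" for x by (rule Q_pos[OF c0])
  have u0: "?u x = 0 \<longleftrightarrow> x = 0" for x
    using Q[of x] by (simp add: u_sol_black[OF c0] S_eq_0_iff)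
  have cross: "v' x * ?u (x - \<xi>) = v x * ?u' (x - \<xi>)" for x
  proof (cases "v x = 0")
    case True
    then have "?u (x - \<xi>) = 0" using mod[of x] norm_u_sol[of "x - \<xi>"] by simp
    then show ?thesis using True by simp
  next
    case False
    let ?y = "x - \<xi>"
    have vc: "cnj (v x) * v x = of_real (1 - \<eta> ?y)"
      using complex_norm_square[of "v x"] mod[of x] by (simp add: mult.commute)
    have "cnj (v x) * (v' x * ?u ?y - v x * ?u' ?y) = (cnj (v x) * v' x) * ?u ?y - (cnj (v x) * v x) * ?u' ?y"
      by (simp add: algebra_simps)
    also have "\<dots> = of_real (\<eta> ?y / 2 * S ?y * (S ?y / Q ?y) - (1 - \<eta> ?y) * (N (S ?y) / Q ?y))"
    proof -
      have "of_real (S ?y) + \<i> * of_real c = complex_of_real (S ?y)" using c0 by simp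
      then show ?thesis unfolding vv' vc u_sol_black[OF c0] by simp
    qed
    also have "\<eta> ?y / 2 * S ?y * (S ?y / Q ?y) - (1 - \<eta> ?y) * (N (S ?y) / Q ?y) = 0"
    proof -
      have "n / p / 2 * s * (s / r) - s\<^sup>2 / (2 * p) * (n / r) = 0" for n p s r :: real
        by (simp add: power2_eq_square)
      note gen = this
      have cs: "c\<^sup>2 + (S ?y)\<^sup>2 = (S ?y)\<^sup>2" using c0 by simp
      show ?thesis unfolding one_minus_\<eta> cs unfolding \<eta>_def by (rule gen)
    qed
    finally show ?thesis using False by simp
  qed
  have der: "((\<lambda>x. v x * inverse (?u (x - \<xi>))) has_vector_derivative 0) (at x)" if "x \<noteq> \<xi>" for x
    by (rule quotient_derivative_zero[OF d has_vector_derivative_shift[OF du] _ cross]) (use that u0 in simp)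
  have "\<exists>k. \<forall>x\<in>X. v x = k * ?u (x - \<xi>) \<and> v' x = k * ?u' (x - \<xi>)" if X: "convex X" "\<xi> \<notin> X" for X
  proof -
    have "((\<lambda>x. v x * inverse (?u (x - \<xi>))) has_vector_derivative 0) (at x within X)" if "x \<in> X" for x
      using der X that by (metis has_vector_derivative_at_within)
    from has_vector_derivative_zero_constant[OF X(1) this]
    obtain k where k: "\<And>x. x \<in> X \<Longrightarrow> v x * inverse (?u (x - \<xi>)) = k" by blast
    have "v x = k * ?u (x - \<xi>) \<and> v' x = k * ?u' (x - \<xi>)" if "x \<in> X" for x
    proof -
      have nz: "?u (x - \<xi>) \<noteq> 0" using that X(2) u0 by auto
      then have 1: "v x = k * ?u (x - \<xi>)" using k[OF that] by (simp add: field_simps)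
      have "v' x * ?u (x - \<xi>) = k * ?u' (x - \<xi>) * ?u (x - \<xi>)"
        unfolding cross 1 by (simp only: mult_ac)
      then show ?thesis using nz 1 mult_right_cancel[OF nz] by blast
    qed
    then show ?thesis by blast
  qed
  note half = this
  obtain k1 where k1: "\<And>x. x > \<xi> \<Longrightarrow> v x = k1 * ?u (x - \<xi>)" "\<And>x. x > \<xi> \<Longrightarrow> v' x = k1 * ?u' (x - \<xi>)"
    using half[of "{\<xi><..}"] by auto
  obtain k2 where k2: "\<And>x. x < \<xi> \<Longrightarrow> v x = k2 * ?u (x - \<xi>)" "\<And>x. x < \<xi> \<Longrightarrow> v' x = k2 * ?u' (x - \<xi>)"
    using half[of "{..<\<xi>}"] by auto
  \<comment> \<open>Carries the formulas for \<open>v'\<close> from the open half-lines to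
    \<open>\<xi>\<close>.\<close>
  have closed: "closed {x. v' x = k * ?u' (x - \<xi>)}" for k
  proof (rule closed_Collect_eq[OF cont])
    show "continuous_on UNIV (\<lambda>x. k * ?u' (x - \<xi>))"
      by (intro continuous_on_mult_left continuous_on_compose2[OF cu] continuous_intros) auto
  qed
  have "closure {\<xi><..} \<subseteq> {x. v' x = k1 * ?u' (x - \<xi>)}" "closure {..<\<xi>} \<subseteq> {x. v' x = k2 * ?u' (x - \<xi>)}"
    by (rule closure_minimal[OF _ closed]; use k1 k2 in auto)+
  then have "v' \<xi> = k1 * ?u' 0" "v' \<xi> = k2 * ?u' 0" by auto
  moreover have "?u' 0 \<noteq> 0" using Q[of 0] nonzero by (simp add: N_def)
  ultimately have k12: "k1 = k2" by simp
  have vk: "v x = k1 * ?u (x - \<xi>)" for x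
  proof -
    have "v \<xi> = 0" using mod[of \<xi>] norm_u_sol[of 0] u0[of 0] by simp
    then show ?thesis using k1(1)[of x] k2(1)[of x] k12 u0[of 0] by (cases x \<xi> rule: linorder_cases) auto
  qed
  \<comment> \<open>The moduli are compared at distance 1 from the centre, since both waves vanish
    at the centre itself.\<close>
  have "cmod k1 = 1"
  proof -
    have "(cmod k1)\<^sup>2 * (cmod (?u 1))\<^sup>2 = 1 * (cmod (?u 1))\<^sup>2"
      using mod[of "\<xi> + 1"] norm_u_sol[of 1] by (simp add: vk norm_mult power_mult_distrib)
    moreover have "(cmod (?u 1))\<^sup>2 \<noteq> 0" using u0[of 1] by simp
    ultimately have "(cmod k1)\<^sup>2 = 1" by simp
    then show ?thesis by (simp add: power2_eq_1_iff) (use norm_ge_zero[of k1] in linarith)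
  qed
  then obtain \<phi> where "k1 = cis \<phi>" using cis_if_unit by blast
  then have "v = (\<lambda>x. cis \<phi> * ?u (x - \<xi>))" using vk by auto
  then show ?thesis by blast
qed

lemma u_sol_unique: "unique_nontrivial_solution c \<kappa> (u_sol c \<kappa>)"
proof (cases "c = 0")
  case True
  then show ?thesis unfolding unique_nontrivial_solution_def
    using nontrivial_u_sol_black unique_up_to_invariances_black by blast
next
  case False
  then have "c > 0" using c_nonneg by simp
  then show ?thesis unfolding unique_nontrivial_solution_def
    using nontrivial_u_sol_pos unique_up_to_invariances_pos by blast
qed

lemma u_sol_derivative:
  obtains u' where "\<And>x. (u_sol c \<kappa> has_vector_derivative u' x) (at x)" "\<And>n. decays rate n u'" "\<And>n. decays 0 n (u_sol c \<kappa>)"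
proof (cases "c = 0")
  case True
  show ?thesis
  proof (rule that)
    show "(u_sol c \<kappa> has_vector_derivative of_real (N (S x) / Q x)) (at x)" for x
      unfolding u_sol_black[OF True, abs_def]
      by (rule has_vector_derivative_of_real_complex[OF u_sol_black_deriv[OF True]])
  qed (rule u_sol_black_deriv_exp[OF True] u_sol_black_smooth[OF True])+
next
  case False
  then have c: "c > 0" using c_nonneg by simp
  show ?thesis by (rule that[OF u_sol_deriv u_sol_deriv_exp u_sol_smooth_pos]) (rule c)+
qed

lemma derivative_decay:
  "\<exists>A>0. \<exists>C>0. \<forall>x. cmod (iter_deriv k (iter_deriv 1 (u_sol c \<kappa>)) x) + \<bar>iter_deriv k (eta c \<kappa>) x\<bar>
     \<le> A * exp (- C * \<bar>x\<bar>)"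
proof -
  obtain u' where u': "\<And>x. (u_sol c \<kappa> has_vector_derivative u' x) (at x)" "\<And>n. decays rate n u'"
    by (rule u_sol_derivative) blast
  have "exp_dominated rate (iter_deriv k u')" using decays_iter_deriv[OF u'(2)[of k], of k] by simp
  then obtain A1 where A1: "A1 > 0" "\<And>x. cmod (iter_deriv k u' x) \<le> A1 * exp (- rate * \<bar>x\<bar>)"
    by (rule exp_dominated_pos) blast
  have "exp_dominated rate (iter_deriv k \<eta>)" using decays_iter_deriv[OF decays_\<eta>[of k], of k] by simp
  then obtain A2 where A2: "A2 > 0" "\<And>x. norm (iter_deriv k \<eta> x) \<le> A2 * exp (- rate * \<bar>x\<bar>)"
    by (rule exp_dominated_pos) blast
  have "cmod (iter_deriv k u' x) + \<bar>iter_deriv k \<eta> x\<bar> \<le> (A1 + A2) * exp (- rate * \<bar>x\<bar>)" for x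
    using A1(2)[of x] A2(2)[of x] by (simp add: distrib_right)
  then show ?thesis
    unfolding eta_fun iter_deriv_1_eqI(1)[OF u'(1)] using A1(1) A2(1) rate_pos
    by (intro exI[of _ "A1 + A2"] conjI exI[of _ rate]) auto
qed

lemma \<eta>_signs:
  "a > 0 \<Longrightarrow> \<eta> x > 0" "a > 0 \<Longrightarrow> \<eta> x \<le> a" "a < 0 \<Longrightarrow> \<eta> x < 0" "a < 0 \<Longrightarrow> a \<le> \<eta> x"
  using \<eta>_in_I[of x] by (auto simp: mem_I_iff zero_less_divide_iff divide_le_eq)

end

theorem theorem1p1:
  fixes c \<kappa> :: real
  assumes "c \<ge> 0"
  shows
    "((c, \<kappa>) \<notin> DD \<longrightarrow>
        (\<forall>u \<in> energy_space \<inter> C_k 2. TW c \<kappa> u \<longrightarrow> (\<exists>\<phi>. \<forall>x. u x = cis \<phi>)))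
     \<and>
     ((c, \<kappa>) \<in> DD \<longrightarrow>
        (c > 0 \<longrightarrow> (\<forall>x. eta c \<kappa> x < 1) \<and> unique_nontrivial_solution c \<kappa> (u_sol c \<kappa>))
      \<and> (c = 0 \<longrightarrow>
           (\<forall>x. u_sol c \<kappa> x \<in> \<real>) \<and> (\<forall>x. u_sol c \<kappa> (- x) = - u_sol c \<kappa> x)
           \<and> unique_nontrivial_solution c \<kappa> (u_sol c \<kappa>))
      \<and> u_sol c \<kappa> \<in> C_infinity
      \<and> (\<forall>x. eta c \<kappa> (- x) = eta c \<kappa> x)
      \<and> ((\<forall>x. eta c \<kappa> x \<le> eta c \<kappa> 0) \<or> (\<forall>x. eta c \<kappa> 0 \<le> eta c \<kappa> x))
      \<and> eta c \<kappa> 0 = 1 - c\<^sup>2 / 2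
      \<and> eta c \<kappa> \<in> C_infinity
      \<and> ((c, \<kappa>) \<in> D1 \<union> D2 \<longrightarrow> (\<forall>x>0. eta c \<kappa> x > 0 \<and> iter_deriv 1 (eta c \<kappa>) x < 0))
      \<and> ((c, \<kappa>) \<in> D3 \<longrightarrow> (\<forall>x>0. eta c \<kappa> x < 0 \<and> iter_deriv 1 (eta c \<kappa>) x > 0))
      \<and> (\<forall>k. \<exists>A>0. \<exists>C>0. \<forall>x.
           cmod (iter_deriv k (iter_deriv 1 (u_sol c \<kappa>)) x) + \<bar>iter_deriv k (eta c \<kappa>) x\<bar>
             \<le> A * exp (- C * \<bar>x\<bar>)))"
proof (intro conjI[of "(c, \<kappa>) \<notin> DD \<longrightarrow> _"] impI)
  assume "(c, \<kappa>) \<notin> DD"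
  then show "\<forall>u \<in> energy_space \<inter> C_k 2. TW c \<kappa> u \<longrightarrow> (\<exists>\<phi>. \<forall>x. u x = cis \<phi>)"
    using trivial_outside_DD[OF assms] by blast
next
  assume "(c, \<kappa>) \<in> DD"
  then interpret wave_parameters c \<kappa> using assms by unfold_locales
  have gray: "c > 0 \<longrightarrow> (\<forall>x. \<eta> x < 1) \<and> unique_nontrivial_solution c \<kappa> (u_sol c \<kappa>)"
    using \<eta>_less_1 u_sol_unique by blast
  have "u_sol c \<kappa> x \<in> \<real>" "u_sol c \<kappa> (- x) = - u_sol c \<kappa> x" if "c = 0" for x
    unfolding u_sol_black[OF that] by (simp_all add: S_minus Q_def[OF that])
  then have black: "c = 0 \<longrightarrow> (\<forall>x. u_sol c \<kappa> x \<in> \<real>) \<and> (\<forall>x. u_sol c \<kappa> (- x) = - u_sol c \<kappa> x)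
      \<and> unique_nontrivial_solution c \<kappa> (u_sol c \<kappa>)"
    using u_sol_unique by blast
  have smooth: "u_sol c \<kappa> \<in> C_infinity"
    by (rule u_sol_derivative) (rule decays_imp_C_infinity)
  \<comment> \<open>A maximum if \<open>a > 0\<close> and a minimum if \<open>a < 0\<close>.\<close>
  have extremum: "(\<forall>x. \<eta> x \<le> \<eta> 0) \<or> (\<forall>x. \<eta> 0 \<le> \<eta> x)"
    unfolding \<eta>_0 using nonzero(1) \<eta>_signs by (metis linorder_neqE_linordered_idom)
  have even: "\<forall>x. \<eta> (- x) = \<eta> x" and origin: "\<eta> 0 = 1 - c\<^sup>2 / 2"
    by (simp_all add: \<eta>_minus \<eta>_0 a_def)
  have decay: "\<forall>k. \<exists>A>0. \<exists>C>0. \<forall>x. cmod (iter_deriv k (iter_deriv 1 (u_sol c \<kappa>)) x) + \<bar>iter_deriv k \<eta> x\<bar>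
      \<le> A * exp (- C * \<bar>x\<bar>)"
    using derivative_decay[unfolded eta_fun] by blast
  have pos: "(c, \<kappa>) \<in> D1 \<union> D2 \<longrightarrow> (\<forall>x>0. \<eta> x > 0 \<and> iter_deriv 1 \<eta> x < 0)"
    unfolding \<eta>_iter_deriv using \<eta>_signs(1)[OF D12_pos(1)] S_pos by (simp add: mult_pos_pos)
  have neg: "(c, \<kappa>) \<in> D3 \<longrightarrow> (\<forall>x>0. \<eta> x < 0 \<and> iter_deriv 1 \<eta> x > 0)"
    unfolding \<eta>_iter_deriv using \<eta>_signs(3)[OF D3_neg(1)] S_pos by (simp add: mult_pos_neg)
  have C: "\<eta> \<in> C_infinity" by (rule decays_imp_C_infinity) (rule decays_\<eta>)
  show "(c > 0 \<longrightarrow> (\<forall>x. eta c \<kappa> x < 1) \<and> unique_nontrivial_solution c \<kappa> (u_sol c \<kappa>))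
      \<and> (c = 0 \<longrightarrow>
           (\<forall>x. u_sol c \<kappa> x \<in> \<real>) \<and> (\<forall>x. u_sol c \<kappa> (- x) = - u_sol c \<kappa> x)
           \<and> unique_nontrivial_solution c \<kappa> (u_sol c \<kappa>))
      \<and> u_sol c \<kappa> \<in> C_infinity
      \<and> (\<forall>x. eta c \<kappa> (- x) = eta c \<kappa> x)
      \<and> ((\<forall>x. eta c \<kappa> x \<le> eta c \<kappa> 0) \<or> (\<forall>x. eta c \<kappa> 0 \<le> eta c \<kappa> x))
      \<and> eta c \<kappa> 0 = 1 - c\<^sup>2 / 2
      \<and> eta c \<kappa> \<in> C_infinity
      \<and> ((c, \<kappa>) \<in> D1 \<union> D2 \<longrightarrow> (\<forall>x>0. eta c \<kappa> x > 0 \<and> iter_deriv 1 (eta c \<kappa>) x < 0))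
      \<and> ((c, \<kappa>) \<in> D3 \<longrightarrow> (\<forall>x>0. eta c \<kappa> x < 0 \<and> iter_deriv 1 (eta c \<kappa>) x > 0))
      \<and> (\<forall>k. \<exists>A>0. \<exists>C>0. \<forall>x.
           cmod (iter_deriv k (iter_deriv 1 (u_sol c \<kappa>)) x) + \<bar>iter_deriv k (eta c \<kappa>) x\<bar>
             \<le> A * exp (- C * \<bar>x\<bar>))"
    unfolding eta_fun
    by (intro conjI; (rule gray black smooth even extremum origin C pos neg decay))
qed

end
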